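(* Let $\alpha>1$ be a constant, let $(M,g)$ be a compact Riemannian manifold, and let $(N,h)$ be a Riemannian manifold with non-positive Riemannian (i.e. sectional) curvature. Then any $\alpha$-harmonic map $\psi:(M,g)\to(N,h)$ is stable.
   Context: For a smooth map $\psi:(M,g)\to(N,h)$, $|d\psi|$ denotes the Hilbert–Schmidt norm of $d\psi$ with respect to $g$ and $h$. For a constant $\alpha>1$, $\psi$ is $\alpha$-harmonic if it is a critical point (with respect to smooth variations) of $E_\alpha(\psi)=\int_M(1+|d\psi|^2)^\alpha\,dV_g$. For an $\alpha$-harmonic map $\psi$ and a smooth 2-parameter variation $\{\psi_{t,s}:M\to N\}_{-\epsilon<s,t<\epsilon}$ with $\psi_{0,0}=\psi$, $\upsilon=\frac{\partial\psi_{t,s}}{\partial t}\big|_{s=t=0}$ and $\omega=\frac{\partial\psi_{t,s}}{\partial s}\big|_{s=t=0}$, set $I(\upsilon,\omega)=\frac{\partial^2}{\partial t\,\partial s}E_\alpha(\psi_{t,s})\big|_{s=t=0}$ (this depends only on $\upsilon,\omega\in\Gamma(\psi^{-1}TN)$). The $\alpha$-harmonic map $\psi$ is stable if $I(\upsilon,\upsilon)\ge0$ for every compactly supported vector field $\upsilon$ along $\psi$. *)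

theory Defs
  imports "HOL-Analysis.Analysis"
begin

section \<open>Smooth maps between Euclidean spaces\<close>

primrec times_diff_on ::
  "nat \<Rightarrow> 'e::real_normed_vector set \<Rightarrow> ('e \<Rightarrow> 'f::real_normed_vector) \<Rightarrow> bool" where
  "times_diff_on 0 S f \<longleftrightarrow> continuous_on S f"
| "times_diff_on (Suc k) S f \<longleftrightarrow>
     (\<forall>x\<in>S. f differentiable (at x)) \<and>
     (\<forall>v. times_diff_on k S (\<lambda>x. frechet_derivative f (at x) v))"

text \<open>Only used for open \<open>S\<close>: differentiability is taken with respect to the full filter
  \<open>at x\<close>.\<close>

definition smooth_on ::
  "'e::real_normed_vector set \<Rightarrow> ('e \<Rightarrow> 'f::real_normed_vector) \<Rightarrow> bool" where
  "smooth_on S f \<longleftrightarrow> (\<forall>k. times_diff_on k S f)"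

section \<open>Riemannian manifolds\<close>

text \<open>The underlying set of a manifold is a whole type. A chart is a pair of its domain and
  its coordinate map; only the values of the coordinate map on the domain matter.\<close>

type_synonym ('a, 'e) chart = "'a set \<times> ('a \<Rightarrow> 'e)"

abbreviation chart_dom :: "('a, 'e) chart \<Rightarrow> 'a set" where
  "chart_dom c \<equiv> fst c"

abbreviation chart_map :: "('a, 'e) chart \<Rightarrow> 'a \<Rightarrow> 'e" where
  "chart_map c \<equiv> snd c"

abbreviation chart_inv :: "('a, 'e) chart \<Rightarrow> 'e \<Rightarrow> 'a" where
  "chart_inv c \<equiv> inv_into (chart_dom c) (chart_map c)"

definition is_chart :: "('a::topological_space, 'e::euclidean_space) chart \<Rightarrow> bool" where
  "is_chart c \<longleftrightarrow> open (chart_dom c) \<and> open (chart_map c ` chart_dom c) \<and>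
     homeomorphism (chart_dom c) (chart_map c ` chart_dom c) (chart_map c) (chart_inv c)"

definition transition :: "('a, 'e) chart \<Rightarrow> ('a, 'e) chart \<Rightarrow> 'e \<Rightarrow> 'e" where
  "transition c c' = (\<lambda>y. chart_map c' (chart_inv c y))"

definition smooth_atlas ::
  "('a::{t2_space,second_countable_topology}, 'e::euclidean_space) chart set \<Rightarrow> bool" where
  "smooth_atlas A \<longleftrightarrow> (\<forall>c\<in>A. is_chart c) \<and> (\<Union>c\<in>A. chart_dom c) = UNIV \<and>
     (\<forall>c\<in>A. \<forall>c'\<in>A. smooth_on (chart_map c ` (chart_dom c \<inter> chart_dom c')) (transition c c'))"

text \<open>A tangent vector at \<open>x\<close> is given by its components, one vector of the model space for each
  chart around \<open>x\<close>, related by the derivatives of the transition maps. Accordingly a metric is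
  given by its components \<open>metric M c x\<close>, a bilinear form on the model space for each chart \<open>c\<close> of
  the atlas and each point \<open>x\<close> of its domain.\<close>

record ('a, 'e) riem =
  atlas :: "('a, 'e) chart set"
  metric :: "('a, 'e) chart \<Rightarrow> 'a \<Rightarrow> 'e \<Rightarrow> 'e \<Rightarrow> real"

definition riemannian_manifold ::
  "('a::{t2_space,second_countable_topology}, 'e::euclidean_space) riem \<Rightarrow> bool" where
  "riemannian_manifold M \<longleftrightarrow> smooth_atlas (atlas M) \<and>
     (\<forall>c\<in>atlas M.
        (\<forall>x\<in>chart_dom c. bilinear (metric M c x) \<and>
           (\<forall>u v. metric M c x u v = metric M c x v u) \<and>
           (\<forall>u. u \<noteq> 0 \<longrightarrow> metric M c x u u > 0)) \<and>
        (\<forall>u v. smooth_on (chart_map c ` chart_dom c) (\<lambda>y. metric M c (chart_inv c y) u v))) \<and>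
     (\<forall>c\<in>atlas M. \<forall>c'\<in>atlas M. \<forall>x\<in>chart_dom c \<inter> chart_dom c'. \<forall>u v.
        metric M c x u v =
          metric M c' x (frechet_derivative (transition c c') (at (chart_map c x)) u)
                        (frechet_derivative (transition c c') (at (chart_map c x)) v))"

text \<open>The Riemannian volume measure \<open>dV\<^sub>g\<close>: the Borel measure with density
  \<open>sqrt (det (g\<^sub>i\<^sub>j))\<close> in every chart. These conditions determine it uniquely,
  since countably many charts cover the manifold.\<close>

definition volume_density ::
  "('a, real^'m) riem \<Rightarrow> ('a, real^'m) chart \<Rightarrow> 'a \<Rightarrow> real" where
  "volume_density M c x = sqrt (det (\<chi> i j. metric M c x (axis i 1) (axis j 1)))"

definition riemannian_volume ::
  "('a::{t2_space,second_countable_topology}, real^'m) riem \<Rightarrow> 'a measure \<Rightarrow> bool" where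
  "riemannian_volume M vol \<longleftrightarrow> sets vol = sets borel \<and>
     (\<forall>c\<in>atlas M. \<forall>S\<in>sets borel. S \<subseteq> chart_dom c \<longrightarrow>
        emeasure vol S =
          (\<integral>\<^sup>+ y. ennreal (volume_density M c (chart_inv c y)) * indicator (chart_map c ` S) y
             \<partial>lborel))"

section \<open>Sectional curvature\<close>

text \<open>\<open>k y\<close> is a metric on an open set of coordinates. The Christoffel form
  \<open>\<Gamma>\<^sub>y(u,v)\<close> is the covariant derivative of the constant field \<open>v\<close> in direction \<open>u\<close>, as given
  by the Koszul formula for the Levi-Civita connection.\<close>

definition christoffel ::
  "('e::euclidean_space \<Rightarrow> 'e \<Rightarrow> 'e \<Rightarrow> real) \<Rightarrow> 'e \<Rightarrow> 'e \<Rightarrow> 'e \<Rightarrow> 'e" where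
  "christoffel k y u v = (THE z. \<forall>w. 2 * k y z w =
       frechet_derivative (\<lambda>p. k p v w) (at y) u
     + frechet_derivative (\<lambda>p. k p u w) (at y) v
     - frechet_derivative (\<lambda>p. k p u v) (at y) w)"

text \<open>\<open>R(u,v)w = \<nabla>\<^sub>u\<nabla>\<^sub>v w - \<nabla>\<^sub>v\<nabla>\<^sub>u w\<close> for constant coordinate fields; with this sign
  \<open>\<langle>R(u,v)v,u\<rangle>\<close> is positive on round spheres.\<close>

definition riemann_curvature ::
  "('e::euclidean_space \<Rightarrow> 'e \<Rightarrow> 'e \<Rightarrow> real) \<Rightarrow> 'e \<Rightarrow> 'e \<Rightarrow> 'e \<Rightarrow> 'e \<Rightarrow> 'e" where
  "riemann_curvature k y u v w =
       frechet_derivative (\<lambda>p. christoffel k p v w) (at y) u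
     - frechet_derivative (\<lambda>p. christoffel k p u w) (at y) v
     + christoffel k y u (christoffel k y v w)
     - christoffel k y v (christoffel k y u w)"

definition coord_metric ::
  "('a, 'e) riem \<Rightarrow> ('a, 'e) chart \<Rightarrow> 'e \<Rightarrow> 'e \<Rightarrow> 'e \<Rightarrow> real" where
  "coord_metric M c = (\<lambda>y. metric M c (chart_inv c y))"

definition sectional_curvature ::
  "('a, 'e::euclidean_space) riem \<Rightarrow> ('a, 'e) chart \<Rightarrow> 'a \<Rightarrow> 'e \<Rightarrow> 'e \<Rightarrow> real" where
  "sectional_curvature M c x u v =
     metric M c x (riemann_curvature (coord_metric M c) (chart_map c x) u v v) u /
     (metric M c x u u * metric M c x v v - (metric M c x u v)\<^sup>2)"

definition nonpositive_sectional_curvature ::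
  "('a, 'e::euclidean_space) riem \<Rightarrow> bool" where
  "nonpositive_sectional_curvature M \<longleftrightarrow>
     (\<forall>c\<in>atlas M. \<forall>x\<in>chart_dom c. \<forall>u v.
        u \<noteq> v \<and> independent {u, v} \<longrightarrow> sectional_curvature M c x u v \<le> 0)"

section \<open>Smooth maps, families of maps and vector fields along maps\<close>

definition coord_rep ::
  "('a, 'e) chart \<Rightarrow> ('b, 'f) chart \<Rightarrow> ('a \<Rightarrow> 'b) \<Rightarrow> 'e \<Rightarrow> 'f" where
  "coord_rep c d \<psi> = (\<lambda>y. chart_map d (\<psi> (chart_inv c y)))"

definition smooth_map ::
  "('a::topological_space, 'e::euclidean_space) riem \<Rightarrow>
   ('b::topological_space, 'f::euclidean_space) riem \<Rightarrow> ('a \<Rightarrow> 'b) \<Rightarrow> bool" where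
  "smooth_map M N \<psi> \<longleftrightarrow> continuous_on UNIV \<psi> \<and>
     (\<forall>c\<in>atlas M. \<forall>d\<in>atlas N.
        smooth_on (chart_map c ` (chart_dom c \<inter> \<psi> -` chart_dom d)) (coord_rep c d \<psi>))"

text \<open>Smoothness of \<open>(p, x) \<mapsto> F p x\<close> on \<open>P \<times> M\<close>, for an open set \<open>P\<close> of parameters.\<close>

definition smooth_family ::
  "'p::euclidean_space set \<Rightarrow> ('a::topological_space, 'e::euclidean_space) riem \<Rightarrow>
   ('b::topological_space, 'f::euclidean_space) riem \<Rightarrow> ('p \<Rightarrow> 'a \<Rightarrow> 'b) \<Rightarrow> bool" where
  "smooth_family P M N F \<longleftrightarrow> continuous_on (P \<times> UNIV) (\<lambda>(p, x). F p x) \<and>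
     (\<forall>c\<in>atlas M. \<forall>d\<in>atlas N.
        smooth_on {(p, chart_map c x) | p x. p \<in> P \<and> x \<in> chart_dom c \<and> F p x \<in> chart_dom d}
          (\<lambda>(p, y). coord_rep c d (F p) y))"

text \<open>A smooth section of \<open>\<psi>\<^sup>-\<^sup>1TN\<close>: \<open>\<upsilon> d x\<close> are the components in the chart \<open>d\<close> of \<open>N\<close> of the
  vector at \<open>\<psi> x\<close>.\<close>

definition vector_field_along ::
  "('a::topological_space, 'e::euclidean_space) riem \<Rightarrow>
   ('b::topological_space, 'f::euclidean_space) riem \<Rightarrow>
   ('a \<Rightarrow> 'b) \<Rightarrow> (('b, 'f) chart \<Rightarrow> 'a \<Rightarrow> 'f) \<Rightarrow> bool" where
  "vector_field_along M N \<psi> \<upsilon> \<longleftrightarrow>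
     (\<forall>d\<in>atlas N. \<forall>d'\<in>atlas N. \<forall>x. \<psi> x \<in> chart_dom d \<inter> chart_dom d' \<longrightarrow>
        \<upsilon> d' x = frechet_derivative (transition d d') (at (chart_map d (\<psi> x))) (\<upsilon> d x)) \<and>
     (\<forall>c\<in>atlas M. \<forall>d\<in>atlas N.
        smooth_on (chart_map c ` (chart_dom c \<inter> \<psi> -` chart_dom d)) (\<lambda>y. \<upsilon> d (chart_inv c y)))"

definition field_support ::
  "('b, 'f::zero) riem \<Rightarrow> ('a::topological_space \<Rightarrow> 'b) \<Rightarrow>
   (('b, 'f) chart \<Rightarrow> 'a \<Rightarrow> 'f) \<Rightarrow> 'a set" where
  "field_support N \<psi> \<upsilon> = closure {x. \<exists>d\<in>atlas N. \<psi> x \<in> chart_dom d \<and> \<upsilon> d x \<noteq> 0}"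

definition has_velocity ::
  "('b, 'f::real_normed_vector) riem \<Rightarrow> (real \<Rightarrow> 'a \<Rightarrow> 'b) \<Rightarrow>
   (('b, 'f) chart \<Rightarrow> 'a \<Rightarrow> 'f) \<Rightarrow> bool" where
  "has_velocity N \<gamma> \<upsilon> \<longleftrightarrow>
     (\<forall>d\<in>atlas N. \<forall>x. \<gamma> 0 x \<in> chart_dom d \<longrightarrow>
        ((\<lambda>t. chart_map d (\<gamma> t x)) has_vector_derivative \<upsilon> d x) (at 0))"

section \<open>The \<open>\<alpha>\<close>-energy, \<open>\<alpha>\<close>-harmonic maps and stability\<close>

definition orthonormal_basis :: "('e::real_vector \<Rightarrow> 'e \<Rightarrow> real) \<Rightarrow> 'e set \<Rightarrow> bool" where
  "orthonormal_basis k b \<longleftrightarrow> span b = UNIV \<and> (\<forall>u\<in>b. \<forall>v\<in>b. k u v = (if u = v then 1 else 0))"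

text \<open>The Hilbert--Schmidt norm of the differential at \<open>x\<close>; it does not depend on the chosen
  charts and orthonormal basis.\<close>

definition chart_at :: "('a, 'e) riem \<Rightarrow> 'a \<Rightarrow> ('a, 'e) chart" where
  "chart_at M x = (SOME c. c \<in> atlas M \<and> x \<in> chart_dom c)"

definition hs_norm_diff ::
  "('a, 'e::euclidean_space) riem \<Rightarrow> ('b, 'f::euclidean_space) riem \<Rightarrow>
   ('a \<Rightarrow> 'b) \<Rightarrow> 'a \<Rightarrow> real" where
  "hs_norm_diff M N \<psi> x =
     (let c = chart_at M x; d = chart_at N (\<psi> x);
          D = frechet_derivative (coord_rep c d \<psi>) (at (chart_map c x));
          b = (SOME b. orthonormal_basis (metric M c x) b)
      in sqrt (\<Sum>e\<in>b. metric N d (\<psi> x) (D e) (D e)))"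

definition alpha_energy ::
  "real \<Rightarrow> 'a measure \<Rightarrow> ('a, 'e::euclidean_space) riem \<Rightarrow> ('b, 'f::euclidean_space) riem \<Rightarrow>
   ('a \<Rightarrow> 'b) \<Rightarrow> real" where
  "alpha_energy \<alpha> vol M N \<psi> = (\<integral>x. (1 + (hs_norm_diff M N \<psi> x)\<^sup>2) powr \<alpha> \<partial>vol)"

definition alpha_harmonic ::
  "real \<Rightarrow> 'a measure \<Rightarrow> ('a::topological_space, 'e::euclidean_space) riem \<Rightarrow>
   ('b::topological_space, 'f::euclidean_space) riem \<Rightarrow> ('a \<Rightarrow> 'b) \<Rightarrow> bool" where
  "alpha_harmonic \<alpha> vol M N \<psi> \<longleftrightarrow> smooth_map M N \<psi> \<and>
     (\<forall>\<epsilon>>0. \<forall>\<gamma>. smooth_family {-\<epsilon><..<\<epsilon>} M N \<gamma> \<and> \<gamma> 0 = \<psi> \<longrightarrow>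
        ((\<lambda>t. alpha_energy \<alpha> vol M N (\<gamma> t)) has_real_derivative 0) (at 0))"

definition two_parameter_variation ::
  "('a::topological_space, 'e::euclidean_space) riem \<Rightarrow>
   ('b::topological_space, 'f::euclidean_space) riem \<Rightarrow> ('a \<Rightarrow> 'b) \<Rightarrow>
   (('b, 'f) chart \<Rightarrow> 'a \<Rightarrow> 'f) \<Rightarrow> (('b, 'f) chart \<Rightarrow> 'a \<Rightarrow> 'f) \<Rightarrow>
   (real \<times> real \<Rightarrow> 'a \<Rightarrow> 'b) \<Rightarrow> bool" where
  "two_parameter_variation M N \<psi> \<upsilon> \<omega> F \<longleftrightarrow>
     (\<exists>\<epsilon>>0. smooth_family ({-\<epsilon><..<\<epsilon>} \<times> {-\<epsilon><..<\<epsilon>}) M N F) \<and> F (0, 0) = \<psi> \<and>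
     has_velocity N (\<lambda>t. F (t, 0)) \<upsilon> \<and> has_velocity N (\<lambda>s. F (0, s)) \<omega>"

definition second_variation ::
  "real \<Rightarrow> 'a measure \<Rightarrow> ('a, 'e::euclidean_space) riem \<Rightarrow> ('b, 'f::euclidean_space) riem \<Rightarrow>
   (real \<times> real \<Rightarrow> 'a \<Rightarrow> 'b) \<Rightarrow> real" where
  "second_variation \<alpha> vol M N F =
     deriv (\<lambda>t. deriv (\<lambda>s. alpha_energy \<alpha> vol M N (F (t, s))) 0) 0"

text \<open>For \<open>\<alpha>\<close>-harmonic \<open>\<psi>\<close>, \<open>I(\<upsilon>,\<upsilon>)\<close> is the second variation along any two-parameter variation
  whose velocities are both \<open>\<upsilon>\<close>; its value depends on \<open>\<upsilon>\<close> only.\<close>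

definition alpha_stable ::
  "real \<Rightarrow> 'a measure \<Rightarrow> ('a::topological_space, 'e::euclidean_space) riem \<Rightarrow>
   ('b::topological_space, 'f::euclidean_space) riem \<Rightarrow> ('a \<Rightarrow> 'b) \<Rightarrow> bool" where
  "alpha_stable \<alpha> vol M N \<psi> \<longleftrightarrow>
     (\<forall>\<upsilon>. vector_field_along M N \<psi> \<upsilon> \<and> compact (field_support N \<psi> \<upsilon>) \<longrightarrow>
        (\<forall>F. two_parameter_variation M N \<psi> \<upsilon> \<upsilon> F \<longrightarrow> 0 \<le> second_variation \<alpha> vol M N F))"

end

theory Submission
  imports Defs
begin

text \<open>Write \<open>e = (1 + |dF|\<^sup>2)\<^sup>\<alpha>\<close> for the energy density of a two-parameter variation \<open>F\<close> with both
  velocities equal to \<open>\<upsilon>\<close>. Commuting covariant derivatives, \<open>\<partial>\<^sub>t\<partial>\<^sub>s e\<close> at the origin is the sum of a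
  nonnegative multiple of \<open>(\<partial>\<^sub>t |dF|\<^sup>2)\<^sup>2\<close>, a nonnegative multiple of
  \<open>|\<nabla>\<upsilon>|\<^sup>2 + \<Sum>\<langle>R(\<upsilon>, d\<psi> e\<^sub>i)\<upsilon>, d\<psi> e\<^sub>i\<rangle>\<close>, which nonpositive curvature makes nonnegative, and the first
  variation density in the direction of the covariant acceleration \<open>W = \<nabla>\<^sub>t\<partial>\<^sub>s F\<close>. The last summand
  integrates to zero: cutting \<open>W\<close> into fields supported in single charts of \<open>N\<close>, each of which
  is the velocity of a variation that is a straight line in that chart, reduces this to
  criticality of \<open>\<psi>\<close>. So neither the divergence theorem nor the exponential map is needed,
  and the volume enters only as a finite Borel measure.\<close>

section \<open>Calculus of smooth maps\<close>

lemma frechet_derivative_cong_open: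
  assumes "open S" "x \<in> S" "\<And>y. y \<in> S \<Longrightarrow> f y = g y"
  shows "frechet_derivative f (at x) = frechet_derivative g (at x)"
proof -
  have "(f has_derivative f') (at x) \<longleftrightarrow> (g has_derivative f') (at x)" for f'
    using assms by (metis has_derivative_transform_within_open)
  then show ?thesis
    unfolding frechet_derivative_def by simp
qed

lemma frechet_derivative_eqI:
  "(f has_derivative f') (at x) \<Longrightarrow> frechet_derivative f (at x) = f'"
  using frechet_derivative_at by metis

lemma times_diff_on_cong:
  assumes "open S" "\<And>y. y \<in> S \<Longrightarrow> f y = g y" "times_diff_on k S f"
  shows "times_diff_on k S g"
  using assms(2,3)
proof (induction k arbitrary: f g)
  case 0
  then show ?case by (simp cong: continuous_on_cong)
next
  case (Suc k)
  have "g differentiable (at x)" if "x \<in> S" for x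
  proof -
    obtain f' where "(f has_derivative f') (at x)"
      using Suc.prems(2) \<open>x \<in> S\<close> by (auto simp: differentiable_def)
    then show ?thesis
      using has_derivative_transform_within_open[of f f' x UNIV S g] Suc.prems(1) assms(1) \<open>x \<in> S\<close>
      by (auto simp: differentiable_def)
  qed
  moreover have "times_diff_on k S (\<lambda>x. frechet_derivative g (at x) v)" for v
  proof (rule Suc.IH)
    show "frechet_derivative f (at y) v = frechet_derivative g (at y) v" if "y \<in> S" for y
      using frechet_derivative_cong_open[OF assms(1) that Suc.prems(1)] by simp
    show "times_diff_on k S (\<lambda>x. frechet_derivative f (at x) v)"
      using Suc.prems(2) by simp
  qed
  ultimately show ?case by simp
qed

lemma times_diff_on_subset:
  "times_diff_on k S f \<Longrightarrow> T \<subseteq> S \<Longrightarrow> times_diff_on k T f"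
  by (induction k arbitrary: f) (auto intro: continuous_on_subset)

lemma times_diff_on_SucI:
  assumes "open S" "\<And>x. x \<in> S \<Longrightarrow> (f has_derivative f' x) (at x)"
    "\<And>v. times_diff_on k S (\<lambda>x. f' x v)"
  shows "times_diff_on (Suc k) S f"
proof -
  have "frechet_derivative f (at x) = f' x" if "x \<in> S" for x
    using assms(2)[OF that] by (rule frechet_derivative_eqI)
  then show ?thesis
    using assms times_diff_on_cong[OF assms(1) _ assms(3)]
    by (auto simp: differentiable_def)
qed

lemma times_diff_on_SucD:
  assumes "times_diff_on (Suc k) S f" "x \<in> S"
  shows "(f has_derivative frechet_derivative f (at x)) (at x)"
  using assms by (simp add: frechet_derivative_works)

lemma times_diff_on_Suc_imp: "times_diff_on (Suc k) S f \<Longrightarrow> times_diff_on k S f"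
proof (induction k arbitrary: f)
  case 0
  then show ?case
    by (auto intro!: continuous_at_imp_continuous_on differentiable_imp_continuous_within)
next
  case (Suc k)
  then show ?case by (metis times_diff_on.simps(2))
qed

lemma times_diff_on_local:
  assumes "\<And>x. x \<in> S \<Longrightarrow> \<exists>U. open U \<and> x \<in> U \<and> times_diff_on k U f"
  shows "times_diff_on k S f"
  using assms
proof (induction k arbitrary: f)
  case 0
  then show ?case
    by (metis continuous_at_imp_continuous_on continuous_on_eq_continuous_at times_diff_on.simps(1))
next
  case (Suc k)
  then show ?case by (metis times_diff_on.simps(2))
qed

lemma times_diff_on_const: "open S \<Longrightarrow> times_diff_on k S (\<lambda>x. c)"
  by (induction k arbitrary: c) simp_all

lemma times_diff_on_linear_comp:
  assumes "bounded_linear L" "open S" "times_diff_on k S f"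
  shows "times_diff_on k S (\<lambda>x. L (f x))"
  using assms(3)
proof (induction k arbitrary: f)
  case 0
  then show ?case
    using assms(1) by (simp add: bounded_linear.continuous_on)
next
  case (Suc k)
  show ?case
  proof (rule times_diff_on_SucI[OF assms(2)])
    fix x assume "x \<in> S"
    then show "((\<lambda>x. L (f x)) has_derivative (\<lambda>v. L (frechet_derivative f (at x) v))) (at x)"
      by (intro bounded_linear.has_derivative[OF assms(1)] times_diff_on_SucD[OF Suc.prems])
  next
    show "times_diff_on k S (\<lambda>x. L (frechet_derivative f (at x) v))" for v
      using Suc by simp
  qed
qed

lemma times_diff_on_add:
  assumes "open S" "times_diff_on k S f" "times_diff_on k S g"
  shows "times_diff_on k S (\<lambda>x. f x + g x)"
  using assms(2,3)
proof (induction k arbitrary: f g)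
  case 0
  then show ?case by (simp add: continuous_on_add)
next
  case (Suc k)
  show ?case
  proof (rule times_diff_on_SucI[OF assms(1)])
    fix x assume "x \<in> S"
    then show "((\<lambda>x. f x + g x) has_derivative
        (\<lambda>v. frechet_derivative f (at x) v + frechet_derivative g (at x) v)) (at x)"
      using Suc.prems by (intro has_derivative_add times_diff_on_SucD)
  next
    show "times_diff_on k S (\<lambda>x. frechet_derivative f (at x) v + frechet_derivative g (at x) v)" for v
      using Suc by simp
  qed
qed

lemma times_diff_on_bilinear:
  assumes "bounded_bilinear B" "open S" "times_diff_on k S f" "times_diff_on k S g"
  shows "times_diff_on k S (\<lambda>x. B (f x) (g x))"
  using assms(3,4)
proof (induction k arbitrary: f g)
  case 0
  then show ?case
    using bounded_bilinear.continuous_on[OF assms(1)] by simp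
next
  case (Suc k)
  show ?case
  proof (rule times_diff_on_SucI[OF assms(2)])
    fix x assume "x \<in> S"
    then show "((\<lambda>x. B (f x) (g x)) has_derivative
        (\<lambda>v. B (f x) (frechet_derivative g (at x) v) + B (frechet_derivative f (at x) v) (g x))) (at x)"
      using Suc.prems by (intro bounded_bilinear.FDERIV[OF assms(1)] times_diff_on_SucD)
  next
    show "times_diff_on k S (\<lambda>x. B (f x) (frechet_derivative g (at x) v)
        + B (frechet_derivative f (at x) v) (g x))" for v
      using Suc.prems times_diff_on_Suc_imp[OF Suc.prems(1)] times_diff_on_Suc_imp[OF Suc.prems(2)]
      by (intro times_diff_on_add[OF assms(2)] Suc.IH) auto
  qed
qed

lemma times_diff_on_sum:
  assumes "open S" "\<And>i. i \<in> I \<Longrightarrow> times_diff_on k S (f i)"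
  shows "times_diff_on k S (\<lambda>x. \<Sum>i\<in>I. f i x)"
  using assms(2)
proof (induction I rule: infinite_finite_induct)
  case (insert i I)
  then show ?case
    using times_diff_on_add[OF assms(1), of k "f i"] by simp
qed (use times_diff_on_const[OF assms(1)] in simp_all)

lemma times_diff_on_compose:
  fixes f :: "'e::real_normed_vector \<Rightarrow> 'f::euclidean_space" and g :: "'f \<Rightarrow> 'g::real_normed_vector"
  assumes "open S" "open T" "f ` S \<subseteq> T" "times_diff_on k S f" "times_diff_on k T g"
  shows "times_diff_on k S (\<lambda>x. g (f x))"
  using assms(4,5)
proof (induction k arbitrary: g)
  case 0
  then show ?case
    using assms(3) continuous_on_compose2[of T g S f] by simp
next
  case (Suc k)
  let ?Df = "\<lambda>x. frechet_derivative f (at x)" and ?Dg = "\<lambda>y. frechet_derivative g (at y)"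
  show ?case
  proof (rule times_diff_on_SucI[OF assms(1)])
    fix x assume x: "x \<in> S"
    have g: "(g has_derivative ?Dg (f x)) (at (f x))"
      using x assms(3) times_diff_on_SucD[OF Suc.prems(2)] by blast
    have 1: "((\<lambda>x. g (f x)) has_derivative (\<lambda>v. ?Dg (f x) (?Df x v))) (at x)"
      by (rule has_derivative_compose[OF times_diff_on_SucD[OF Suc.prems(1) x] g])
    have 2: "?Dg (f x) w = (\<Sum>b\<in>Basis. (w \<bullet> b) *\<^sub>R ?Dg (f x) b)" for w
    proof -
      have "?Dg (f x) (\<Sum>b\<in>Basis. (w \<bullet> b) *\<^sub>R b) = (\<Sum>b\<in>Basis. (w \<bullet> b) *\<^sub>R ?Dg (f x) b)"
        unfolding linear_sum[OF has_derivative_linear[OF g]]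
          linear_scale[OF has_derivative_linear[OF g]] ..
      then show ?thesis unfolding euclidean_representation .
    qed
    show "((\<lambda>x. g (f x)) has_derivative
        (\<lambda>v. \<Sum>b\<in>Basis. (?Df x v \<bullet> b) *\<^sub>R ?Dg (f x) b)) (at x)"
      using 1 unfolding 2[symmetric] .
  next
    show "times_diff_on k S (\<lambda>x. \<Sum>b\<in>Basis. (?Df x v \<bullet> b) *\<^sub>R ?Dg (f x) b)" for v
      using Suc.prems times_diff_on_Suc_imp[OF Suc.prems(1)]
      by (intro times_diff_on_sum times_diff_on_bilinear[OF bounded_bilinear_scaleR]
          times_diff_on_linear_comp[OF bounded_linear_inner_left] assms(1) Suc.IH)
        (simp_all add: assms(1))
  qed
qed

lemma smooth_on_times_diff_on: "smooth_on S f \<Longrightarrow> times_diff_on k S f"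
  by (simp add: smooth_on_def)

lemma smooth_on_cong:
  "open S \<Longrightarrow> (\<And>y. y \<in> S \<Longrightarrow> f y = g y) \<Longrightarrow> smooth_on S f \<Longrightarrow> smooth_on S g"
  unfolding smooth_on_def using times_diff_on_cong by blast

lemma smooth_on_subset: "smooth_on S f \<Longrightarrow> T \<subseteq> S \<Longrightarrow> smooth_on T f"
  unfolding smooth_on_def using times_diff_on_subset by blast

lemma smooth_on_local:
  "(\<And>x. x \<in> S \<Longrightarrow> \<exists>U. open U \<and> x \<in> U \<and> smooth_on U f) \<Longrightarrow> smooth_on S f"
  unfolding smooth_on_def by (metis times_diff_on_local)

lemma smooth_on_imp_continuous_on: "smooth_on S f \<Longrightarrow> continuous_on S f"
  unfolding smooth_on_def by (metis times_diff_on.simps(1))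

lemma smooth_on_const: "open S \<Longrightarrow> smooth_on S (\<lambda>x. c)"
  by (simp add: smooth_on_def times_diff_on_const)

lemma smooth_on_linear_comp:
  "bounded_linear L \<Longrightarrow> open S \<Longrightarrow> smooth_on S f \<Longrightarrow> smooth_on S (\<lambda>x. L (f x))"
  by (simp add: smooth_on_def times_diff_on_linear_comp)

lemma times_diff_on_linear: 
  assumes "bounded_linear L" "open S" shows "times_diff_on k S L"
proof (cases k)
  case 0 then show ?thesis using assms by (simp add: linear_continuous_on)
next
  case (Suc j)
  show ?thesis unfolding Suc
    by (rule times_diff_on_SucI[OF assms(2), of _ "\<lambda>x. L"])
      (auto simp: assms times_diff_on_const intro: bounded_linear_imp_has_derivative)
qed

lemma smooth_on_linear: "bounded_linear L \<Longrightarrow> open S \<Longrightarrow> smooth_on S L"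
  by (simp add: smooth_on_def times_diff_on_linear)

lemma smooth_on_add:
  "open S \<Longrightarrow> smooth_on S f \<Longrightarrow> smooth_on S g \<Longrightarrow> smooth_on S (\<lambda>x. f x + g x)"
  by (simp add: smooth_on_def times_diff_on_add)

lemma smooth_on_bilinear:
  "bounded_bilinear B \<Longrightarrow> open S \<Longrightarrow> smooth_on S f \<Longrightarrow> smooth_on S g \<Longrightarrow>
    smooth_on S (\<lambda>x. B (f x) (g x))"
  by (simp add: smooth_on_def times_diff_on_bilinear)

lemmas smooth_on_mult = smooth_on_bilinear[OF bounded_bilinear_mult]
lemmas smooth_on_scaleR = smooth_on_bilinear[OF bounded_bilinear_scaleR]
lemmas smooth_on_inner_left = smooth_on_linear_comp[OF bounded_linear_inner_left]
lemma smooth_on_sum: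
  "open S \<Longrightarrow> (\<And>i. i \<in> I \<Longrightarrow> smooth_on S (f i)) \<Longrightarrow> smooth_on S (\<lambda>x. \<Sum>i\<in>I. f i x)"
  by (simp add: smooth_on_def times_diff_on_sum)

lemma smooth_on_minus: "open S \<Longrightarrow> smooth_on S f \<Longrightarrow> smooth_on S (\<lambda>x. - f x)"
  by (rule smooth_on_linear_comp[OF bounded_linear_minus[OF bounded_linear_ident]])

lemma smooth_on_diff:
  "open S \<Longrightarrow> smooth_on S f \<Longrightarrow> smooth_on S g \<Longrightarrow> smooth_on S (\<lambda>x. f x - g x)"
  using smooth_on_add[of S f "\<lambda>x. - g x"] by (simp add: smooth_on_minus)

lemma smooth_on_prod:
  fixes f :: "'i \<Rightarrow> 'e::real_normed_vector \<Rightarrow> real"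
  assumes "open S" "\<And>i. i \<in> I \<Longrightarrow> smooth_on S (f i)"
  shows "smooth_on S (\<lambda>x. \<Prod>i\<in>I. f i x)"
  using assms(2)
proof (induction I rule: infinite_finite_induct)
  case (insert i I)
  then show ?case
    using smooth_on_mult[OF assms(1), of "f i"] by simp
qed (use smooth_on_const[OF assms(1)] in simp_all)

lemma smooth_on_compose:
  fixes f :: "'e::real_normed_vector \<Rightarrow> 'f::euclidean_space" and g :: "'f \<Rightarrow> 'g::real_normed_vector"
  shows "open S \<Longrightarrow> open T \<Longrightarrow> f ` S \<subseteq> T \<Longrightarrow> smooth_on S f \<Longrightarrow> smooth_on T g \<Longrightarrow>
    smooth_on S (\<lambda>x. g (f x))"
  unfolding smooth_on_def using times_diff_on_compose by blast

lemma smooth_on_Pair: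
  assumes "open S" "smooth_on S f" "smooth_on S g"
  shows "smooth_on S (\<lambda>x. (f x, g x))"
proof -
  have "smooth_on S (\<lambda>x. (f x, 0) + (0, g x))"
    by (intro smooth_on_add smooth_on_linear_comp[of "\<lambda>y. (y, 0)"] 
        smooth_on_linear_comp[of "\<lambda>y. (0, y)"] assms) (auto intro!: bounded_linear_intros)
  then show ?thesis by simp
qed

lemma times_diff_on_inverse: "times_diff_on k (- {0}) (inverse :: real \<Rightarrow> real)"
proof (induction k)
  case 0
  then show ?case by (auto intro!: continuous_intros)
next
  case (Suc k)
  have o: "open (- {0::real})" by auto
  show ?case
  proof (rule times_diff_on_SucI[OF o])
    fix x :: real assume "x \<in> - {0}"
    then show "(inverse has_derivative (\<lambda>v. (- v) * (inverse x * inverse x))) (at x)"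
      by (auto intro!: derivative_eq_intros)
  next
    show "times_diff_on k (- {0}) (\<lambda>x. (- v) * (inverse x * inverse x))" for v :: real
      by (intro times_diff_on_bilinear[OF bounded_bilinear_mult] o Suc times_diff_on_const)
  qed
qed

lemma smooth_on_divide:
  fixes f g :: "'e::real_normed_vector \<Rightarrow> real"
  assumes "open S" "smooth_on S f" "smooth_on S g" "\<And>x. x \<in> S \<Longrightarrow> g x \<noteq> 0"
  shows "smooth_on S (\<lambda>x. f x / g x)"
  unfolding divide_inverse using assms times_diff_on_inverse
  by (intro smooth_on_mult smooth_on_compose[of S "- {0}" g inverse])
    (auto simp: smooth_on_def)

lemma times_diff_on_powr: "times_diff_on k {0<..} (\<lambda>x::real. x powr a)"
proof (induction k arbitrary: a)
  case 0
  then show ?case by (auto intro!: continuous_intros)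
next
  case (Suc k)
  show ?case
  proof (rule times_diff_on_SucI)
    fix x :: real assume "x \<in> {0<..}"
    then show "((\<lambda>x. x powr a) has_derivative (\<lambda>v. (a * v) * x powr (a - 1))) (at x)"
      by (auto intro!: derivative_eq_intros simp: powr_diff field_simps)
  next
    show "times_diff_on k {0<..} (\<lambda>x. (a * v) * x powr (a - 1))" for v :: real
      by (intro times_diff_on_bilinear[OF bounded_bilinear_mult] Suc times_diff_on_const) auto
  qed auto
qed

lemma smooth_on_powr:
  fixes f :: "'e::real_normed_vector \<Rightarrow> real"
  assumes "open S" "smooth_on S f" "\<And>x. x \<in> S \<Longrightarrow> f x > 0"
  shows "smooth_on S (\<lambda>x. f x powr a)"
  using assms times_diff_on_powr
  by (intro smooth_on_compose[of S "{0<..}" f "\<lambda>x. x powr a"]) (auto simp: smooth_on_def)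

subsection \<open>Directional derivatives\<close>

definition dird :: "'e::real_normed_vector \<Rightarrow> ('e \<Rightarrow> 'f::real_normed_vector) \<Rightarrow> 'e \<Rightarrow> 'f" where
  "dird v f z = frechet_derivative f (at z) v"

lemma dird_eqI: "(f has_derivative f') (at z) \<Longrightarrow> dird v f z = f' v"
  by (simp add: dird_def frechet_derivative_eqI)

lemma has_derivative_dird:
  assumes "smooth_on S f" "z \<in> S"
  shows "(f has_derivative (\<lambda>v. dird v f z)) (at z)"
  unfolding dird_def by (rule times_diff_on_SucD[OF smooth_on_times_diff_on[OF assms(1)] assms(2)])

lemma dird_cong_open:
  "open S \<Longrightarrow> z \<in> S \<Longrightarrow> (\<And>y. y \<in> S \<Longrightarrow> f y = g y) \<Longrightarrow> dird v f z = dird v g z"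
  unfolding dird_def using frechet_derivative_cong_open[of S z f g] by simp

lemma smooth_on_dird: "smooth_on S f \<Longrightarrow> smooth_on S (dird v f)"
  unfolding smooth_on_def dird_def by (metis times_diff_on.simps(2))

lemma linear_dird: "smooth_on S f \<Longrightarrow> z \<in> S \<Longrightarrow> linear (\<lambda>v. dird v f z)"
  using has_derivative_dird has_derivative_linear by blast

lemma dird_const: "dird v (\<lambda>x. c) z = 0"
  by (simp add: dird_def)

lemma dird_linear_comp:
  assumes "bounded_linear L" "smooth_on S f" "z \<in> S"
  shows "dird v (\<lambda>x. L (f x)) z = L (dird v f z)"
  by (rule dird_eqI[OF bounded_linear.has_derivative[OF assms(1) has_derivative_dird[OF assms(2,3)]]])

lemma dird_add:
  assumes "smooth_on S f" "smooth_on S g" "z \<in> S"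
  shows "dird v (\<lambda>x. f x + g x) z = dird v f z + dird v g z"
  by (rule dird_eqI[OF has_derivative_add]) (use assms has_derivative_dird in blast)+

lemma dird_sum:
  assumes "\<And>i. i \<in> I \<Longrightarrow> smooth_on S (f i)" "z \<in> S"
  shows "dird v (\<lambda>x. \<Sum>i\<in>I. f i x) z = (\<Sum>i\<in>I. dird v (f i) z)"
  by (rule dird_eqI[OF has_derivative_sum]) (use assms has_derivative_dird in blast)

lemma dird_bilinear:
  assumes "bounded_bilinear B" "smooth_on S f" "smooth_on S g" "z \<in> S"
  shows "dird v (\<lambda>x. B (f x) (g x)) z = B (f z) (dird v g z) + B (dird v f z) (g z)"
  by (rule dird_eqI[OF bounded_bilinear.FDERIV[OF assms(1)]])
    (use assms has_derivative_dird in blast)+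

lemmas dird_mult = dird_bilinear[OF bounded_bilinear_mult]
lemmas dird_scaleR = dird_bilinear[OF bounded_bilinear_scaleR]

lemma dird_compose:
  assumes "smooth_on S f" "smooth_on T g" "z \<in> S" "f z \<in> T"
  shows "dird v (\<lambda>x. g (f x)) z = dird (dird v f z) g (f z)"
  by (rule dird_eqI[OF has_derivative_compose[OF has_derivative_dird[OF assms(1,3)]
          has_derivative_dird[OF assms(2,4)]]])

lemma dird_powr:
  fixes f :: "'e::real_normed_vector \<Rightarrow> real"
  assumes "smooth_on S f" "z \<in> S" "f z > 0"
  shows "dird v (\<lambda>x. f x powr a) z = a * f z powr (a - 1) * dird v f z"
proof -
  have "((\<lambda>x. x powr a) has_derivative (\<lambda>h. (a * f z powr (a - 1)) * h)) (at (f z))"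
    using assms(3) by (auto intro!: derivative_eq_intros simp: powr_diff field_simps)
  from has_derivative_compose[OF has_derivative_dird[OF assms(1,2)] this]
  show ?thesis by (rule dird_eqI)
qed

lemma has_vector_derivative_line:
  assumes "smooth_on S f" "x + t *\<^sub>R v \<in> S"
  shows "((\<lambda>t. f (x + t *\<^sub>R v)) has_vector_derivative dird v f (x + t *\<^sub>R v)) (at t)"
proof -
  note l = linear_dird[OF assms]
  have 1: "((\<lambda>t. x + t *\<^sub>R v) has_derivative (\<lambda>h. h *\<^sub>R v)) (at t)"
    by (auto intro!: derivative_eq_intros)
  show ?thesis
    using has_derivative_compose[OF 1 has_derivative_dird[OF assms]]
    unfolding has_vector_derivative_def linear_scale[OF l] .
qed

lemma second_difference:
  fixes f :: "'e::real_normed_vector \<Rightarrow> real"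
  assumes "smooth_on S f" "h > 0"
    and S: "\<And>s t. 0 \<le> s \<Longrightarrow> s \<le> h \<Longrightarrow> 0 \<le> t \<Longrightarrow> t \<le> h \<Longrightarrow> x + s *\<^sub>R u + t *\<^sub>R v \<in> S"
  obtains s t where "0 < s" "s < h" "0 < t" "t < h"
    "f (x + h *\<^sub>R u + h *\<^sub>R v) - f (x + h *\<^sub>R u) - f (x + h *\<^sub>R v) + f x
      = h * h * dird v (dird u f) (x + s *\<^sub>R u + t *\<^sub>R v)"
proof -
  have line: "((\<lambda>t. g (y + t *\<^sub>R w)) has_real_derivative dird w g (y + t *\<^sub>R w)) (at t)"
    if "smooth_on S g" "y + t *\<^sub>R w \<in> S" for g :: "'e \<Rightarrow> real" and y w t
    using has_vector_derivative_line[OF that]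
    by (simp add: has_real_derivative_iff_has_vector_derivative)
  have 1: "((\<lambda>s. f ((x + h *\<^sub>R v) + s *\<^sub>R u) - f (x + s *\<^sub>R u)) has_real_derivative
      (dird u f ((x + h *\<^sub>R v) + s *\<^sub>R u) - dird u f (x + s *\<^sub>R u))) (at s)" if "0 \<le> s" "s \<le> h" for s
    using S[OF that, of h] S[OF that, of 0] assms(2)
    by (intro DERIV_diff line assms(1)) (simp_all add: algebra_simps)
  obtain s where s: "0 < s" "s < h" 
    "(f ((x + h *\<^sub>R v) + h *\<^sub>R u) - f (x + h *\<^sub>R u)) - (f ((x + h *\<^sub>R v) + 0 *\<^sub>R u) - f (x + 0 *\<^sub>R u))
      = (h - 0) * (dird u f ((x + h *\<^sub>R v) + s *\<^sub>R u) - dird u f (x + s *\<^sub>R u))"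
    using MVT2[OF assms(2) 1] by blast
  have 2: "((\<lambda>t. dird u f ((x + s *\<^sub>R u) + t *\<^sub>R v)) has_real_derivative
      dird v (dird u f) ((x + s *\<^sub>R u) + t *\<^sub>R v)) (at t)" if "0 \<le> t" "t \<le> h" for t
    using S[of s t] s(1,2) that by (intro line smooth_on_dird assms(1)) simp
  obtain t where t: "0 < t" "t < h" 
    "dird u f ((x + s *\<^sub>R u) + h *\<^sub>R v) - dird u f ((x + s *\<^sub>R u) + 0 *\<^sub>R v)
      = (h - 0) * dird v (dird u f) ((x + s *\<^sub>R u) + t *\<^sub>R v)"
    using MVT2[OF assms(2) 2] by blast
  have "f (x + h *\<^sub>R u + h *\<^sub>R v) - f (x + h *\<^sub>R u) - f (x + h *\<^sub>R v) + f x
      = h * (dird u f ((x + s *\<^sub>R u) + h *\<^sub>R v) - dird u f ((x + s *\<^sub>R u) + 0 *\<^sub>R v))"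
    using s(3) by (simp add: algebra_simps)
  then have "f (x + h *\<^sub>R u + h *\<^sub>R v) - f (x + h *\<^sub>R u) - f (x + h *\<^sub>R v) + f x
      = h * h * dird v (dird u f) (x + s *\<^sub>R u + t *\<^sub>R v)"
    unfolding t(3) by simp
  then show thesis using that s(1,2) t(1,2) by blast
qed

lemma dird_commute_real:
  fixes f :: "'e::real_normed_vector \<Rightarrow> real"
  assumes "open S" "smooth_on S f" "x \<in> S"
  shows "dird u (dird v f) x = dird v (dird u f) x"
proof -
  define K where "K = norm u + norm v + 1"
  have K: "K > 0" by (simp add: K_def add_nonneg_pos)
  obtain r where r: "r > 0" "ball x r \<subseteq> S"
    using assms(1,3) open_contains_ball by blast
  define h where "h n = r / (2 * K) / real (Suc n)" for n
  have h0: "h n > 0" for n using r(1) K by (simp add: h_def)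
  have hr: "h n * K < r" for n
  proof -
    have "h n * K = r / (2 * real (Suc n))" using K by (simp add: h_def)
    also have "\<dots> < r" using r(1) by (simp add: field_simps add_pos_nonneg)
    finally show ?thesis .
  qed
  have nrm: "norm (s *\<^sub>R u + t *\<^sub>R v) \<le> h n * K" 
    if "0 \<le> s" "s \<le> h n" "0 \<le> t" "t \<le> h n" for s t n
  proof -
    have "norm (s *\<^sub>R u + t *\<^sub>R v) \<le> s * norm u + t * norm v"
      using norm_triangle_ineq[of "s *\<^sub>R u" "t *\<^sub>R v"] that by simp
    also have "\<dots> \<le> h n * norm u + h n * norm v"
      using that by (intro add_mono mult_right_mono) auto
    also have "\<dots> \<le> h n * K" using h0[of n] by (simp add: K_def algebra_simps)
    finally show ?thesis .
  qed
  have inS: "x + s *\<^sub>R u + t *\<^sub>R v \<in> S" if "0 \<le> s" "s \<le> h n" "0 \<le> t" "t \<le> h n" for s t n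
  proof -
    have "dist x (x + s *\<^sub>R u + t *\<^sub>R v) = norm (s *\<^sub>R u + t *\<^sub>R v)"
      by (simp add: dist_norm norm_minus_commute algebra_simps)
    then have "x + s *\<^sub>R u + t *\<^sub>R v \<in> ball x r" using nrm[OF that] hr[of n] by simp
    then show ?thesis using r(2) by blast
  qed
  have inS': "x + s *\<^sub>R v + t *\<^sub>R u \<in> S" if "0 \<le> s" "s \<le> h n" "0 \<le> t" "t \<le> h n" for s t n
    using inS[of t n s] that by (simp add: algebra_simps)
  have "\<exists>s t s' t'. 0 \<le> s \<and> s \<le> h n \<and> 0 \<le> t \<and> t \<le> h n \<and> 0 \<le> s' \<and> s' \<le> h n \<and> 0 \<le> t' \<and> t' \<le> h n \<and>
     dird v (dird u f) (x + s *\<^sub>R u + t *\<^sub>R v) = dird u (dird v f) (x + t' *\<^sub>R u + s' *\<^sub>R v)" for n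
  proof -
    obtain s t where st: "0 < s" "s < h n" "0 < t" "t < h n"
      "f (x + h n *\<^sub>R u + h n *\<^sub>R v) - f (x + h n *\<^sub>R u) - f (x + h n *\<^sub>R v) + f x
        = h n * h n * dird v (dird u f) (x + s *\<^sub>R u + t *\<^sub>R v)"
      by (rule second_difference[OF assms(2) h0[of n] inS[of _ n]])
    obtain s' t' where st': "0 < s'" "s' < h n" "0 < t'" "t' < h n"
      "f (x + h n *\<^sub>R v + h n *\<^sub>R u) - f (x + h n *\<^sub>R v) - f (x + h n *\<^sub>R u) + f x
        = h n * h n * dird u (dird v f) (x + s' *\<^sub>R v + t' *\<^sub>R u)"
      by (rule second_difference[OF assms(2) h0[of n] inS'[of _ n]])
    have "h n * h n * dird v (dird u f) (x + s *\<^sub>R u + t *\<^sub>R v)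
        = h n * h n * dird u (dird v f) (x + s' *\<^sub>R v + t' *\<^sub>R u)"
      using st(5) st'(5) by (simp add: algebra_simps)
    then have "dird v (dird u f) (x + s *\<^sub>R u + t *\<^sub>R v) = dird u (dird v f) (x + t' *\<^sub>R u + s' *\<^sub>R v)"
      using h0[of n] by (simp add: algebra_simps)
    then show ?thesis using st(1-4) st'(1-4) less_imp_le by blast
  qed
  then obtain s t s' t' where st: "\<And>n. 0 \<le> s n \<and> s n \<le> h n \<and> 0 \<le> t n \<and> t n \<le> h n"
      "\<And>n. 0 \<le> s' n \<and> s' n \<le> h n \<and> 0 \<le> t' n \<and> t' n \<le> h n"
    and eq: "\<And>n. dird v (dird u f) (x + s n *\<^sub>R u + t n *\<^sub>R v)
        = dird u (dird v f) (x + t' n *\<^sub>R u + s' n *\<^sub>R v)"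
    by metis
  have "h \<longlonglongrightarrow> 0"
    unfolding h_def using LIMSEQ_Suc[OF lim_const_over_n[of "r / (2 * K)"]] by simp
  then have z: "a \<longlonglongrightarrow> 0" if "\<And>n. 0 \<le> a n \<and> a n \<le> h n" for a
    by (rule tendsto_sandwich[OF _ _ tendsto_const, rotated 2]) (use that in auto)
  have lim: "(\<lambda>n. g (x + a n *\<^sub>R u + b n *\<^sub>R v)) \<longlonglongrightarrow> g x"
    if g: "smooth_on S g" and ab: "\<And>n. 0 \<le> a n \<and> a n \<le> h n" "\<And>n. 0 \<le> b n \<and> b n \<le> h n" 
    for g :: "'e \<Rightarrow> real" and a b
  proof -
    have "(\<lambda>n. x + a n *\<^sub>R u + b n *\<^sub>R v) \<longlonglongrightarrow> x + 0 *\<^sub>R u + 0 *\<^sub>R v"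
      by (intro tendsto_intros z ab)
    moreover have "isCont g x"
      using smooth_on_imp_continuous_on[OF g] assms(1,3) continuous_on_eq_continuous_at by blast
    ultimately show ?thesis using isCont_tendsto_compose by fastforce
  qed
  have "(\<lambda>n. dird v (dird u f) (x + s n *\<^sub>R u + t n *\<^sub>R v)) \<longlonglongrightarrow> dird v (dird u f) x"
    using st by (intro lim smooth_on_dird assms(2)) auto
  moreover have "(\<lambda>n. dird u (dird v f) (x + t' n *\<^sub>R u + s' n *\<^sub>R v)) \<longlonglongrightarrow> dird u (dird v f) x"
    using st by (intro lim smooth_on_dird assms(2)) auto
  ultimately show ?thesis
    unfolding eq using LIMSEQ_unique by blast
qed

lemma dird_commute:
  fixes f :: "'e::real_normed_vector \<Rightarrow> 'f::euclidean_space"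
  assumes "open S" "smooth_on S f" "x \<in> S"
  shows "dird u (dird v f) x = dird v (dird u f) x"
proof (rule euclidean_eqI)
  fix b :: 'f assume "b \<in> Basis"
  have 1: "dird u (dird v (\<lambda>y. f y \<bullet> b)) x = dird u (dird v f) x \<bullet> b" for u v
  proof -
    have "dird u (dird v (\<lambda>y. f y \<bullet> b)) x = dird u (\<lambda>y. dird v f y \<bullet> b) x"
      by (rule dird_cong_open[OF assms(1,3)])
        (simp add: dird_linear_comp[OF bounded_linear_inner_left assms(2)])
    then show ?thesis
      by (simp add: dird_linear_comp[OF bounded_linear_inner_left smooth_on_dird[OF assms(2)] assms(3)])
  qed
  show "dird u (dird v f) x \<bullet> b = dird v (dird u f) x \<bullet> b"
    using dird_commute_real[OF assms(1) smooth_on_inner_left[OF assms(1,2)] assms(3)]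
    by (metis 1)
qed

subsection \<open>Smooth families of bilinear maps\<close>

lemma bilinear_eq_sum:
  fixes B :: "'e::euclidean_space \<Rightarrow> 'g::euclidean_space \<Rightarrow> 'f::real_normed_vector"
  assumes "bilinear B"
  shows "B u v = (\<Sum>i\<in>Basis. \<Sum>j\<in>Basis. ((u \<bullet> i) * (v \<bullet> j)) *\<^sub>R B i j)"
proof -
  have "B (\<Sum>i\<in>Basis. (u \<bullet> i) *\<^sub>R i) (\<Sum>j\<in>Basis. (v \<bullet> j) *\<^sub>R j)
      = (\<Sum>(i, j)\<in>Basis \<times> Basis. ((u \<bullet> i) * (v \<bullet> j)) *\<^sub>R B i j)"
    unfolding bilinear_sum[OF assms]
    by (auto simp: bilinear_lmul[OF assms] bilinear_rmul[OF assms] mult.commute intro!: sum.cong)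
  then show ?thesis unfolding euclidean_representation by (simp add: sum.cartesian_product)
qed

lemma smooth_on_bilinear_family:
  fixes B :: "'y::euclidean_space \<Rightarrow> 'e::euclidean_space \<Rightarrow> 'g::euclidean_space \<Rightarrow> 'f::real_normed_vector"
  assumes "open U" "open V" "\<forall>y\<in>V. bilinear (B y)" "\<And>u v. smooth_on V (\<lambda>y. B y u v)"
    and "f ` U \<subseteq> V" "smooth_on U f" "smooth_on U a" "smooth_on U b"
  shows "smooth_on U (\<lambda>z. B (f z) (a z) (b z))"
proof (rule smooth_on_cong[OF assms(1)])
  show "smooth_on U (\<lambda>z. \<Sum>i\<in>Basis. \<Sum>j\<in>Basis. ((a z \<bullet> i) * (b z \<bullet> j)) *\<^sub>R B (f z) i j)"
    by (intro smooth_on_sum smooth_on_scaleR smooth_on_mult smooth_on_inner_left assms(1,7,8)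
        smooth_on_compose[OF assms(1,2,5,6) assms(4)])
  show "(\<Sum>i\<in>Basis. \<Sum>j\<in>Basis. ((a z \<bullet> i) * (b z \<bullet> j)) *\<^sub>R B (f z) i j) = B (f z) (a z) (b z)" 
    if "z \<in> U" for z
    using bilinear_eq_sum[OF assms(3)[rule_format], of "f z" "a z" "b z"] that assms(5) by auto
qed

lemma dird_bilinear_family:
  fixes B :: "'y::euclidean_space \<Rightarrow> 'e::euclidean_space \<Rightarrow> 'g::euclidean_space \<Rightarrow> 'f::real_normed_vector"
  assumes "open U" "open V" "\<forall>y\<in>V. bilinear (B y)" "\<And>u v. smooth_on V (\<lambda>y. B y u v)"
    and "f ` U \<subseteq> V" "smooth_on U f" "smooth_on U a" "smooth_on U b" "z \<in> U"
  shows "dird v (\<lambda>z. B (f z) (a z) (b z)) z =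
    dird (dird v f z) (\<lambda>y. B y (a z) (b z)) (f z) + B (f z) (dird v a z) (b z) + B (f z) (a z) (dird v b z)"
proof -
  have fz: "f z \<in> V" using assms(5,9) by blast
  note sB = smooth_on_compose[OF assms(1,2,5,6) assms(4)]
  have 1: "dird w (\<lambda>y. B y p q) (f z) = (\<Sum>i\<in>Basis. \<Sum>j\<in>Basis. ((p \<bullet> i) * (q \<bullet> j)) *\<^sub>R dird w (\<lambda>y. B y i j) (f z))"
    for w p q
  proof -
    have "dird w (\<lambda>y. B y p q) (f z) = dird w (\<lambda>y. \<Sum>i\<in>Basis. \<Sum>j\<in>Basis. ((p \<bullet> i) * (q \<bullet> j)) *\<^sub>R B y i j) (f z)"
      by (rule dird_cong_open[OF assms(2) fz bilinear_eq_sum[OF assms(3)[rule_format]]])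
    also have "\<dots> = (\<Sum>i\<in>Basis. \<Sum>j\<in>Basis. ((p \<bullet> i) * (q \<bullet> j)) *\<^sub>R dird w (\<lambda>y. B y i j) (f z))"
      by (subst dird_sum[OF _ fz] dird_linear_comp[OF bounded_linear_scaleR_right assms(4) fz]
          | intro smooth_on_sum smooth_on_linear_comp[OF bounded_linear_scaleR_right] assms(2,4) sum.cong refl)+
    finally show ?thesis .
  qed
  have s: "smooth_on U (\<lambda>z. (a z \<bullet> i) * (b z \<bullet> j))" 
    "smooth_on U (\<lambda>z. ((a z \<bullet> i) * (b z \<bullet> j)) *\<^sub>R B (f z) i j)" for i j
    by (intro smooth_on_scaleR smooth_on_mult smooth_on_inner_left assms(1,7,8) sB)+
  have "dird v (\<lambda>z. B (f z) (a z) (b z)) z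
      = dird v (\<lambda>z. \<Sum>i\<in>Basis. \<Sum>j\<in>Basis. ((a z \<bullet> i) * (b z \<bullet> j)) *\<^sub>R B (f z) i j) z"
    using assms(5) by (intro dird_cong_open[OF assms(1,9)] bilinear_eq_sum assms(3)[rule_format]) blast
  also have "\<dots> = (\<Sum>i\<in>Basis. \<Sum>j\<in>Basis. dird v (\<lambda>z. ((a z \<bullet> i) * (b z \<bullet> j)) *\<^sub>R B (f z) i j) z)"
    by (subst dird_sum[OF _ assms(9)] | intro smooth_on_sum s assms(1) sum.cong refl)+
  also have "\<dots> = (\<Sum>i\<in>Basis. \<Sum>j\<in>Basis. 
      ((a z \<bullet> i) * (b z \<bullet> j)) *\<^sub>R dird (dird v f z) (\<lambda>y. B y i j) (f z)
      + ((dird v a z \<bullet> i) * (b z \<bullet> j)) *\<^sub>R B (f z) i j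
      + ((a z \<bullet> i) * (dird v b z \<bullet> j)) *\<^sub>R B (f z) i j)"
  proof (intro sum.cong refl)
    fix i :: 'e and j :: 'g
    have "dird v (\<lambda>z. ((a z \<bullet> i) * (b z \<bullet> j)) *\<^sub>R B (f z) i j) z
      = ((a z \<bullet> i) * (b z \<bullet> j)) *\<^sub>R dird v (\<lambda>z. B (f z) i j) z
        + dird v (\<lambda>z. (a z \<bullet> i) * (b z \<bullet> j)) z *\<^sub>R B (f z) i j"
      by (rule dird_scaleR[OF s(1) sB assms(9)])
    also have "dird v (\<lambda>z. (a z \<bullet> i) * (b z \<bullet> j)) z
        = (a z \<bullet> i) * (dird v b z \<bullet> j) + (dird v a z \<bullet> i) * (b z \<bullet> j)"
      by (simp add: dird_mult[OF smooth_on_inner_left[OF assms(1,7)] smooth_on_inner_left[OF assms(1,8)] assms(9)]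
          dird_linear_comp[OF bounded_linear_inner_left assms(7) assms(9)]
          dird_linear_comp[OF bounded_linear_inner_left assms(8) assms(9)])
    also have "dird v (\<lambda>z. B (f z) i j) z = dird (dird v f z) (\<lambda>y. B y i j) (f z)"
      by (rule dird_compose[OF assms(6) assms(4) assms(9) fz])
    finally show "dird v (\<lambda>z. ((a z \<bullet> i) * (b z \<bullet> j)) *\<^sub>R B (f z) i j) z = 
      ((a z \<bullet> i) * (b z \<bullet> j)) *\<^sub>R dird (dird v f z) (\<lambda>y. B y i j) (f z)
      + ((dird v a z \<bullet> i) * (b z \<bullet> j)) *\<^sub>R B (f z) i j
      + ((a z \<bullet> i) * (dird v b z \<bullet> j)) *\<^sub>R B (f z) i j"
      by (simp add: scaleR_left_distrib)
  qed
  also have "\<dots> = dird (dird v f z) (\<lambda>y. B y (a z) (b z)) (f z) + B (f z) (dird v a z) (b z) + B (f z) (a z) (dird v b z)"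
    unfolding 1[of "dird v f z" "a z" "b z"] bilinear_eq_sum[OF bspec[OF assms(3) fz], of "dird v a z"]
      bilinear_eq_sum[OF bspec[OF assms(3) fz], of _ "dird v b z"]
    by (simp add: sum.distrib)
  finally show ?thesis .
qed

section \<open>Inner products and orthonormal bases\<close>

definition inner_form :: "('e::real_vector \<Rightarrow> 'e \<Rightarrow> real) \<Rightarrow> bool" where
  "inner_form k \<longleftrightarrow> bilinear k \<and> (\<forall>u v. k u v = k v u) \<and> (\<forall>u. u \<noteq> 0 \<longrightarrow> k u u > 0)"

lemma inner_formD:
  assumes "inner_form k"
  shows "bilinear k" "k u v = k v u" "u \<noteq> 0 \<Longrightarrow> k u u > 0" "k u u \<ge> 0" "k u u = 0 \<longleftrightarrow> u = 0"
proof -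
  show b: "bilinear k" and "k u v = k v u" and p: "u \<noteq> 0 \<Longrightarrow> k u u > 0"
    using assms by (simp_all add: inner_form_def)
  show "k u u \<ge> 0" "k u u = 0 \<longleftrightarrow> u = 0"
    using p bilinear_lzero[OF b, of u] by (cases "u = 0"; force)+
qed

lemma inner_form_eqI:
  assumes "inner_form k" "\<And>w. k u w = k v w"
  shows "u = v"
proof -
  have "k (u - v) (u - v) = 0"
    using assms(2)[of "u - v"] bilinear_lsub[OF inner_formD(1)[OF assms(1)]] by simp
  then show ?thesis using inner_formD(5)[OF assms(1)] by simp
qed

lemma inner_form_strict_Cauchy_Schwarz:
  assumes "inner_form k" "u \<noteq> v" "independent {u, v}"
  shows "k u u * k v v - (k u v)\<^sup>2 > 0"
proof -
  note b = inner_formD(1)[OF assms(1)]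
  have "v \<noteq> 0" using assms(3) dependent_zero by blast
  have v: "k v v > 0" using inner_formD(3)[OF assms(1) \<open>v \<noteq> 0\<close>] .
  define w where "w = k v v *\<^sub>R u - k u v *\<^sub>R v"
  have "w \<noteq> 0"
  proof
    assume "w = 0"
    then have "k v v *\<^sub>R u = k u v *\<^sub>R v" by (simp add: w_def)
    then have "u = (1 / k v v) *\<^sub>R (k u v *\<^sub>R v)"
      using v by (metis divide_self_if less_irrefl scaleR_one scaleR_scaleR times_divide_eq_left mult_1)
    then have "u \<in> span {v}" by (metis span_base span_scale singletonI)
    then show False
      using assms(2,3) by (simp add: independent_insert)
  qed
  then have "0 < k w w" using inner_formD(3)[OF assms(1)] by blast
  also have "k w w = k v v * (k u u * k v v - (k u v)\<^sup>2)"
    unfolding w_def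
    by (simp add: bilinear_lsub[OF b] bilinear_rsub[OF b] bilinear_lmul[OF b] bilinear_rmul[OF b]
        inner_formD(2)[OF assms(1), of v u] power2_eq_square algebra_simps)
  finally show ?thesis using v by (simp add: zero_less_mult_iff)
qed

definition gram :: "(real^'n \<Rightarrow> real^'n \<Rightarrow> real) \<Rightarrow> real^'n^'n" where
  "gram k = (\<chi> i j. k (axis i 1) (axis j 1))"

lemma vec_eq_sum_axis: "(v :: real^'n) = (\<Sum>j\<in>UNIV. v $ j *\<^sub>R axis j 1)"
  by (simp add: vec_eq_iff axis_def sum.delta if_distrib cong: if_cong)

lemma linear_eq_sum_axis:
  fixes v :: "real^'n"
  assumes "linear (L :: real^'n \<Rightarrow> 'f::real_vector)"
  shows "L v = (\<Sum>j\<in>UNIV. v $ j *\<^sub>R L (axis j 1))"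
proof -
  have "L (\<Sum>j\<in>UNIV. v $ j *\<^sub>R axis j 1) = (\<Sum>j\<in>UNIV. v $ j *\<^sub>R L (axis j 1))"
    unfolding linear_sum[OF assms] linear_scale[OF assms] ..
  then show ?thesis unfolding vec_eq_sum_axis[symmetric] .
qed

lemma gram_mult:
  assumes "bilinear k"
  shows "(gram k *v z) $ i = k (axis i 1) z"
  using linear_eq_sum_axis[of "k (axis i 1)" z] assms
  by (simp add: gram_def matrix_vector_mult_def bilinear_def mult.commute)

lemma det_gram_nonzero:
  assumes "inner_form k"
  shows "det (gram k) \<noteq> 0"
proof -
  note b = inner_formD(1)[OF assms]
  have "z = 0" if "gram k *v z = 0" for z
  proof -
    have "k (axis i 1) z = 0" for i
      using gram_mult[OF b, of z i] that by simp
    then have "k z z = 0"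
      using linear_eq_sum_axis[of "\<lambda>w. k w z" z] b by (simp add: bilinear_def)
    then show ?thesis using inner_formD(5)[OF assms] by simp
  qed
  then have "inj ((*v) (gram k))"
    by (simp add: linear_injective_0)
  then show ?thesis
    by (metis invertible_det_nz invertible_left_inverse matrix_left_invertible_injective)
qed

definition gram_inv :: "(real^'n \<Rightarrow> real^'n \<Rightarrow> real) \<Rightarrow> 'n \<Rightarrow> 'n \<Rightarrow> real" where
  "gram_inv k i j =
     det (\<chi> a l. if l = i then (axis j 1 :: real^'n) $ a else gram k $ a $ l) / det (gram k)"

lemma gram_inv_right:
  assumes "inner_form k"
  shows "gram k ** (\<chi> i j. gram_inv k i j) = mat 1"
proof -
  have "gram k *v (\<chi> i. gram_inv k i j) = axis j 1" for j
    unfolding cramer[OF det_gram_nonzero[OF assms]] by (simp add: gram_inv_def)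
  then have "(gram k *v (\<chi> i. gram_inv k i j)) $ i = (axis j 1 :: real^'a) $ i" for i j
    by metis
  then show ?thesis
    by (auto simp: vec_eq_iff matrix_matrix_mult_def matrix_vector_mult_def mat_def axis_def)
qed

lemma gram_inv_unique:
  assumes "inner_form k" "gram k ** P = mat 1"
  shows "P = (\<chi> i j. gram_inv k i j)"
  by (metis assms gram_inv_right matrix_left_right_inverse matrix_mul_assoc matrix_mul_lid matrix_mul_rid)

lemma inner_form_solve:
  fixes k :: "real^'n \<Rightarrow> real^'n \<Rightarrow> real"
  assumes "inner_form k" "linear \<phi>"
  shows "k (\<chi> i. \<Sum>j\<in>UNIV. gram_inv k i j * \<phi> (axis j 1)) w = \<phi> w"
proof -
  note b = inner_formD(1)[OF assms(1)]
  define z where "z = (\<chi> i. \<Sum>j\<in>UNIV. gram_inv k i j * \<phi> (axis j 1))"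
  have z: "z = (\<chi> i j. gram_inv k i j) *v (\<chi> j. \<phi> (axis j 1))"
    by (simp add: z_def matrix_vector_mult_def)
  have "gram k *v z = (\<chi> j. \<phi> (axis j 1))"
    unfolding z by (simp add: matrix_vector_mul_assoc gram_inv_right[OF assms(1)])
  then have "k (axis i 1) z = \<phi> (axis i 1)" for i
    using gram_mult[OF b, of z i] by simp
  moreover have "k w z = (\<Sum>j\<in>UNIV. w $ j *\<^sub>R k (axis j 1) z)"
    using linear_eq_sum_axis[of "\<lambda>w. k w z" w] b by (simp add: bilinear_def)
  ultimately have "k w z = \<phi> w"
    using linear_eq_sum_axis[OF assms(2), of w] by simp
  then show ?thesis
    using inner_formD(2)[OF assms(1)] by (simp add: z_def)
qed

lemma orthonormal_independent:
  fixes b :: "'e::euclidean_space set"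
  assumes "inner_form k" "\<forall>u\<in>b. \<forall>v\<in>b. k u v = (if u = v then 1 else 0)"
  shows "independent b" "finite b"
proof -
  note bl = inner_formD(1)[OF assms(1)]
  show "independent b"
    unfolding dependent_explicit
  proof safe
    fix t f u
    assume t: "finite t" "t \<subseteq> b" "(\<Sum>v\<in>t. f v *\<^sub>R v) = 0" and u: "u \<in> t" "f u \<noteq> (0::real)"
    have "k (\<Sum>v\<in>t. f v *\<^sub>R v) u = (\<Sum>v\<in>t. f v * k v u)"
      using linear_sum[of "\<lambda>w. k w u" "\<lambda>v. f v *\<^sub>R v" t] bl
      by (simp add: bilinear_lmul[OF bl] bilinear_def)
    also have "\<dots> = (\<Sum>v\<in>t. if v = u then f v else 0)"
      using t(2) u(1) assms(2) by (intro sum.cong refl) (auto simp: subset_iff)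
    also have "\<dots> = f u" using t(1) u(1) by simp
    finally show False using t(3) u(2) bilinear_lzero[OF bl] by simp
  qed
  then show "finite b" using independent_bound by blast
qed

lemma orthonormal_basis_finite:
  fixes b :: "'e::euclidean_space set"
  shows "inner_form k \<Longrightarrow> orthonormal_basis k b \<Longrightarrow> finite b"
  using orthonormal_independent(2) unfolding orthonormal_basis_def by blast

lemma orthonormal_basis_expansion:
  fixes b :: "'e::euclidean_space set"
  assumes "inner_form k" "orthonormal_basis k b"
  shows "v = (\<Sum>e\<in>b. k v e *\<^sub>R e)"
proof -
  note bl = inner_formD(1)[OF assms(1)] and fin = orthonormal_basis_finite[OF assms]
  have ob: "k u v = (if u = v then 1 else 0)" if "u \<in> b" "v \<in> b" for u v
    using assms(2) that by (auto simp: orthonormal_basis_def)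
  have "v \<in> span b" using assms(2) by (simp add: orthonormal_basis_def)
  then obtain f where f: "v = (\<Sum>e\<in>b. f e *\<^sub>R e)"
    unfolding span_finite[OF fin] by auto
  have "k v e = f e" if "e \<in> b" for e
  proof -
    have "k v e = (\<Sum>u\<in>b. f u * k u e)"
      unfolding f using linear_sum[of "\<lambda>w. k w e" "\<lambda>v. f v *\<^sub>R v" b] bl
      by (simp add: bilinear_lmul[OF bl] bilinear_def)
    also have "\<dots> = (\<Sum>u\<in>b. if u = e then f u else 0)"
      using that by (intro sum.cong refl) (auto simp: ob)
    also have "\<dots> = f e" using that fin by simp
    finally show ?thesis .
  qed
  then show ?thesis using f by simp
qed

lemma orthonormal_basis_exists:
  fixes k :: "'e::euclidean_space \<Rightarrow> 'e \<Rightarrow> real"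
  assumes "inner_form k"
  shows "\<exists>b. orthonormal_basis k b"
proof -
  note bl = inner_formD(1)[OF assms]
  define on where "on b \<longleftrightarrow> (\<forall>u\<in>b. \<forall>v\<in>b. k u v = (if u = v then 1 else 0))" for b
  note ind = orthonormal_independent[OF assms, folded on_def]
  have bound: "card b \<le> DIM('e)" if "on b" for b
    using independent_bound[OF ind(1)[OF that]] by simp
  have "on {}" by (simp add: on_def)
  then obtain b where b: "on b" and max: "\<And>b'. on b' \<Longrightarrow> card b' \<le> card b"
    using ex_has_greatest_nat[of on "{}" card "DIM('e) + 1"] bound by (metis le_imp_less_Suc Suc_eq_plus1)
  note fin = ind(2)[OF b]
  have "span b = UNIV"
  proof (rule ccontr)
    assume "span b \<noteq> UNIV"
    then obtain v where v: "v \<notin> span b" by blast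
    define w where "w = v - (\<Sum>e\<in>b. k v e *\<^sub>R e)"
    have "(\<Sum>e\<in>b. k v e *\<^sub>R e) \<in> span b"
      by (intro span_sum span_scale span_base)
    then have w: "w \<notin> span b"
      unfolding w_def using v by (metis diff_add_cancel span_add)
    then have "w \<noteq> 0" using span_zero by auto
    then have pos: "k w w > 0" using inner_formD(3)[OF assms] by blast
    have orth: "k w e = 0" if "e \<in> b" for e
    proof -
      have "k (\<Sum>u\<in>b. k v u *\<^sub>R u) e = (\<Sum>u\<in>b. k v u * k u e)"
        using linear_sum[of "\<lambda>w. k w e" "\<lambda>u. k v u *\<^sub>R u" b] bl
        by (simp add: bilinear_lmul[OF bl] bilinear_def)
      also have "\<dots> = (\<Sum>u\<in>b. if u = e then k v u else 0)"
        using that b by (intro sum.cong refl) (auto simp: on_def)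
      also have "\<dots> = k v e" using that fin by simp
      finally show ?thesis unfolding w_def by (simp add: bilinear_lsub[OF bl])
    qed
    define n where "n = (1 / sqrt (k w w)) *\<^sub>R w"
    have "n \<notin> b"
      using w pos span_scale[OF span_base[of n b], of "sqrt (k w w)"] by (auto simp: n_def)
    moreover have "k n n = 1"
      using pos by (simp add: n_def bilinear_lmul[OF bl] bilinear_rmul[OF bl] field_simps)
    moreover have "k n e = 0" "k e n = 0" if "e \<in> b" for e
      using orth[OF that] inner_formD(2)[OF assms, of e n]
      by (simp_all add: n_def bilinear_lmul[OF bl])
    ultimately have "on (insert n b)"
      using b by (auto simp: on_def)
    from max[OF this] show False using \<open>n \<notin> b\<close> fin by simp
  qed
  then show ?thesis using b by (auto simp: orthonormal_basis_def on_def)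
qed

lemma trace_orthonormal_basis:
  fixes k :: "real^'n \<Rightarrow> real^'n \<Rightarrow> real"
  assumes "inner_form k" "orthonormal_basis k b" "bilinear B"
  shows "(\<Sum>e\<in>b. B e e) = (\<Sum>i\<in>UNIV. \<Sum>j\<in>UNIV. gram_inv k i j * B (axis i 1) (axis j 1))"
proof -
  define P :: "real^'n^'n" where "P = (\<chi> i j. \<Sum>e\<in>b. e $ i * e $ j)"
  have "(gram k ** P) $ i $ j = (if i = j then 1 else 0)" for i j
  proof -
    have "(gram k ** P) $ i $ j = (\<Sum>l\<in>UNIV. \<Sum>e\<in>b. (k (axis i 1) (axis l 1) * e $ l) * e $ j)"
      by (simp add: matrix_matrix_mult_def gram_def P_def sum_distrib_left mult.assoc)
    also have "\<dots> = (\<Sum>e\<in>b. (gram k *v e) $ i * e $ j)"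
      by (subst sum.swap) (simp add: gram_def matrix_vector_mult_def sum_distrib_right)
    also have "\<dots> = (\<Sum>e\<in>b. k (axis i 1) e *\<^sub>R e) $ j"
      by (simp add: gram_mult[OF inner_formD(1)[OF assms(1)]])
    also have "\<dots> = axis i 1 $ j"
      unfolding orthonormal_basis_expansion[OF assms(1,2), symmetric] ..
    finally show ?thesis by (simp add: axis_def eq_commute)
  qed
  then have "gram k ** P = mat 1" by (simp add: vec_eq_iff mat_def)
  then have "P = (\<chi> i j. gram_inv k i j)" by (rule gram_inv_unique[OF assms(1)])
  then have P: "P $ i $ j = gram_inv k i j" for i j by simp
  have B: "B e e = (\<Sum>i\<in>UNIV. \<Sum>j\<in>UNIV. (e $ i * e $ j) * B (axis i 1) (axis j 1))" for e
  proof -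
    have "B e e = (\<Sum>i\<in>UNIV. e $ i *\<^sub>R B (axis i 1) e)"
      using linear_eq_sum_axis[of "\<lambda>u. B u e" e] assms(3) by (simp add: bilinear_def)
    also have "\<dots> = (\<Sum>i\<in>UNIV. e $ i *\<^sub>R (\<Sum>j\<in>UNIV. e $ j *\<^sub>R B (axis i 1) (axis j 1)))"
      using linear_eq_sum_axis[of "B _" e] assms(3) by (simp add: bilinear_def)
    finally show ?thesis by (simp add: sum_distrib_left mult.assoc)
  qed
  have "(\<Sum>e\<in>b. B e e) = (\<Sum>i\<in>UNIV. \<Sum>j\<in>UNIV. \<Sum>e\<in>b. (e $ i * e $ j) * B (axis i 1) (axis j 1))"
    unfolding B by (subst sum.swap, intro sum.cong refl, subst sum.swap, rule refl)
  also have "\<dots> = (\<Sum>i\<in>UNIV. \<Sum>j\<in>UNIV. P $ i $ j * B (axis i 1) (axis j 1))"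
    by (simp add: P_def sum_distrib_right)
  finally show ?thesis unfolding P .
qed

lemma smooth_on_det:
  fixes A :: "'e::real_normed_vector \<Rightarrow> real^'n^'n"
  assumes "open S" "\<And>i j. smooth_on S (\<lambda>x. A x $ i $ j)"
  shows "smooth_on S (\<lambda>x. det (A x))"
  unfolding det_def
  by (intro smooth_on_sum smooth_on_mult smooth_on_const smooth_on_prod assms)

lemma smooth_on_gram_inv:
  assumes "open V" "\<And>y. y \<in> V \<Longrightarrow> inner_form (k y)" "\<And>u v. smooth_on V (\<lambda>y. k y u v)"
  shows "smooth_on V (\<lambda>y. gram_inv (k y) i j)"
  unfolding gram_inv_def
proof (intro smooth_on_divide smooth_on_det assms(1))
  show "smooth_on V (\<lambda>y. (\<chi> a l. if l = i then axis j 1 $ a else gram (k y) $ a $ l) $ p $ q)" for p q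
    using assms(1,3) by (cases "q = i") (auto simp: gram_def smooth_on_const)
  show "smooth_on V (\<lambda>y. gram (k y) $ p $ q)" for p q
    using assms(3) by (simp add: gram_def)
  show "det (gram (k y)) \<noteq> 0" if "y \<in> V" for y
    by (rule det_gram_nonzero[OF assms(2)[OF that]])
qed

section \<open>The Levi-Civita connection in coordinates\<close>

locale local_metric =
  fixes V :: "(real^'n) set" and k :: "real^'n \<Rightarrow> real^'n \<Rightarrow> real^'n \<Rightarrow> real"
  assumes open_V: "open V"
    and inner_form_k: "y \<in> V \<Longrightarrow> inner_form (k y)"
    and smooth_k: "smooth_on V (\<lambda>y. k y u v)"
begin

lemma bilinear_k: "y \<in> V \<Longrightarrow> bilinear (k y)"
  and sym_k: "y \<in> V \<Longrightarrow> k y u v = k y v u"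
  using inner_form_k inner_formD(1,2) by blast+

lemma bilinear_k': "\<forall>y\<in>V. bilinear (k y)"
  using bilinear_k by blast

lemmas k_simps =
  bilinear_ladd[OF bilinear_k] bilinear_radd[OF bilinear_k]
  bilinear_lsub[OF bilinear_k] bilinear_rsub[OF bilinear_k]
  bilinear_lmul[OF bilinear_k] bilinear_rmul[OF bilinear_k]

lemma dird_k_add: "y \<in> V \<Longrightarrow> dird w (\<lambda>p. k p u (v + v')) y = dird w (\<lambda>p. k p u v) y + dird w (\<lambda>p. k p u v') y"
  using dird_add[OF smooth_k smooth_k, of y w u v u v'] dird_cong_open[OF open_V, of y "\<lambda>p. k p u (v + v')"]
  by (simp add: k_simps)

lemma dird_k_scale: "y \<in> V \<Longrightarrow> dird w (\<lambda>p. k p u (c *\<^sub>R v)) y = c * dird w (\<lambda>p. k p u v) y"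
  using dird_linear_comp[OF bounded_linear_mult_right smooth_k, of y w c u v]
    dird_cong_open[OF open_V, of y "\<lambda>p. k p u (c *\<^sub>R v)"]
  by (simp add: k_simps)

lemma dird_k_sym: "y \<in> V \<Longrightarrow> dird w (\<lambda>p. k p u v) y = dird w (\<lambda>p. k p v u) y"
  using sym_k by (intro dird_cong_open[OF open_V]) auto

definition koszul :: "real^'n \<Rightarrow> real^'n \<Rightarrow> real^'n \<Rightarrow> real^'n \<Rightarrow> real" where
  "koszul y u v w = (dird u (\<lambda>p. k p v w) y + dird v (\<lambda>p. k p u w) y - dird w (\<lambda>p. k p u v) y) / 2"

lemma linear_koszul:
  assumes "y \<in> V"
  shows "linear (koszul y u v)"
proof -
  note l = linear_dird[OF smooth_k assms, of u v]
  show ?thesis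
    by (rule linearI)
      (simp_all add: koszul_def dird_k_add dird_k_scale assms linear_add[OF l] linear_scale[OF l] field_simps)
qed

lemma christoffel_eqI:
  assumes "y \<in> V" "\<And>w. k y z w = koszul y u v w"
  shows "christoffel k y u v = z"
  unfolding christoffel_def dird_def[symmetric]
proof (rule the_equality)
  show "\<forall>w. 2 * k y z w = dird u (\<lambda>p. k p v w) y + dird v (\<lambda>p. k p u w) y - dird w (\<lambda>p. k p u v) y"
    using assms(2) by (simp add: koszul_def field_simps)
  show "z' = z" if "\<forall>w. 2 * k y z' w = dird u (\<lambda>p. k p v w) y + dird v (\<lambda>p. k p u w) y
      - dird w (\<lambda>p. k p u v) y" for z'
  proof (rule inner_form_eqI[OF inner_form_k[OF assms(1)]])
    show "k y z' w = k y z w" for w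
    proof -
      have "2 * k y z' w = 2 * koszul y u v w"
        using that by (simp add: koszul_def)
      then show ?thesis using assms(2)[of w] by simp
    qed
  qed
qed

lemma christoffel_eq:
  assumes "y \<in> V"
  shows "christoffel k y u v = (\<chi> i. \<Sum>j\<in>UNIV. gram_inv (k y) i j * koszul y u v (axis j 1))"
  by (rule christoffel_eqI[OF assms inner_form_solve[OF inner_form_k[OF assms] linear_koszul[OF assms]]])

lemma k_christoffel: "y \<in> V \<Longrightarrow> k y (christoffel k y u v) w = koszul y u v w"
  by (simp add: christoffel_eq inner_form_solve inner_form_k linear_koszul)

lemma christoffel_sym: "y \<in> V \<Longrightarrow> christoffel k y u v = christoffel k y v u"
  by (rule christoffel_eqI) (auto simp: k_christoffel koszul_def dird_k_sym[of y _ u v])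

lemma bilinear_christoffel:
  assumes y: "y \<in> V"
  shows "bilinear (christoffel k y)"
proof -
  have "linear (christoffel k y u)" for u
  proof (rule linearI)
    show "christoffel k y u (v + v') = christoffel k y u v + christoffel k y u v'" for v v'
      using linear_add[OF linear_dird[OF smooth_k y]]
      by (intro christoffel_eqI y)
        (simp add: k_simps y k_christoffel koszul_def dird_k_add dird_k_sym[OF y, of _ "_ + _"]
          dird_k_sym[OF y, of _ v] dird_k_sym[OF y, of _ v'] field_simps)
    show "christoffel k y u (c *\<^sub>R v) = c *\<^sub>R christoffel k y u v" for c v
      using linear_scale[OF linear_dird[OF smooth_k y]]
      by (intro christoffel_eqI y)
        (simp add: k_simps y k_christoffel koszul_def dird_k_scale dird_k_sym[OF y, of _ "_ *\<^sub>R _"]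
          dird_k_sym[OF y, of _ v] field_simps)
  qed
  then show ?thesis
    unfolding bilinear_def using christoffel_sym[OF y] by auto
qed

lemma bilinear_christoffel': "\<forall>y\<in>V. bilinear (christoffel k y)"
  using bilinear_christoffel by blast

lemma smooth_on_vec_lambda:
  fixes f :: "'i::finite \<Rightarrow> 'e::real_normed_vector \<Rightarrow> real"
  assumes "open S" "\<And>i. smooth_on S (f i)"
  shows "smooth_on S (\<lambda>x. \<chi> i. f i x)"
proof (rule smooth_on_cong[OF assms(1)])
  show "smooth_on S (\<lambda>x. \<Sum>i\<in>UNIV. f i x *\<^sub>R axis i (1::real))"
    by (intro smooth_on_sum smooth_on_scaleR smooth_on_const assms)
  show "(\<Sum>i\<in>UNIV. f i x *\<^sub>R axis i 1) = (\<chi> i. f i x)" for x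
    using vec_eq_sum_axis[of "\<chi> i. f i x"] by simp
qed

lemma smooth_christoffel: "smooth_on V (\<lambda>y. christoffel k y u v)"
proof (rule smooth_on_cong[OF open_V])
  show "smooth_on V (\<lambda>y. \<chi> i. \<Sum>j\<in>UNIV. gram_inv (k y) i j * koszul y u v (axis j 1))"
    unfolding koszul_def
    by (intro smooth_on_vec_lambda smooth_on_sum smooth_on_mult smooth_on_divide smooth_on_const
        smooth_on_add smooth_on_diff smooth_on_dird smooth_k open_V smooth_on_gram_inv inner_form_k) auto
qed (simp add: christoffel_eq)

lemma metric_compatible:
  assumes "y \<in> V"
  shows "dird w (\<lambda>p. k p u v) y = k y (christoffel k y w u) v + k y u (christoffel k y w v)"
  using assms
  by (simp add: sym_k[of y u "christoffel k y w v"] k_christoffel koszul_def dird_k_sym[of y _ u v] field_simps)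

text \<open>\<open>f\<close> is a map into the coordinate patch, \<open>X\<close> a vector field along \<open>f\<close>.\<close>

definition cov :: "('z::euclidean_space \<Rightarrow> real^'n) \<Rightarrow> 'z \<Rightarrow> ('z \<Rightarrow> real^'n) \<Rightarrow> 'z \<Rightarrow> real^'n" where
  "cov f v X z = dird v X z + christoffel k (f z) (dird v f z) (X z)"

context
  fixes U :: "'z::euclidean_space set" and f :: "'z \<Rightarrow> real^'n"
  assumes open_U: "open U" and f: "f ` U \<subseteq> V" "smooth_on U f"
begin

lemmas smooth_k_along = smooth_on_bilinear_family[OF open_U open_V bilinear_k' smooth_k f]
lemmas smooth_christoffel_along =
  smooth_on_bilinear_family[OF open_U open_V bilinear_christoffel' smooth_christoffel f]

lemma smooth_cov: "smooth_on U X \<Longrightarrow> smooth_on U (cov f v X)"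
  unfolding cov_def
  by (intro smooth_on_add open_U smooth_on_dird smooth_christoffel_along f)

lemma dird_k_along:
  assumes "smooth_on U X" "smooth_on U Y" "z \<in> U"
  shows "dird v (\<lambda>z. k (f z) (X z) (Y z)) z = k (f z) (cov f v X z) (Y z) + k (f z) (X z) (cov f v Y z)"
proof -
  have fz: "f z \<in> V" using f(1) assms(3) by blast
  show ?thesis
    unfolding dird_bilinear_family[OF open_U open_V bilinear_k' smooth_k f assms, of v]
      metric_compatible[OF fz] cov_def
    by (simp add: k_simps fz)
qed

lemma cov_commute:
  assumes "z \<in> U"
  shows "cov f v (dird w f) z = cov f w (dird v f) z"
proof -
  have fz: "f z \<in> V" using f(1) assms by blast
  show ?thesis
    unfolding cov_def christoffel_sym[OF fz, of "dird v f z"] dird_commute[OF open_U f(2) assms, of v w] ..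
qed

lemma cov_curvature:
  assumes X: "smooth_on U X" and z: "z \<in> U"
  shows "cov f v (cov f w X) z - cov f w (cov f v X) z
    = riemann_curvature k (f z) (dird v f z) (dird w f z) (X z)"
proof -
  have fz: "f z \<in> V" using f(1) z by blast
  note b = bilinear_christoffel[OF fz]
  have 1: "dird a (cov f b X) z = dird a (dird b X) z +
     (dird (dird a f z) (\<lambda>y. christoffel k y (dird b f z) (X z)) (f z)
      + christoffel k (f z) (dird a (dird b f) z) (X z) + christoffel k (f z) (dird b f z) (dird a X z))" for a b
  proof -
    have "dird a (cov f b X) z = dird a (dird b X) z + dird a (\<lambda>z. christoffel k (f z) (dird b f z) (X z)) z"
      unfolding cov_def
      by (rule dird_add[OF smooth_on_dird[OF X] smooth_christoffel_along[OF smooth_on_dird[OF f(2)] X] z])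
    also have "dird a (\<lambda>z. christoffel k (f z) (dird b f z) (X z)) z 
      = dird (dird a f z) (\<lambda>y. christoffel k y (dird b f z) (X z)) (f z)
      + christoffel k (f z) (dird a (dird b f) z) (X z) + christoffel k (f z) (dird b f z) (dird a X z)"
      by (rule dird_bilinear_family[OF open_U open_V bilinear_christoffel' smooth_christoffel f 
            smooth_on_dird[OF f(2)] X z])
    finally show ?thesis .
  qed
  show ?thesis
    unfolding riemann_curvature_def dird_def[symmetric] cov_def[of f v "cov f w X"] cov_def[of f w "cov f v X"] 1
      dird_commute[OF open_U f(2) z, of v w] dird_commute[OF open_U X z, of v w]
      cov_def[of f w X z] cov_def[of f v X z]
    by (simp add: bilinear_radd[OF b])
qed

end

lemma curvature_skew:
  assumes "y \<in> V"
  shows "k y (riemann_curvature k y u v X) Y + k y X (riemann_curvature k y u v Y) = 0"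
proof -
  have id: "(\<lambda>y. y) ` V \<subseteq> V" "smooth_on V (\<lambda>y. y)"
    by (auto intro: smooth_on_linear open_V bounded_linear_ident)
  have di: "dird v (\<lambda>y. y) y = v" for v :: "real^'n" and y
    by (simp add: dird_def)
  let ?X = "\<lambda>y::real^'n. X" and ?Y = "\<lambda>y::real^'n. Y" and ?c = "cov (\<lambda>y. y)"
  have s: "smooth_on V ?X" "smooth_on V ?Y" by (auto intro: smooth_on_const open_V)
  note sc = smooth_cov[OF open_V id]
  have D: "dird a (dird b (\<lambda>y. k y X Y)) y = k y (?c a (?c b ?X) y) Y + k y (?c b ?X y) (?c a ?Y y)
     + (k y (?c a ?X y) (?c b ?Y y) + k y X (?c a (?c b ?Y) y))" for a b
  proof -
    have "dird a (dird b (\<lambda>y. k y X Y)) y = dird a (\<lambda>y. k y (?c b ?X y) Y + k y X (?c b ?Y y)) y"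
      by (rule dird_cong_open[OF open_V assms dird_k_along[OF open_V id s]])
    also have "\<dots> = dird a (\<lambda>y. k y (?c b ?X y) Y) y + dird a (\<lambda>y. k y X (?c b ?Y y)) y"
      by (rule dird_add[OF smooth_k_along[OF open_V id sc[OF s(1)] s(2)]
            smooth_k_along[OF open_V id s(1) sc[OF s(2)]] assms])
    finally show ?thesis
      by (simp only: dird_k_along[OF open_V id sc[OF s(1)] s(2) assms]
          dird_k_along[OF open_V id s(1) sc[OF s(2)] assms])
  qed
  have "dird u (dird v (\<lambda>y. k y X Y)) y = dird v (dird u (\<lambda>y. k y X Y)) y"
    by (rule dird_commute[OF open_V smooth_k assms])
  then have "k y (?c u (?c v ?X) y - ?c v (?c u ?X) y) Y + k y X (?c u (?c v ?Y) y - ?c v (?c u ?Y) y) = 0"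
    unfolding D using assms by (simp add: k_simps)
  then show ?thesis
    unfolding cov_curvature[OF open_V id s(1) assms] cov_curvature[OF open_V id s(2) assms] di .
qed

text \<open>On linearly dependent vectors, which the definition of nonpositive sectional curvature does
  not cover, the curvature form vanishes by skew-symmetry.\<close>

lemma curvature_nonneg:
  assumes "y \<in> V"
    and K: "\<And>u v. u \<noteq> v \<Longrightarrow> independent {u, v} \<Longrightarrow>
      k y (riemann_curvature k y u v v) u / (k y u u * k y v v - (k y u v)\<^sup>2) \<le> 0"
  shows "k y (riemann_curvature k y u v u) v \<ge> 0"
proof -
  let ?R = "riemann_curvature k y u v"
  have sk: "k y (?R u) v = - k y (?R v) u"
    using curvature_skew[OF assms(1), of u v u v] sym_k[OF assms(1), of u "?R v"] by simp
  have z: "k y (?R X) X = 0" for X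
    using curvature_skew[OF assms(1), of u v X X] sym_k[OF assms(1), of X "?R X"] by simp
  consider "u \<noteq> v" "independent {u, v}" | c where "u = c *\<^sub>R v" | "v = 0"
  proof (cases "v = 0 \<or> u \<in> span {v}")
    case True
    then show ?thesis using that by (auto simp: span_singleton)
  next
    case False
    then have "u \<noteq> v" using span_base by blast
    then show ?thesis using that(1) False by (simp add: independent_insert dependent_single)
  qed
  then show ?thesis
  proof cases
    case 1
    then show ?thesis
      using K[OF 1] inner_form_strict_Cauchy_Schwarz[OF inner_form_k[OF assms(1)] 1] sk
      by (simp add: divide_le_0_iff)
  next
    case (2 c)
    have "k y (?R v) u = c * k y (?R v) v"
      using assms(1) by (subst (2) 2) (simp add: k_simps)
    then show ?thesis using sk z by simp
  next
    case 3
    then show ?thesis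
      using bilinear_rzero[OF bilinear_k[OF assms(1)]] by simp
  qed
qed

end

section \<open>Charts and chart changes\<close>

abbreviation chart_img :: "('a, 'e) chart \<Rightarrow> 'e set" where
  "chart_img c \<equiv> chart_map c ` chart_dom c"

locale riem_manifold =
  fixes M :: "('a::{t2_space,second_countable_topology}, real^'m) riem"
  assumes riemannian: "riemannian_manifold M"
begin

lemma is_chart: "c \<in> atlas M \<Longrightarrow> is_chart c"
  using riemannian unfolding riemannian_manifold_def smooth_atlas_def by blast

lemma open_chart_dom: "c \<in> atlas M \<Longrightarrow> open (chart_dom c)"
  and open_chart_img: "c \<in> atlas M \<Longrightarrow> open (chart_img c)"
  and chart_homeomorphism:
    "c \<in> atlas M \<Longrightarrow> homeomorphism (chart_dom c) (chart_img c) (chart_map c) (chart_inv c)"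
  using is_chart by (auto simp: is_chart_def)

lemma chart_inv_map: "c \<in> atlas M \<Longrightarrow> x \<in> chart_dom c \<Longrightarrow> chart_inv c (chart_map c x) = x"
  using chart_homeomorphism homeomorphism_apply1 by blast

lemma chart_map_inv: "c \<in> atlas M \<Longrightarrow> y \<in> chart_img c \<Longrightarrow> chart_map c (chart_inv c y) = y"
  using chart_homeomorphism homeomorphism_apply2 by blast

lemma chart_inv_in: "y \<in> chart_img c \<Longrightarrow> chart_inv c y \<in> chart_dom c"
  by (rule inv_into_into)

lemma continuous_on_chart_map: "c \<in> atlas M \<Longrightarrow> continuous_on (chart_dom c) (chart_map c)"
  using chart_homeomorphism homeomorphism_cont1 by blast

lemma continuous_on_chart_inv: "c \<in> atlas M \<Longrightarrow> continuous_on (chart_img c) (chart_inv c)"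
  using chart_homeomorphism homeomorphism_cont2 by blast

lemma chart_exists: obtains c where "c \<in> atlas M" "x \<in> chart_dom c"
proof -
  have "x \<in> (\<Union>c\<in>atlas M. chart_dom c)"
    using riemannian by (simp add: riemannian_manifold_def smooth_atlas_def)
  then show thesis using that by blast
qed

lemma chart_at: "chart_at M x \<in> atlas M" "x \<in> chart_dom (chart_at M x)"
proof -
  have "\<exists>c. c \<in> atlas M \<and> x \<in> chart_dom c" using chart_exists by blast
  from someI_ex[OF this] show "chart_at M x \<in> atlas M" "x \<in> chart_dom (chart_at M x)"
    by (auto simp: chart_at_def)
qed

lemma open_chart_image:
  assumes "c \<in> atlas M" "open W"
  shows "open (chart_map c ` (chart_dom c \<inter> W))"
proof -
  have "chart_map c ` (chart_dom c \<inter> W) = {y \<in> chart_img c. chart_inv c y \<in> W}"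
    using chart_inv_map[OF assms(1)] by force
  moreover have "open {y \<in> chart_img c. chart_inv c y \<in> W}"
    using continuous_open_preimage[OF continuous_on_chart_inv[OF assms(1)] open_chart_img[OF assms(1)] assms(2)]
    by (simp add: vimage_def Int_def)
  ultimately show ?thesis by simp
qed

lemma smooth_transition:
  "c \<in> atlas M \<Longrightarrow> c' \<in> atlas M \<Longrightarrow>
    smooth_on (chart_map c ` (chart_dom c \<inter> chart_dom c')) (transition c c')"
  using riemannian by (simp add: riemannian_manifold_def smooth_atlas_def)

lemma open_overlap:
  "c \<in> atlas M \<Longrightarrow> c' \<in> atlas M \<Longrightarrow> open (chart_map c ` (chart_dom c \<inter> chart_dom c'))"
  using open_chart_image open_chart_dom by blast

lemma inner_form_metric:
  assumes "c \<in> atlas M" "x \<in> chart_dom c" shows "inner_form (metric M c x)"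
  using riemannian assms unfolding riemannian_manifold_def inner_form_def by blast

lemma metric_transform:
  "c \<in> atlas M \<Longrightarrow> c' \<in> atlas M \<Longrightarrow> x \<in> chart_dom c \<Longrightarrow> x \<in> chart_dom c' \<Longrightarrow>
    metric M c x u v = metric M c' x (dird u (transition c c') (chart_map c x))
      (dird v (transition c c') (chart_map c x))"
  using riemannian unfolding riemannian_manifold_def dird_def by blast

lemma coord_metric_eq: "c \<in> atlas M \<Longrightarrow> x \<in> chart_dom c \<Longrightarrow> coord_metric M c (chart_map c x) = metric M c x"
  by (simp add: coord_metric_def chart_inv_map)

lemma local_metric: "c \<in> atlas M \<Longrightarrow> local_metric (chart_img c) (coord_metric M c)"
proof
  assume c: "c \<in> atlas M"
  show "open (chart_img c)" by (rule open_chart_img[OF c])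
  show "inner_form (coord_metric M c y)" if "y \<in> chart_img c" for y
    unfolding coord_metric_def by (rule inner_form_metric[OF c chart_inv_in[OF that]])
  show "smooth_on (chart_img c) (\<lambda>y. coord_metric M c y u v)" for u v
    using riemannian c unfolding coord_metric_def riemannian_manifold_def by blast
qed

lemma linear_transition:
  "c \<in> atlas M \<Longrightarrow> c' \<in> atlas M \<Longrightarrow> x \<in> chart_dom c \<Longrightarrow> x \<in> chart_dom c' \<Longrightarrow>
    linear (\<lambda>u. dird u (transition c c') (chart_map c x))"
  by (rule linear_dird[OF smooth_transition]) auto

lemma orthonormal_basis_transition:
  assumes c: "c \<in> atlas M" "c' \<in> atlas M" "x \<in> chart_dom c" "x \<in> chart_dom c'"
    and b: "orthonormal_basis (metric M c x) b"
  defines "T \<equiv> \<lambda>u. dird u (transition c c') (chart_map c x)"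
  shows "orthonormal_basis (metric M c' x) (T ` b)" "inj T"
proof -
  have l: "linear T" unfolding T_def by (rule linear_transition[OF c])
  have mt: "metric M c' x (T u) (T v) = metric M c x u v" for u v
    unfolding T_def using metric_transform[OF c] by simp
  show inj: "inj T"
    unfolding linear_injective_0[OF l]
  proof safe
    fix u assume "T u = 0"
    then have "metric M c x u u = 0"
      using mt[of u u] bilinear_lzero[OF inner_formD(1)[OF inner_form_metric[OF c(2,4)]]] by simp
    then show "u = 0" using inner_formD(5)[OF inner_form_metric[OF c(1,3)]] by simp
  qed
  have "span (T ` b) = UNIV"
    using linear_injective_imp_surjective[OF l inj] b
    by (simp add: linear_span_image[OF l] orthonormal_basis_def)
  then show "orthonormal_basis (metric M c' x) (T ` b)"
    using b inj by (auto simp: orthonormal_basis_def mt inj_eq)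
qed

end

section \<open>The energy density of a smooth family\<close>

text \<open>The product \<open>P \<times> M\<close> in the coordinates given by a chart of \<open>M\<close>, restricted to the points
  mapped into the domain of \<open>d\<close>, and the coordinate representation of the family there.\<close>

definition fam_dom ::
  "'p set \<Rightarrow> ('a, 'e) chart \<Rightarrow> ('b, 'f) chart \<Rightarrow> ('p \<Rightarrow> 'a \<Rightarrow> 'b) \<Rightarrow> ('p \<times> 'e) set" where
  "fam_dom P c d F = {(p, chart_map c x) | p x. p \<in> P \<and> x \<in> chart_dom c \<and> F p x \<in> chart_dom d}"

definition fam_rep ::
  "('a, 'e) chart \<Rightarrow> ('b, 'f) chart \<Rightarrow> ('p \<Rightarrow> 'a \<Rightarrow> 'b) \<Rightarrow> 'p \<times> 'e \<Rightarrow> 'f" where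
  "fam_rep c d F = (\<lambda>(p, y). coord_rep c d (F p) y)"

definition smooth_fun ::
  "'p::euclidean_space set \<Rightarrow> ('a, 'e::euclidean_space) riem \<Rightarrow> ('p \<Rightarrow> 'a \<Rightarrow> real) \<Rightarrow> bool" where
  "smooth_fun P M u \<longleftrightarrow> (\<forall>c\<in>atlas M. smooth_on (P \<times> chart_img c) (\<lambda>(p, y). u p (chart_inv c y)))"

lemma dird_snd_slice:
  assumes "smooth_on S f" "(p, y) \<in> S"
  shows "dird e (\<lambda>y. f (p, y)) y = dird (0, e) f (p, y)"
proof -
  have 1: "((\<lambda>y. (p, y)) has_derivative (\<lambda>h. (0, h))) (at y)"
    by (auto intro!: derivative_eq_intros)
  show ?thesis
    using has_derivative_compose[OF 1 has_derivative_dird[OF assms]] by (rule dird_eqI)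
qed

lemma dird_fst_slice:
  assumes "smooth_on S f" "(p, y) \<in> S"
  shows "dird v (\<lambda>p. f (p, y)) p = dird (v, 0) f (p, y)"
proof -
  have 1: "((\<lambda>p. (p, y)) has_derivative (\<lambda>h. (h, 0))) (at p)"
    by (auto intro!: derivative_eq_intros)
  show ?thesis
    using has_derivative_compose[OF 1 has_derivative_dird[OF assms]] by (rule dird_eqI)
qed

locale two_manifolds = M: riem_manifold M + N: riem_manifold N
  for M :: "('a::{t2_space,second_countable_topology}, real^'m) riem"
    and N :: "('b::{t2_space,second_countable_topology}, real^'n) riem"
begin

lemma smooth_map_rep:
  "smooth_map M N \<psi> \<Longrightarrow> c \<in> atlas M \<Longrightarrow> d \<in> atlas N \<Longrightarrow>
    smooth_on (chart_map c ` (chart_dom c \<inter> \<psi> -` chart_dom d)) (coord_rep c d \<psi>)"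
  by (simp add: smooth_map_def)

lemma open_smooth_map_vimage: "smooth_map M N \<psi> \<Longrightarrow> open W \<Longrightarrow> open (\<psi> -` W)"
  by (metis continuous_on_open_vimage open_UNIV smooth_map_def inf_top_right)

lemma open_rep_dom:
  "smooth_map M N \<psi> \<Longrightarrow> c \<in> atlas M \<Longrightarrow> d \<in> atlas N \<Longrightarrow>
    open (chart_map c ` (chart_dom c \<inter> \<psi> -` chart_dom d))"
  using M.open_chart_image N.open_chart_dom open_smooth_map_vimage by blast

lemma linear_rep:
  assumes "smooth_map M N \<psi>" "c \<in> atlas M" "d \<in> atlas N" "x \<in> chart_dom c" "\<psi> x \<in> chart_dom d"
  shows "linear (\<lambda>e. dird e (coord_rep c d \<psi>) (chart_map c x))"
  by (rule linear_dird[OF smooth_map_rep[OF assms(1-3)]]) (use assms(4,5) in auto)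

lemma rep_change_target:
  assumes \<psi>: "smooth_map M N \<psi>" and c: "c \<in> atlas M" "x \<in> chart_dom c"
    and d: "d \<in> atlas N" "d' \<in> atlas N" "\<psi> x \<in> chart_dom d" "\<psi> x \<in> chart_dom d'"
  shows "dird e (coord_rep c d' \<psi>) (chart_map c x)
    = dird (dird e (coord_rep c d \<psi>) (chart_map c x)) (transition d d') (chart_map d (\<psi> x))"
proof -
  let ?W = "chart_map c ` (chart_dom c \<inter> \<psi> -` (chart_dom d \<inter> chart_dom d'))"
  have W: "open ?W" "chart_map c x \<in> ?W"
    using c d by (auto intro!: M.open_chart_image open_smooth_map_vimage[OF \<psi>] N.open_chart_dom)
  have "coord_rep c d' \<psi> y = transition d d' (coord_rep c d \<psi> y)" if "y \<in> ?W" for y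
    using that c d by (auto simp: coord_rep_def transition_def M.chart_inv_map N.chart_inv_map)
  then have "dird e (coord_rep c d' \<psi>) (chart_map c x)
      = dird e (\<lambda>y. transition d d' (coord_rep c d \<psi> y)) (chart_map c x)"
    by (rule dird_cong_open[OF W])
  also have "\<dots> = dird (dird e (coord_rep c d \<psi>) (chart_map c x)) (transition d d') (coord_rep c d \<psi> (chart_map c x))"
    by (rule dird_compose[OF smooth_map_rep[OF \<psi> c(1) d(1)] N.smooth_transition[OF d(1,2)]])
      (use c d in \<open>auto simp: coord_rep_def M.chart_inv_map\<close>)
  finally show ?thesis using c by (simp add: coord_rep_def M.chart_inv_map)
qed

lemma rep_change_source:
  assumes \<psi>: "smooth_map M N \<psi>" and c: "c \<in> atlas M" "c' \<in> atlas M" "x \<in> chart_dom c" "x \<in> chart_dom c'"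
    and d: "d \<in> atlas N" "\<psi> x \<in> chart_dom d"
  shows "dird e (coord_rep c d \<psi>) (chart_map c x)
    = dird (dird e (transition c c') (chart_map c x)) (coord_rep c' d \<psi>) (chart_map c' x)"
proof -
  let ?W = "chart_map c ` (chart_dom c \<inter> (chart_dom c' \<inter> \<psi> -` chart_dom d))"
  have W: "open ?W" "chart_map c x \<in> ?W"
    using c d by (auto intro!: M.open_chart_image open_smooth_map_vimage[OF \<psi>] N.open_chart_dom
      M.open_chart_dom open_Int)
  have "coord_rep c d \<psi> y = coord_rep c' d \<psi> (transition c c' y)" if "y \<in> ?W" for y
    using that c d by (auto simp: coord_rep_def transition_def M.chart_inv_map)
  then have "dird e (coord_rep c d \<psi>) (chart_map c x)
      = dird e (\<lambda>y. coord_rep c' d \<psi> (transition c c' y)) (chart_map c x)"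
    by (rule dird_cong_open[OF W])
  also have "\<dots> = dird (dird e (transition c c') (chart_map c x)) (coord_rep c' d \<psi>) (transition c c' (chart_map c x))"
    by (rule dird_compose[OF M.smooth_transition[OF c(1,2)] smooth_map_rep[OF \<psi> c(2) d(1)]])
      (use c d in \<open>auto simp: transition_def M.chart_inv_map\<close>)
  finally show ?thesis using c by (simp add: transition_def M.chart_inv_map)
qed

lemma bilinear_pullback:
  assumes "bilinear (B :: 'v::real_vector \<Rightarrow> 'v \<Rightarrow> real)" "linear L"
  shows "bilinear (\<lambda>u v. B (L u) (L v))"
  using assms linear_compose[of L "B _"] linear_compose[of L "\<lambda>u. B u _"]
  by (simp add: bilinear_def o_def)

lemma hs_norm_diff_eq:
  assumes \<psi>: "smooth_map M N \<psi>" and c: "c \<in> atlas M" "x \<in> chart_dom c"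
    and d: "d \<in> atlas N" "\<psi> x \<in> chart_dom d"
    and b: "orthonormal_basis (metric M c x) b"
  shows "(hs_norm_diff M N \<psi> x)\<^sup>2 = (\<Sum>e\<in>b. metric N d (\<psi> x)
    (dird e (coord_rep c d \<psi>) (chart_map c x)) (dird e (coord_rep c d \<psi>) (chart_map c x)))"
proof -
  define c0 where "c0 = chart_at M x"
  define d0 where "d0 = chart_at N (\<psi> x)"
  define b0 where "b0 = (SOME b. orthonormal_basis (metric M c0 x) b)"
  note c0 = M.chart_at[of x, folded c0_def] and d0 = N.chart_at[of "\<psi> x", folded d0_def]
  have b0: "orthonormal_basis (metric M c0 x) b0"
    unfolding b0_def by (rule someI_ex[OF orthonormal_basis_exists[OF M.inner_form_metric[OF c0]]])
  let ?T = "\<lambda>u. dird u (transition c0 c) (chart_map c0 x)"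
  let ?D = "\<lambda>c d e. dird e (coord_rep c d \<psi>) (chart_map c x)"
  let ?Q = "\<lambda>c d e. metric N d (\<psi> x) (?D c d e) (?D c d e)"
  note T = M.orthonormal_basis_transition[OF c0(1) c(1) c0(2) c(2) b0]
  have "(hs_norm_diff M N \<psi> x)\<^sup>2 = (\<Sum>e\<in>b0. ?Q c0 d0 e)"
    unfolding hs_norm_diff_def Let_def c0_def[symmetric] d0_def[symmetric] b0_def[symmetric]
      dird_def[symmetric]
    by (intro real_sqrt_pow2 sum_nonneg inner_formD(4) N.inner_form_metric d0)
  also have "\<dots> = (\<Sum>e\<in>b0. ?Q c d (?T e))"
    unfolding N.metric_transform[OF d0(1) d(1) d0(2) d(2)] rep_change_target[OF \<psi> c0 d0(1) d(1) d0(2) d(2), symmetric]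
      rep_change_source[OF \<psi> c0(1) c(1) c0(2) c(2) d] ..
  also have "\<dots> = (\<Sum>e\<in>?T ` b0. ?Q c d e)"
    using inj_on_subset[OF T(2), of b0] by (simp add: sum.reindex)
  also have "\<dots> = (\<Sum>e\<in>b. ?Q c d e)"
    unfolding trace_orthonormal_basis[OF M.inner_form_metric[OF c] T(1)
        bilinear_pullback[OF inner_formD(1)[OF N.inner_form_metric[OF d]] linear_rep[OF \<psi> c(1) d(1) c(2) d(2)]]]
      trace_orthonormal_basis[OF M.inner_form_metric[OF c] b
        bilinear_pullback[OF inner_formD(1)[OF N.inner_form_metric[OF d]] linear_rep[OF \<psi> c(1) d(1) c(2) d(2)]]] ..
  finally show ?thesis .
qed

context
  fixes P :: "'p::euclidean_space set" and F :: "'p \<Rightarrow> 'a \<Rightarrow> 'b"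
  assumes open_P: "open P" and F: "smooth_family P M N F"
begin

lemma mem_fam_dom:
  "c \<in> atlas M \<Longrightarrow> x \<in> chart_dom c \<Longrightarrow>
    (p, chart_map c x) \<in> fam_dom P c d F \<longleftrightarrow> p \<in> P \<and> F p x \<in> chart_dom d"
  by (auto simp: fam_dom_def) (metis M.chart_inv_map)+

lemma fam_dom_eq:
  "c \<in> atlas M \<Longrightarrow>
    fam_dom P c d F = {z \<in> P \<times> chart_img c. F (fst z) (chart_inv c (snd z)) \<in> chart_dom d}"
  by (auto simp: fam_dom_def M.chart_inv_map) 

lemma open_fam_dom:
  assumes c: "c \<in> atlas M" and d: "d \<in> atlas N"
  shows "open (fam_dom P c d F)"
proof -
  have "continuous_on (P \<times> chart_img c) (\<lambda>z. case (fst z, chart_inv c (snd z)) of (p, x) \<Rightarrow> F p x)"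
  proof (rule continuous_on_compose2[where t = "P \<times> UNIV"])
    show "continuous_on (P \<times> UNIV) (\<lambda>(p, x). F p x)"
      using F by (simp add: smooth_family_def)
    show "continuous_on (P \<times> chart_img c) (\<lambda>z. (fst z, chart_inv c (snd z)))"
      by (intro continuous_intros continuous_on_compose2[OF M.continuous_on_chart_inv[OF c]]) auto
  qed auto
  from continuous_open_preimage[OF this _ N.open_chart_dom[OF d]] open_P M.open_chart_img[OF c]
  show ?thesis
    unfolding fam_dom_eq[OF c] by (simp add: open_Times vimage_def Int_def)
qed

lemma smooth_fam_rep:
  "c \<in> atlas M \<Longrightarrow> d \<in> atlas N \<Longrightarrow> smooth_on (fam_dom P c d F) (fam_rep c d F)"
  using F by (simp add: smooth_family_def fam_dom_def fam_rep_def)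

lemma fam_rep_img: "c \<in> atlas M \<Longrightarrow> fam_rep c d F ` fam_dom P c d F \<subseteq> chart_img d"
  by (auto simp: fam_rep_def fam_dom_def coord_rep_def M.chart_inv_map)

lemma smooth_map_slice:
  assumes "p \<in> P"
  shows "smooth_map M N (F p)"
  unfolding smooth_map_def
proof (intro conjI ballI)
  have "continuous_on UNIV (\<lambda>x. case (p, x) of (p, x) \<Rightarrow> F p x)"
    by (rule continuous_on_compose2[where t = "P \<times> UNIV"])
      (use F assms in \<open>auto simp: smooth_family_def intro!: continuous_intros\<close>)
  then show cont: "continuous_on UNIV (F p)" by simp
  fix c d assume cd: "c \<in> atlas M" "d \<in> atlas N"
  have o: "open (chart_map c ` (chart_dom c \<inter> F p -` chart_dom d))"
    using cd cont by (intro M.open_chart_image)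
      (auto intro: N.open_chart_dom simp: continuous_on_open_vimage)
  have "smooth_on (chart_map c ` (chart_dom c \<inter> F p -` chart_dom d)) (\<lambda>y. fam_rep c d F (p, y))"
    by (rule smooth_on_compose[OF o open_fam_dom[OF cd] _
          smooth_on_Pair[OF o smooth_on_const[OF o] smooth_on_linear[OF bounded_linear_ident o]]
          smooth_fam_rep[OF cd]])
      (use assms cd in \<open>auto simp: mem_fam_dom\<close>)
  then show "smooth_on (chart_map c ` (chart_dom c \<inter> F p -` chart_dom d)) (coord_rep c d (F p))"
    by (simp add: fam_rep_def)
qed

lemma hs_norm_diff_family:
  assumes c: "c \<in> atlas M" "x \<in> chart_dom c" and d: "d \<in> atlas N" "F p x \<in> chart_dom d" and p: "p \<in> P"
    and b: "orthonormal_basis (metric M c x) b"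
  defines "f \<equiv> fam_rep c d F" and "z \<equiv> (p, chart_map c x)"
  shows "(hs_norm_diff M N (F p) x)\<^sup>2 =
    (\<Sum>e\<in>b. coord_metric N d (f z) (dird (0, e) f z) (dird (0, e) f z))"
proof -
  have z: "z \<in> fam_dom P c d F"
    unfolding z_def by (rule iffD2[OF mem_fam_dom[OF c] conjI[OF p d(2)]])
  have "dird e (coord_rep c d (F p)) (chart_map c x) = dird (0, e) f z" for e
    using dird_snd_slice[OF smooth_fam_rep[OF c(1) d(1)] z[unfolded z_def], of e]
    by (simp add: f_def z_def fam_rep_def)
  moreover have "coord_metric N d (f z) = metric N d (F p x)"
    using c d by (simp add: f_def z_def fam_rep_def coord_rep_def M.chart_inv_map N.coord_metric_eq)
  ultimately show ?thesis
    using hs_norm_diff_eq[OF smooth_map_slice[OF p] c d b] by simp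
qed

lemma smooth_fun_energy_density:
  "smooth_fun P M (\<lambda>p x. (1 + (hs_norm_diff M N (F p) x)\<^sup>2) powr \<alpha>)"
  unfolding smooth_fun_def
proof
  fix c assume c: "c \<in> atlas M"
  interpret Mc: local_metric "chart_img c" "coord_metric M c" by (rule M.local_metric[OF c])
  show "smooth_on (P \<times> chart_img c) (\<lambda>(p, y). (1 + (hs_norm_diff M N (F p) (chart_inv c y))\<^sup>2) powr \<alpha>)"
  proof (rule smooth_on_local)
    fix z assume z: "z \<in> P \<times> chart_img c"
    obtain d where d: "d \<in> atlas N" "F (fst z) (chart_inv c (snd z)) \<in> chart_dom d"
      by (rule N.chart_exists)
    let ?U = "fam_dom P c d F" and ?f = "fam_rep c d F"
    let ?h = "\<lambda>w. \<Sum>i\<in>UNIV. \<Sum>j\<in>UNIV. gram_inv (coord_metric M c (snd w)) i j *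
      coord_metric N d (?f w) (dird (0, axis i 1) ?f w) (dird (0, axis j 1) ?f w)"
    interpret Nd: local_metric "chart_img d" "coord_metric N d" by (rule N.local_metric[OF d(1)])
    have U: "open ?U" "z \<in> ?U"
      using open_fam_dom[OF c d(1)] z d(2) by (auto simp: fam_dom_eq[OF c])
    note f = smooth_fam_rep[OF c d(1)]
    have "smooth_on ?U (\<lambda>w. gram_inv (coord_metric M c (snd w)) i j)" for i j
      by (rule smooth_on_compose[OF U(1) Mc.open_V _ _ smooth_on_gram_inv[OF Mc.open_V Mc.inner_form_k Mc.smooth_k]])
        (auto simp: fam_dom_eq[OF c] intro!: smooth_on_linear bounded_linear_snd U(1)[unfolded fam_dom_eq[OF c]])
    then have h: "smooth_on ?U ?h"
      by (intro smooth_on_sum smooth_on_mult U(1) Nd.smooth_k_along fam_rep_img c f smooth_on_dird)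
    have eq: "(hs_norm_diff M N (F p) (chart_inv c y))\<^sup>2 = ?h (p, y)" if "(p, y) \<in> ?U" for p y
    proof -
      have y: "p \<in> P" "y \<in> chart_img c" "F p (chart_inv c y) \<in> chart_dom d"
        using that by (auto simp: fam_dom_eq[OF c])
      note x = M.chart_inv_in[OF y(2)] and cy = M.chart_map_inv[OF c y(2)]
      obtain b where b: "orthonormal_basis (metric M c (chart_inv c y)) b"
        using orthonormal_basis_exists[OF M.inner_form_metric[OF c x]] by blast
      have fz: "?f (p, y) \<in> chart_img d"
        by (rule subsetD[OF fam_rep_img[OF c] imageI[OF that]])
      have L: "linear (\<lambda>e. dird (0, e) ?f (p, y))"
        using linear_compose[of "\<lambda>e. (0, e)", OF _ linear_dird[OF f that]]
        by (simp add: o_def linear_iff)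
      have m: "metric M c (chart_inv c y) = coord_metric M c y"
        by (simp add: coord_metric_def)
      show ?thesis
        unfolding hs_norm_diff_family[OF c x d(1) y(3,1) b] cy trace_orthonormal_basis[OF M.inner_form_metric[OF c x] b
            bilinear_pullback[OF Nd.bilinear_k[OF fz] L]] m by (simp only: snd_conv)
    qed
    have pos: "0 < 1 + ?h w" if "w \<in> ?U" for w
    proof -
      have "(fst w, snd w) \<in> ?U" using that by simp
      from zero_le_power2 have "0 \<le> ?h (fst w, snd w)"
        unfolding eq[OF \<open>(fst w, snd w) \<in> ?U\<close>, symmetric] .
      then have "0 \<le> ?h w" by (simp only: prod.collapse)
      then show ?thesis by (rule add_pos_nonneg[OF zero_less_one])
    qed
    have "smooth_on ?U (\<lambda>w. (1 + ?h w) powr \<alpha>)"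
      by (intro smooth_on_powr smooth_on_add smooth_on_const U(1) h pos)
    then have "smooth_on ?U (\<lambda>(p, y). (1 + (hs_norm_diff M N (F p) (chart_inv c y))\<^sup>2) powr \<alpha>)"
    proof (rule smooth_on_cong[OF U(1), rotated])
      fix w assume "w \<in> ?U"
      with eq[of "fst w" "snd w"] show "(1 + ?h w) powr \<alpha> =
          (case w of (p, y) \<Rightarrow> (1 + (hs_norm_diff M N (F p) (chart_inv c y))\<^sup>2) powr \<alpha>)"
        by (simp only: prod.collapse case_prod_beta)
    qed
    with U show "\<exists>U. open U \<and> z \<in> U \<and>
      smooth_on U (\<lambda>(p, y). (1 + (hs_norm_diff M N (F p) (chart_inv c y))\<^sup>2) powr \<alpha>)" by blast
  qed
qed

end

end

section \<open>Differentiation under the integral\<close>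

lemma integrable_continuous_compact:
  fixes w :: "'a::topological_space \<Rightarrow> real"
  assumes "finite_measure vol" "sets vol = sets borel" "compact (UNIV :: 'a set)" "continuous_on UNIV w"
  shows "integrable vol w"
proof -
  interpret finite_measure vol by (rule assms(1))
  have m: "w \<in> borel_measurable vol"
    using borel_measurable_continuous_onI[OF assms(4)] measurable_cong_sets[OF assms(2) refl] by blast
  obtain B where "\<And>x. norm (w x) \<le> B"
    using compact_imp_bounded[OF compact_continuous_image[OF assms(4,3)]] by (auto simp: bounded_iff)
  then show ?thesis by (intro integrable_const_bound[OF _ m]) auto
qed

lemma differentiable_under_integral:
  fixes u :: "'p::euclidean_space \<Rightarrow> 'a::topological_space \<Rightarrow> real"
  assumes fin: "finite_measure vol" and sets: "sets vol = sets borel"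
    and cpt: "compact (UNIV :: 'a set)" and P: "open P" "p \<in> P"
    and u: "continuous_on (P \<times> UNIV) (\<lambda>(p, x). u p x)"
    and g: "continuous_on (P \<times> UNIV) (\<lambda>(p, x). g p x)"
    and deriv: "\<And>h x. p + h *\<^sub>R v \<in> P \<Longrightarrow>
      ((\<lambda>h. u (p + h *\<^sub>R v) x) has_real_derivative g (p + h *\<^sub>R v) x) (at h)"
  shows "((\<lambda>h. \<integral>x. u (p + h *\<^sub>R v) x \<partial>vol) has_real_derivative (\<integral>x. g p x \<partial>vol)) (at 0)"
proof -
  interpret finite_measure vol by (rule fin)
  have int: "integrable vol (w q)" if w: "continuous_on (P \<times> UNIV) (\<lambda>(p, x). w p x)" and q: "q \<in> P"
    for w :: "'p \<Rightarrow> 'a \<Rightarrow> real" and q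
  proof -
    have "continuous_on UNIV (\<lambda>x. case (q, x) of (p, x) \<Rightarrow> w p x)"
      by (rule continuous_on_compose2[OF w]) (use q in \<open>auto intro!: continuous_intros\<close>)
    then show ?thesis by (intro integrable_continuous_compact[OF fin sets cpt]) simp
  qed
  obtain \<delta> where \<delta>: "\<delta> > 0" "cball p \<delta> \<subseteq> P"
    using P open_contains_cball by blast
  have "compact (cball p \<delta> \<times> (UNIV :: 'a set))" by (intro compact_Times compact_cball cpt)
  moreover have "continuous_on (cball p \<delta> \<times> UNIV) (\<lambda>(p, x). g p x)"
    by (rule continuous_on_subset[OF g]) (use \<delta> in auto)
  ultimately have "bounded ((\<lambda>(p, x). g p x) ` (cball p \<delta> \<times> UNIV))"
    by (intro compact_imp_bounded compact_continuous_image)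
  then obtain C where "\<forall>y\<in>(\<lambda>(p, x). g p x) ` (cball p \<delta> \<times> UNIV). \<bar>y\<bar> \<le> C"
    unfolding bounded_iff real_norm_def ..
  then have C: "\<bar>g q x\<bar> \<le> C" if "q \<in> cball p \<delta>" for q x
    using that imageI[of "(q, x)" "cball p \<delta> \<times> UNIV" "\<lambda>(p, x). g p x"] by simp
  define r where "r = \<delta> / (norm v + 1)"
  have r: "r > 0" unfolding r_def using \<delta>(1) by (simp add: add_nonneg_pos)
  have near: "p + h *\<^sub>R v \<in> cball p \<delta>" if "\<bar>h\<bar> \<le> r" for h
  proof -
    have "\<bar>h\<bar> * norm v \<le> r * (norm v + 1)"
      using that r by (intro mult_mono) auto
    also have "\<dots> = \<delta>" using norm_ge_zero[of v] by (simp add: r_def add_nonneg_eq_0_iff)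
    finally show ?thesis by (simp add: dist_norm)
  qed
  have quot: "\<bar>(u (p + h *\<^sub>R v) x - u p x) / h\<bar> \<le> C" if "\<bar>h\<bar> \<le> r" "h \<noteq> 0" for h x
  proof -
    have "norm (u (p + h *\<^sub>R v) x - u (p + 0 *\<^sub>R v) x) \<le> C * norm (h - 0)"
    proof (rule field_differentiable_bound[of "{-r..r}" "\<lambda>h. u (p + h *\<^sub>R v) x" "\<lambda>h. g (p + h *\<^sub>R v) x"])
      show "((\<lambda>h. u (p + h *\<^sub>R v) x) has_field_derivative g (p + s *\<^sub>R v) x) (at s within {-r..r})"
        if "s \<in> {-r..r}" for s
      proof -
        have "p + s *\<^sub>R v \<in> P" by (rule subsetD[OF \<delta>(2) near]) (use that in auto)
        then show ?thesis by (rule has_field_derivative_at_within[OF deriv])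
      qed
      show "norm (g (p + s *\<^sub>R v) x) \<le> C" if "s \<in> {-r..r}" for s
        using C[OF near] that by (simp add: abs_le_iff)
      show "0 \<in> {-r..r}" "h \<in> {-r..r}" using that(1) r by (auto simp: abs_le_iff)
    qed simp
    then show ?thesis using that(2) by (simp add: field_simps)
  qed
  have "(\<lambda>h. ((\<integral>x. u (p + h *\<^sub>R v) x \<partial>vol) - (\<integral>x. u (p + 0 *\<^sub>R v) x \<partial>vol)) / h)
      \<midarrow>0\<rightarrow> (\<integral>x. g p x \<partial>vol)"
    unfolding LIMSEQ_SEQ_conv[symmetric]
  proof safe
    fix S :: "nat \<Rightarrow> real" assume S: "\<forall>n. S n \<noteq> 0" "S \<longlonglongrightarrow> 0"
    obtain n0 where n0: "\<And>n. n \<ge> n0 \<Longrightarrow> \<bar>S n\<bar> \<le> r"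
      using LIMSEQ_D[OF S(2) r] by (auto intro: less_imp_le)
    let ?T = "\<lambda>n. S (n + n0)"
    have T: "\<bar>?T n\<bar> \<le> r" "?T n \<noteq> 0" for n using n0 S(1) by auto
    have inP: "p + ?T n *\<^sub>R v \<in> P" for n using near[OF T(1)] \<delta>(2) by blast
    have Tlim: "?T \<longlonglongrightarrow> 0" by (rule LIMSEQ_ignore_initial_segment[OF S(2)])
    have lim: "(\<lambda>n. \<integral>x. (u (p + ?T n *\<^sub>R v) x - u p x) / ?T n \<partial>vol) \<longlonglongrightarrow> (\<integral>x. g p x \<partial>vol)"
    proof (rule integral_dominated_convergence[where w = "\<lambda>x. C"])
      show "g p \<in> borel_measurable vol" using int[OF g P(2)] by auto
      show "(\<lambda>x. (u (p + ?T n *\<^sub>R v) x - u p x) / ?T n) \<in> borel_measurable vol" for n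
        using int[OF u inP[of n]] int[OF u P(2)] by auto
      show "AE x in vol. (\<lambda>n. (u (p + ?T n *\<^sub>R v) x - u p x) / ?T n) \<longlonglongrightarrow> g p x"
      proof (rule AE_I2)
        fix x
        have "((\<lambda>h. (u (p + h *\<^sub>R v) x - u p x) / h) \<longlongrightarrow> g p x) (at 0)"
          using deriv[of 0 x] P(2) by (simp add: DERIV_def)
        then show "(\<lambda>n. (u (p + ?T n *\<^sub>R v) x - u p x) / ?T n) \<longlonglongrightarrow> g p x"
          unfolding LIMSEQ_SEQ_conv[symmetric] using Tlim T(2) by (auto dest!: spec[of _ ?T])
      qed
      show "AE x in vol. norm ((u (p + ?T n *\<^sub>R v) x - u p x) / ?T n) \<le> C" for n
        using quot[OF T] by auto
    qed simp
    have eq: "(\<integral>x. (u (p + ?T n *\<^sub>R v) x - u p x) / ?T n \<partial>vol)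
        = ((\<integral>x. u (p + ?T n *\<^sub>R v) x \<partial>vol) - (\<integral>x. u (p + 0 *\<^sub>R v) x \<partial>vol)) / ?T n" for n
      using int[OF u inP[of n]] int[OF u P(2)] by simp
    show "(\<lambda>n. ((\<integral>x. u (p + S n *\<^sub>R v) x \<partial>vol) - (\<integral>x. u (p + 0 *\<^sub>R v) x \<partial>vol)) / S n)
        \<longlonglongrightarrow> (\<integral>x. g p x \<partial>vol)"
      by (rule LIMSEQ_offset[where k = n0]) (rule lim[unfolded eq])
  qed
  then show ?thesis by (simp add: DERIV_def)
qed

context riem_manifold
begin

lemma finite_volume:
  assumes cpt: "compact (UNIV :: 'a set)" and vol: "riemannian_volume M vol"
  shows "finite_measure vol"
proof (rule finite_measureI)
  have sets: "sets vol = sets borel" using vol by (simp add: riemannian_volume_def)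
  have vol': "\<forall>c\<in>atlas M. \<forall>S\<in>sets borel. S \<subseteq> chart_dom c \<longrightarrow> emeasure vol S =
      (\<integral>\<^sup>+ y. ennreal (volume_density M c (chart_inv c y)) * indicator (chart_map c ` S) y \<partial>lborel)"
    using vol unfolding riemannian_volume_def by (rule conjunct2)
  have "\<exists>W. open W \<and> x \<in> W \<and> emeasure vol W < \<infinity>" for x
  proof -
    obtain c where c: "c \<in> atlas M" "x \<in> chart_dom c" by (rule chart_exists)
    obtain r where r: "r > 0" "cball (chart_map c x) r \<subseteq> chart_img c"
      using open_chart_img[OF c(1)] c(2) open_contains_cball[of "chart_img c"] by blast
    let ?B = "cball (chart_map c x) r"
    let ?W = "chart_dom c \<inter> chart_map c -` ball (chart_map c x) r"
    have W: "open ?W" "x \<in> ?W"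
      using continuous_open_preimage[OF continuous_on_chart_map open_chart_dom open_ball] c r(1) by auto
    have "continuous_on (chart_img c) (\<lambda>y. volume_density M c (chart_inv c y))"
      unfolding volume_density_def
      by (intro continuous_on_real_sqrt smooth_on_imp_continuous_on smooth_on_det open_chart_img c)
        (use riemannian c(1) in \<open>simp add: riemannian_manifold_def\<close>)
    from compact_imp_bounded[OF compact_continuous_image[OF continuous_on_subset[OF this r(2)] compact_cball]]
    obtain C where C: "\<forall>y\<in>?B. \<bar>volume_density M c (chart_inv c y)\<bar> \<le> C"
      unfolding bounded_iff ball_simps real_norm_def ..
    have "emeasure vol ?W = (\<integral>\<^sup>+ y. ennreal (volume_density M c (chart_inv c y)) * indicator (chart_map c ` ?W) y \<partial>lborel)"
      by (rule vol'[rule_format, OF c(1) borel_open[OF W(1)] Int_lower1])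
    also have "\<dots> \<le> (\<integral>\<^sup>+ y. ennreal C * indicator ?B y \<partial>lborel)"
    proof (rule nn_integral_mono)
      fix y show "ennreal (volume_density M c (chart_inv c y)) * indicator (chart_map c ` ?W) y \<le> ennreal C * indicator ?B y"
        using bspec[OF C, of y] by (auto simp: indicator_def intro!: ennreal_leI)
    qed
    also have "\<dots> = ennreal C * emeasure lborel ?B"
      by (rule nn_integral_cmult_indicator) simp
    also have "\<dots> < \<infinity>"
      using emeasure_compact_finite[of ?B] by (simp add: ennreal_mult_less_top)
    finally show ?thesis using W by blast
  qed
  then obtain W where W: "\<And>x. open (W x)" "\<And>x. x \<in> W x" "\<And>x. emeasure vol (W x) < \<infinity>" by metis
  obtain I where I: "finite I" "UNIV \<subseteq> (\<Union>x\<in>I. W x)"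
    using compactE_image[OF cpt, of UNIV W] W by (metis UNIV_I UN_I subsetI)
  have "emeasure vol (space vol) \<le> emeasure vol (\<Union>x\<in>I. W x)"
    using I(2) W(1) by (intro emeasure_mono) (auto simp: sets intro!: borel_open)
  also have "\<dots> \<le> (\<Sum>x\<in>I. emeasure vol (W x))"
    by (rule emeasure_subadditive_finite) (use I W in \<open>auto simp: sets\<close>)
  also have "\<dots> < \<infinity>" using W(3) I(1) by (simp add: less_top[symmetric])
  finally show "emeasure vol (space vol) \<noteq> \<infinity>" by simp
qed

context
  fixes P :: "'p::euclidean_space set" and u :: "'p \<Rightarrow> 'a \<Rightarrow> real"
  assumes P: "open P" and u: "smooth_fun P M u"
begin

lemma smooth_fun_rep: "c \<in> atlas M \<Longrightarrow> smooth_on (P \<times> chart_img c) (\<lambda>(p, y). u p (chart_inv c y))"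
  using u by (simp add: smooth_fun_def)

lemma smooth_fun_continuous: "continuous_on (P \<times> UNIV) (\<lambda>(p, x). u p x)"
proof (rule continuous_at_imp_continuous_on, safe)
  fix p x assume p: "p \<in> P"
  obtain c where c: "c \<in> atlas M" "x \<in> chart_dom c" by (rule chart_exists)
  have "continuous_on (P \<times> chart_dom c) (\<lambda>z. case (fst z, chart_map c (snd z)) of (p, y) \<Rightarrow> u p (chart_inv c y))"
    by (rule continuous_on_compose2[OF smooth_on_imp_continuous_on[OF smooth_fun_rep[OF c(1)]]])
      (auto intro!: continuous_intros continuous_on_compose2[OF continuous_on_chart_map[OF c(1)]])
  then have "continuous_on (P \<times> chart_dom c) (\<lambda>(p, x). u p x)"
    by (rule continuous_on_cong[THEN iffD1, rotated 2]) (auto simp: chart_inv_map c)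
  then show "isCont (\<lambda>(p, x). u p x) (p, x)"
    using p c P open_chart_dom[OF c(1)] by (auto simp: continuous_on_eq_continuous_at open_Times)
qed

lemma smooth_fun_slice: "smooth_on P (\<lambda>p. u p x)"
proof -
  obtain c where c: "c \<in> atlas M" "x \<in> chart_dom c" by (rule chart_exists)
  have "smooth_on P (\<lambda>p. case (p, chart_map c x) of (p, y) \<Rightarrow> u p (chart_inv c y))"
    by (rule smooth_on_compose[OF P open_Times[OF P open_chart_img[OF c(1)]] _
          smooth_on_Pair[OF P smooth_on_linear[OF bounded_linear_ident P] smooth_on_const[OF P]]
          smooth_fun_rep[OF c(1)]]) (use c in auto)
  then show ?thesis by (simp add: chart_inv_map c)
qed

lemma smooth_fun_dird: "smooth_fun P M (\<lambda>p x. dird v (\<lambda>p. u p x) p)"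
  unfolding smooth_fun_def
proof
  fix c assume c: "c \<in> atlas M"
  have o: "open (P \<times> chart_img c)" by (intro open_Times P open_chart_img c)
  show "smooth_on (P \<times> chart_img c) (\<lambda>(p, y). dird v (\<lambda>p. u p (chart_inv c y)) p)"
  proof (rule smooth_on_cong[OF o])
    show "smooth_on (P \<times> chart_img c) (dird (v, 0) (\<lambda>(p, y). u p (chart_inv c y)))"
      by (rule smooth_on_dird[OF smooth_fun_rep[OF c]])
    fix z assume "z \<in> P \<times> chart_img c"
    then show "dird (v, 0) (\<lambda>(p, y). u p (chart_inv c y)) z
      = (case z of (p, y) \<Rightarrow> dird v (\<lambda>p. u p (chart_inv c y)) p)"
      using dird_fst_slice[OF smooth_fun_rep[OF c], of "fst z" "snd z" v] by (cases z) simp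
  qed
qed

lemma smooth_fun_integrable:
  assumes "finite_measure vol" "sets vol = sets borel" "compact (UNIV :: 'a set)" "p \<in> P"
  shows "integrable vol (u p)"
proof -
  have "continuous_on UNIV (\<lambda>x. case (p, x) of (p, x) \<Rightarrow> u p x)"
    by (rule continuous_on_compose2[OF smooth_fun_continuous]) (use assms in \<open>auto intro!: continuous_intros\<close>)
  then show ?thesis by (intro integrable_continuous_compact[OF assms(1-3)]) simp
qed

end

lemma smooth_fun_integral_deriv:
  fixes P :: "'p::euclidean_space set"
  assumes "open P" "smooth_fun P M u" "p \<in> P"
    "finite_measure vol" "sets vol = sets borel" "compact (UNIV :: 'a set)"
  shows "((\<lambda>h. \<integral>x. u (p + h *\<^sub>R v) x \<partial>vol) has_real_derivative (\<integral>x. dird v (\<lambda>p. u p x) p \<partial>vol)) (at 0)"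
proof (rule differentiable_under_integral[OF assms(4,5,6,1,3)])
  show "continuous_on (P \<times> UNIV) (\<lambda>(p, x). u p x)"
    by (rule smooth_fun_continuous[OF assms(1,2)])
  show "continuous_on (P \<times> UNIV) (\<lambda>(p, x). dird v (\<lambda>p. u p x) p)"
    by (rule smooth_fun_continuous[OF assms(1) smooth_fun_dird[OF assms(1,2)]])
  show "((\<lambda>h. u (p + h *\<^sub>R v) x) has_real_derivative dird v (\<lambda>p. u p x) (p + h *\<^sub>R v)) (at h)"
    if "p + h *\<^sub>R v \<in> P" for h x
    using has_vector_derivative_line[OF smooth_fun_slice[OF assms(1,2)] that]
    by (simp add: has_real_derivative_iff_has_vector_derivative)
qed

end

section \<open>Bump functions\<close>

definition flat :: "nat \<Rightarrow> real \<Rightarrow> real" where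
  "flat n t = (if t > 0 then exp (- (1 / t)) / t ^ n else 0)"

lemma flat_nonneg: "flat n t \<ge> 0" by (simp add: flat_def)

lemma flat_pos: "t > 0 \<Longrightarrow> flat n t > 0" by (simp add: flat_def)

lemma flat_tendsto_0: "(flat n \<longlongrightarrow> 0) (at 0)"
proof -
  have "((\<lambda>t. inverse t ^ n / exp (inverse t)) \<longlongrightarrow> 0) (at_right (0::real))"
    by (rule filterlim_compose[OF tendsto_power_div_exp_0 filterlim_inverse_at_top_right])
  then have r: "(flat n \<longlongrightarrow> 0) (at_right 0)"
    by (rule Lim_transform_eventually)
      (auto simp: eventually_at_filter flat_def exp_minus field_simps)
  have l: "(flat n \<longlongrightarrow> 0) (at_left 0)"
    by (rule Lim_transform_eventually[OF tendsto_const[of 0]]) (auto simp: eventually_at_filter flat_def)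
  show ?thesis using l r by (simp add: filterlim_split_at)
qed

lemma flat_deriv: "(flat n has_real_derivative flat (n + 2) t - real n * flat (n + 1) t) (at t)"
proof -
  consider "t > 0" | "t < 0" | "t = 0" by linarith
  then show ?thesis
  proof cases
    case 1
    have "((\<lambda>t. exp (- (1 / t)) / t ^ n) has_real_derivative
        (exp (- (1 / t)) * (1 / (t * t)) * t ^ n - exp (- (1 / t)) * (real n * t ^ (n - 1))) / (t ^ n * t ^ n)) (at t)"
      using 1 by (auto intro!: derivative_eq_intros)
    moreover have "(exp (- (1 / t)) * (1 / (t * t)) * t ^ n - exp (- (1 / t)) * (real n * t ^ (n - 1))) / (t ^ n * t ^ n)
      = flat (n + 2) t - real n * flat (n + 1) t"
      using 1 by (cases n) (simp_all add: flat_def field_simps)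
    ultimately have "((\<lambda>t. exp (- (1 / t)) / t ^ n) has_real_derivative flat (n + 2) t - real n * flat (n + 1) t) (at t)"
      by simp
    then show ?thesis
      by (rule has_field_derivative_transform_within_open[of _ _ _ "{0<..}"]) (use 1 in \<open>auto simp: flat_def\<close>)
  next
    case 2
    have "((\<lambda>t. 0) has_real_derivative 0) (at t)" by simp
    then have "(flat n has_real_derivative 0) (at t)"
      by (rule has_field_derivative_transform_within_open[of _ _ _ "{..<0}"]) (use 2 in \<open>auto simp: flat_def\<close>)
    then show ?thesis using 2 by (simp add: flat_def)
  next
    case 3
    have "((\<lambda>h. (flat n (0 + h) - flat n 0) / h) \<longlongrightarrow> 0) (at 0)"
      by (rule Lim_transform_eventually[OF flat_tendsto_0[of "n + 1"]])
        (auto simp: eventually_at_filter flat_def)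
    then show ?thesis unfolding DERIV_def 3 by (simp add: flat_def)
  qed
qed

lemma times_diff_on_flat: "times_diff_on k UNIV (flat n)"
proof (induction k arbitrary: n)
  case 0
  then show ?case
    by (auto intro!: continuous_at_imp_continuous_on DERIV_isCont[OF flat_deriv])
next
  case (Suc k)
  show ?case
  proof (rule times_diff_on_SucI)
    have "(\<lambda>v. v * flat (n + 2) t + (- v * real n) * flat (n + 1) t)
        = (*) (flat (n + 2) t - real n * flat (n + 1) t)" for t
      by (auto simp: algebra_simps)
    then show "(flat n has_derivative (\<lambda>v. v * flat (n + 2) t + (- v * real n) * flat (n + 1) t)) (at t)" for t
      using flat_deriv[of n t] by (simp only: has_field_derivative_def)
    show "times_diff_on k UNIV (\<lambda>t. v * flat (n + 2) t + (- v * real n) * flat (n + 1) t)" for v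
      by (intro times_diff_on_add times_diff_on_bilinear[OF bounded_bilinear_mult] times_diff_on_const
          Suc open_UNIV)
  qed simp
qed

lemma smooth_on_flat: "open S \<Longrightarrow> smooth_on S f \<Longrightarrow> smooth_on S (\<lambda>x. flat n (f x))"
  using times_diff_on_flat by (intro smooth_on_compose[of S UNIV f "flat n"]) (auto simp: smooth_on_def)

definition smooth_scalar :: "('a, 'e::euclidean_space) riem \<Rightarrow> ('a \<Rightarrow> real) \<Rightarrow> bool" where
  "smooth_scalar M \<beta> \<longleftrightarrow> (\<forall>c\<in>atlas M. smooth_on (chart_img c) (\<lambda>y. \<beta> (chart_inv c y)))"

context riem_manifold
begin

lemma continuous_on_chartwise:
  fixes Z :: "'a \<Rightarrow> 'z::real_normed_vector"
  assumes "open W" and Z: "\<And>c. c \<in> atlas M \<Longrightarrow>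
    smooth_on (chart_map c ` (chart_dom c \<inter> W)) (\<lambda>y. Z (chart_inv c y))"
  shows "continuous_on W Z"
proof (rule continuous_at_imp_continuous_on, safe)
  fix x assume x: "x \<in> W"
  obtain c where c: "c \<in> atlas M" "x \<in> chart_dom c" by (rule chart_exists)
  have "continuous_on (chart_dom c \<inter> W) (\<lambda>x. Z (chart_inv c (chart_map c x)))"
    by (rule continuous_on_compose2[OF smooth_on_imp_continuous_on[OF Z[OF c(1)]]])
      (auto intro: continuous_on_subset[OF continuous_on_chart_map[OF c(1)]])
  then have "continuous_on (chart_dom c \<inter> W) Z"
    by (rule continuous_on_cong[THEN iffD1, rotated 2]) (auto simp: chart_inv_map c)
  then show "isCont Z x"
    using x c assms(1) open_chart_dom[OF c(1)] by (auto simp: continuous_on_eq_continuous_at open_Int)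
qed

lemma bump_exists:
  assumes "open W" "x0 \<in> W"
  obtains \<beta> K where "smooth_scalar M \<beta>" "\<beta> x0 > 0" "\<And>x. \<beta> x \<ge> 0" "compact K" "K \<subseteq> W"
    "\<And>x. x \<notin> K \<Longrightarrow> \<beta> x = 0"
proof -
  obtain c0 where c0: "c0 \<in> atlas M" "x0 \<in> chart_dom c0" by (rule chart_exists)
  let ?m = "chart_map c0"
  obtain r where r: "r > 0" "cball (?m x0) r \<subseteq> ?m ` (chart_dom c0 \<inter> W)"
    using open_chart_image[OF c0(1) assms(1)] c0(2) assms(2)
      open_contains_cball[of "?m ` (chart_dom c0 \<inter> W)"] by blast
  define K where "K = chart_inv c0 ` cball (?m x0) r"
  define \<beta> where "\<beta> x = (if x \<in> chart_dom c0 then flat 0 (r\<^sup>2 - (?m x - ?m x0) \<bullet> (?m x - ?m x0)) else 0)" for x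
  have img: "cball (?m x0) r \<subseteq> chart_img c0"
    by (rule order_trans[OF r(2) image_mono]) simp
  have K: "compact K"
    unfolding K_def
    by (rule compact_continuous_image[OF continuous_on_subset[OF continuous_on_chart_inv[OF c0(1)] img] compact_cball])
  have KW: "K \<subseteq> W"
  proof
    fix x assume "x \<in> K"
    then obtain y where y: "y \<in> cball (?m x0) r" "x = chart_inv c0 y" by (auto simp: K_def)
    from subsetD[OF r(2) y(1)] obtain x' where "x' \<in> chart_dom c0" "x' \<in> W" "y = ?m x'" by blast
    then show "x \<in> W" using y(2) chart_inv_map[OF c0(1)] by simp
  qed
  have zero: "\<beta> x = 0" if "x \<notin> K" for x
  proof (cases "x \<in> chart_dom c0")
    case True
    then have "?m x \<notin> cball (?m x0) r"
      using that chart_inv_map[OF c0(1) True] unfolding K_def by (metis imageI)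
    then have "r\<^sup>2 \<le> (norm (?m x - ?m x0))\<^sup>2"
      using r(1) by (intro power_mono) (auto simp: dist_norm norm_minus_commute)
    then show ?thesis by (simp add: \<beta>_def flat_def power2_norm_eq_inner)
  qed (simp add: \<beta>_def)
  have "smooth_on (chart_img c) (\<lambda>y. \<beta> (chart_inv c y))" if c: "c \<in> atlas M" for c
  proof (rule smooth_on_local)
    fix y assume y: "y \<in> chart_img c"
    define x where "x = chart_inv c y"
    have x: "x \<in> chart_dom c" "chart_map c x = y"
      using chart_inv_in[OF y] chart_map_inv[OF c y] by (auto simp: x_def)
    show "\<exists>U. open U \<and> y \<in> U \<and> smooth_on U (\<lambda>y. \<beta> (chart_inv c y))"
    proof (cases "x \<in> chart_dom c0")
      case True
      let ?U = "chart_map c ` (chart_dom c \<inter> chart_dom c0)"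
      have U: "open ?U" "y \<in> ?U" using open_overlap[OF c c0(1)] x True by auto
      have "smooth_on ?U (\<lambda>y. flat 0 (r\<^sup>2 - (transition c c0 y - ?m x0) \<bullet> (transition c c0 y - ?m x0)))"
        by (intro smooth_on_flat smooth_on_diff smooth_on_const U(1) smooth_transition[OF c c0(1)]
            smooth_on_bilinear[OF bounded_bilinear_inner])
      then have "smooth_on ?U (\<lambda>y. \<beta> (chart_inv c y))"
        by (rule smooth_on_cong[OF U(1), rotated]) (auto simp: \<beta>_def transition_def chart_inv_map[OF c])
      then show ?thesis using U by blast
    next
      case False
      let ?U = "chart_map c ` (chart_dom c \<inter> - K)"
      have "K \<subseteq> chart_dom c0"
        unfolding K_def using chart_inv_in[OF subsetD[OF img]] by (rule image_subsetI)
      then have "x \<notin> K" using False by blast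
      then have U: "open ?U" "y \<in> ?U"
        using open_chart_image[OF c, of "- K"] compact_imp_closed[OF K] x by (auto simp: open_closed)
      have "smooth_on ?U (\<lambda>y. 0 :: real)" by (rule smooth_on_const[OF U(1)])
      then have "smooth_on ?U (\<lambda>y. \<beta> (chart_inv c y))"
        by (rule smooth_on_cong[OF U(1), rotated]) (auto simp: zero chart_inv_map[OF c])
      then show ?thesis using U by blast
    qed
  qed
  then have "smooth_scalar M \<beta>" by (simp add: smooth_scalar_def)
  moreover have "\<beta> x0 > 0" using c0(2) r(1) by (simp add: \<beta>_def flat_pos)
  moreover have "\<beta> x \<ge> 0" for x by (simp add: \<beta>_def flat_nonneg)
  ultimately show thesis using that K KW zero by blast
qed

end

section \<open>Vector fields along a map\<close>

context two_manifolds
begin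

lemma field_transform:
  "vector_field_along M N \<psi> X \<Longrightarrow> d \<in> atlas N \<Longrightarrow> d' \<in> atlas N \<Longrightarrow> \<psi> x \<in> chart_dom d \<Longrightarrow>
    \<psi> x \<in> chart_dom d' \<Longrightarrow> X d' x = dird (X d x) (transition d d') (chart_map d (\<psi> x))"
  unfolding vector_field_along_def dird_def by blast

lemma field_smooth:
  "vector_field_along M N \<psi> X \<Longrightarrow> c \<in> atlas M \<Longrightarrow> d \<in> atlas N \<Longrightarrow>
    smooth_on (chart_map c ` (chart_dom c \<inter> \<psi> -` chart_dom d)) (\<lambda>y. X d (chart_inv c y))"
  by (simp add: vector_field_along_def)

lemma vector_field_alongI:
  assumes "\<And>d d' x. d \<in> atlas N \<Longrightarrow> d' \<in> atlas N \<Longrightarrow> \<psi> x \<in> chart_dom d \<Longrightarrow>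
    \<psi> x \<in> chart_dom d' \<Longrightarrow> X d' x = dird (X d x) (transition d d') (chart_map d (\<psi> x))"
    and "\<And>c d. c \<in> atlas M \<Longrightarrow> d \<in> atlas N \<Longrightarrow>
    smooth_on (chart_map c ` (chart_dom c \<inter> \<psi> -` chart_dom d)) (\<lambda>y. X d (chart_inv c y))"
  shows "vector_field_along M N \<psi> X"
  unfolding vector_field_along_def dird_def[symmetric]
  by (intro conjI ballI allI impI assms) blast+

lemma vector_field_along_scale:
  assumes \<psi>: "smooth_map M N \<psi>" and X: "vector_field_along M N \<psi> X" and \<beta>: "smooth_scalar M \<beta>"
  shows "vector_field_along M N \<psi> (\<lambda>d x. \<beta> x *\<^sub>R X d x)"
proof (rule vector_field_alongI)
  show "\<beta> x *\<^sub>R X d' x = dird (\<beta> x *\<^sub>R X d x) (transition d d') (chart_map d (\<psi> x))"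
    if "d \<in> atlas N" "d' \<in> atlas N" "\<psi> x \<in> chart_dom d" "\<psi> x \<in> chart_dom d'" for d d' x
    by (simp add: field_transform[OF X that] linear_scale[OF N.linear_transition[OF that]])
  show "smooth_on (chart_map c ` (chart_dom c \<inter> \<psi> -` chart_dom d)) (\<lambda>y. \<beta> (chart_inv c y) *\<^sub>R X d (chart_inv c y))"
    if "c \<in> atlas M" "d \<in> atlas N" for c d
    using that \<beta> by (intro smooth_on_scaleR open_rep_dom[OF \<psi>] field_smooth[OF X])
      (auto simp: smooth_scalar_def intro: smooth_on_subset)
qed

text \<open>A field supported in the preimage of one chart of \<open>N\<close> is the velocity of a straight-line
  variation in that chart; no exponential map is needed.\<close>

lemma local_variation:
  assumes \<psi>: "smooth_map M N \<psi>" and X: "vector_field_along M N \<psi> X"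
    and d0: "d0 \<in> atlas N" and \<beta>: "smooth_scalar M \<beta>"
    and K: "compact K" "K \<subseteq> \<psi> -` chart_dom d0" "\<And>x. x \<notin> K \<Longrightarrow> \<beta> x = 0"
  obtains \<epsilon> \<gamma> where "\<epsilon> > 0" "smooth_family {-\<epsilon><..<\<epsilon>} M N \<gamma>" "\<gamma> 0 = \<psi>"
    "has_velocity N \<gamma> (\<lambda>d x. \<beta> x *\<^sub>R X d x)"
proof -
  define W where "W = \<psi> -` chart_dom d0"
  define Z where "Z x = \<beta> x *\<^sub>R X d0 x" for x
  have W: "open W" unfolding W_def by (rule open_smooth_map_vimage[OF \<psi> N.open_chart_dom[OF d0]])
  have KW: "K \<subseteq> W" using K(2) by (simp add: W_def)
  note field = vector_field_along_scale[OF \<psi> X \<beta>]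
  have Zs: "smooth_on (chart_map c ` (chart_dom c \<inter> W)) (\<lambda>y. Z (chart_inv c y))" if "c \<in> atlas M" for c
    using field_smooth[OF field that d0] by (simp add: Z_def W_def)
  have psis: "smooth_on (chart_map c ` (chart_dom c \<inter> W)) (\<lambda>y. chart_map d0 (\<psi> (chart_inv c y)))" if "c \<in> atlas M" for c
    using smooth_map_rep[OF \<psi> that d0] by (simp add: coord_rep_def[abs_def] W_def)
  have Zc: "continuous_on W Z" by (rule M.continuous_on_chartwise[OF W Zs])
  have gc: "continuous_on W (\<lambda>x. chart_map d0 (\<psi> x))" by (rule M.continuous_on_chartwise[OF W psis])
  have "compact ((\<lambda>x. chart_map d0 (\<psi> x)) ` K)"
    by (rule compact_continuous_image[OF continuous_on_subset[OF gc KW] K(1)])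
  moreover have "(\<lambda>x. chart_map d0 (\<psi> x)) ` K \<subseteq> chart_img d0" using K(2) by auto
  ultimately obtain \<delta> where \<delta>: "\<delta> > 0" "(\<Union>y\<in>(\<lambda>x. chart_map d0 (\<psi> x)) ` K. ball y \<delta>) \<subseteq> chart_img d0"
    using compact_subset_open_imp_ball_epsilon_subset[OF _ N.open_chart_img[OF d0]] by metis
  obtain B where B: "B > 0" "\<And>x. x \<in> K \<Longrightarrow> norm (Z x) \<le> B"
    using compact_imp_bounded[OF compact_continuous_image[OF continuous_on_subset[OF Zc KW] K(1)]]
    by (auto simp: bounded_pos)
  define \<epsilon> where "\<epsilon> = \<delta> / B"
  have \<epsilon>: "\<epsilon> > 0" using \<delta>(1) B(1) by (simp add: \<epsilon>_def)
  let ?P = "{-\<epsilon><..<\<epsilon>}"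
  have stay: "chart_map d0 (\<psi> x) + t *\<^sub>R Z x \<in> chart_img d0" if "x \<in> W" "t \<in> ?P" for x t
  proof (cases "x \<in> K")
    case True
    have "\<bar>t\<bar> * norm (Z x) \<le> \<bar>t\<bar> * B" using B(2)[OF True] by (intro mult_left_mono) auto
    also have "\<dots> < \<delta>" using that(2) B(1) by (auto simp: \<epsilon>_def field_simps abs_if)
    finally have "chart_map d0 (\<psi> x) + t *\<^sub>R Z x \<in> ball (chart_map d0 (\<psi> x)) \<delta>" by (simp add: dist_norm)
    then show ?thesis using \<delta>(2) True by blast
  next
    case False
    then show ?thesis using K(3) that(1) by (simp add: Z_def W_def)
  qed
  define \<gamma> where "\<gamma> t x = (if x \<in> W then chart_inv d0 (chart_map d0 (\<psi> x) + t *\<^sub>R Z x) else \<psi> x)" for t x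
  have outside: "\<gamma> t x = \<psi> x" if "x \<notin> K" for t x
    using K(3)[OF that] by (auto simp: \<gamma>_def Z_def W_def N.chart_inv_map[OF d0])
  define rep where "rep c z = coord_rep c d0 \<psi> (snd z) + fst z *\<^sub>R Z (chart_inv c (snd z))" 
    for c :: "('a, real^'m) chart" and z :: "real \<times> (real^'m)"
  have oW: "open (chart_map c ` (chart_dom c \<inter> W))" if "c \<in> atlas M" for c
    by (rule M.open_chart_image[OF that W])
  have oR: "open (?P \<times> chart_map c ` (chart_dom c \<inter> W))" if "c \<in> atlas M" for c
    by (intro open_Times oW that) simp
  have rep: "smooth_on (?P \<times> chart_map c ` (chart_dom c \<inter> W)) (rep c)" if c: "c \<in> atlas M" for c
    unfolding rep_def
    by (intro smooth_on_add smooth_on_scaleR oR[OF c]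
        smooth_on_linear[OF bounded_linear_fst oR[OF c]]
        smooth_on_compose[OF oR[OF c] oW[OF c] _ smooth_on_linear[OF bounded_linear_snd oR[OF c]]]
        smooth_map_rep[OF \<psi> c d0, folded W_def] Zs[OF c]) auto
  have rep_eq: "\<gamma> t x = chart_inv d0 (rep c (t, chart_map c x))" "rep c (t, chart_map c x) \<in> chart_img d0"
    if "c \<in> atlas M" "x \<in> chart_dom c" "x \<in> W" "t \<in> ?P" for c x t
    using stay[OF that(3,4)] that by (auto simp: \<gamma>_def rep_def coord_rep_def M.chart_inv_map)
  have "smooth_family ?P M N \<gamma>"
    unfolding smooth_family_def
  proof (intro conjI ballI)
    show "continuous_on (?P \<times> UNIV) (\<lambda>(t, x). \<gamma> t x)"
    proof (rule continuous_at_imp_continuous_on, safe)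
      fix t x assume t: "t \<in> ?P"
      show "isCont (\<lambda>(t, x). \<gamma> t x) (t, x)"
      proof (cases "x \<in> W")
        case True
        obtain c where c: "c \<in> atlas M" "x \<in> chart_dom c" by (rule M.chart_exists)
        have 1: "continuous_on (?P \<times> (chart_dom c \<inter> W)) (\<lambda>z. rep c (fst z, chart_map c (snd z)))"
          by (rule continuous_on_compose2[OF smooth_on_imp_continuous_on[OF rep[OF c(1)]]])
            (auto intro!: continuous_intros continuous_on_compose2[OF M.continuous_on_chart_map[OF c(1)]])
        have 2: "(\<lambda>z. rep c (fst z, chart_map c (snd z))) ` (?P \<times> (chart_dom c \<inter> W)) \<subseteq> chart_img d0"
        proof (rule image_subsetI)
          show "rep c (fst z, chart_map c (snd z)) \<in> chart_img d0" if "z \<in> ?P \<times> (chart_dom c \<inter> W)" for z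
            by (rule rep_eq(2)[OF c(1)]) (use that in auto)
        qed
        have "continuous_on (?P \<times> (chart_dom c \<inter> W)) (\<lambda>z. chart_inv d0 (rep c (fst z, chart_map c (snd z))))"
          by (rule continuous_on_compose2[OF N.continuous_on_chart_inv[OF d0] 1 2])
        then have "continuous_on (?P \<times> (chart_dom c \<inter> W)) (\<lambda>(t, x). \<gamma> t x)"
          by (rule continuous_on_cong[THEN iffD1, rotated 2]) (use rep_eq(1)[OF c(1)] in auto)
        moreover have "open (?P \<times> (chart_dom c \<inter> W))"
          using M.open_chart_dom[OF c(1)] W by (intro open_Times open_Int) auto
        ultimately show ?thesis using t c True by (auto simp: continuous_on_eq_continuous_at)
      next
        case False
        have "continuous_on (?P \<times> - K) (\<lambda>z. \<psi> (snd z))"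
          by (rule continuous_on_compose2[OF _ continuous_on_snd[OF continuous_on_id], of UNIV \<psi>])
            (use \<psi> in \<open>simp_all add: smooth_map_def\<close>)
        then have "continuous_on (?P \<times> - K) (\<lambda>(t, x). \<gamma> t x)"
          by (rule continuous_on_cong[THEN iffD1, rotated 2]) (auto simp: outside)
        moreover have "open (?P \<times> - K)"
          using compact_imp_closed[OF K(1)] by (intro open_Times) auto
        moreover have "x \<notin> K" using False KW by blast
        ultimately show ?thesis using t by (auto simp: continuous_on_eq_continuous_at)
      qed
    qed
    fix c d assume c: "c \<in> atlas M" and d: "d \<in> atlas N"
    show "smooth_on {(t, chart_map c x) |t x. t \<in> ?P \<and> x \<in> chart_dom c \<and> \<gamma> t x \<in> chart_dom d}
      (\<lambda>(t, y). coord_rep c d (\<gamma> t) y)"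
    proof (rule smooth_on_local)
      fix z assume "z \<in> {(t, chart_map c x) |t x. t \<in> ?P \<and> x \<in> chart_dom c \<and> \<gamma> t x \<in> chart_dom d}"
      then obtain t x where z: "z = (t, chart_map c x)" "t \<in> ?P" "x \<in> chart_dom c" "\<gamma> t x \<in> chart_dom d"
        by blast
      show "\<exists>U. open U \<and> z \<in> U \<and> smooth_on U (\<lambda>(t, y). coord_rep c d (\<gamma> t) y)"
      proof (cases "x \<in> W")
        case True
        let ?R = "?P \<times> chart_map c ` (chart_dom c \<inter> W)" and ?T = "chart_map d0 ` (chart_dom d0 \<inter> chart_dom d)"
        let ?U = "?R \<inter> rep c -` ?T"
        have U: "open ?U"
          by (rule continuous_open_preimage[OF smooth_on_imp_continuous_on[OF rep[OF c]] oR[OF c] N.open_overlap[OF d0 d]])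
        have "rep c z \<in> ?T"
        proof -
          have "chart_inv d0 (rep c z) \<in> chart_dom d0 \<inter> chart_dom d"
            using N.chart_inv_in[OF rep_eq(2)[OF c z(3) True z(2)]] z(4)
            unfolding rep_eq(1)[OF c z(3) True z(2)] z(1) by (rule IntI)
          then show ?thesis
            using N.chart_map_inv[OF d0] rep_eq(2)[OF c z(3) True z(2)] z(1) by (metis imageI)
        qed
        then have zU: "z \<in> ?U" using z True by auto
        have "smooth_on ?U (\<lambda>z. transition d0 d (rep c z))"
          by (rule smooth_on_compose[OF U N.open_overlap[OF d0 d] _ smooth_on_subset[OF rep[OF c]] N.smooth_transition[OF d0 d]])
            auto
        then have "smooth_on ?U (\<lambda>(t, y). coord_rep c d (\<gamma> t) y)"
          by (rule smooth_on_cong[OF U, rotated])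
            (auto simp: coord_rep_def transition_def rep_eq(1)[OF c] M.chart_inv_map[OF c])
        then show ?thesis using U zU by blast
      next
        case False
        let ?V = "chart_map c ` (chart_dom c \<inter> (\<psi> -` chart_dom d \<inter> - K))"
        let ?U = "?P \<times> ?V"
        have V: "open ?V"
          using compact_imp_closed[OF K(1)]
          by (intro M.open_chart_image[OF c] open_Int open_smooth_map_vimage[OF \<psi> N.open_chart_dom[OF d]]) auto
        then have U: "open ?U" by (intro open_Times) auto
        have "x \<notin> K" using False KW by blast
        then have "x \<in> chart_dom c \<inter> (\<psi> -` chart_dom d \<inter> - K)"
          using z(3,4) outside[of x t] by simp
        then have zU: "z \<in> ?U" using z(1,2) by blast
        have "smooth_on ?U (\<lambda>z. coord_rep c d \<psi> (snd z))"
          by (rule smooth_on_compose[OF U V _ smooth_on_linear[OF bounded_linear_snd U]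
              smooth_on_subset[OF smooth_map_rep[OF \<psi> c d]]]) auto
        then have "smooth_on ?U (\<lambda>(t, y). coord_rep c d (\<gamma> t) y)"
          by (rule smooth_on_cong[OF U, rotated]) (auto simp: coord_rep_def outside M.chart_inv_map[OF c])
        then show ?thesis using U zU by blast
      qed
    qed
  qed
  moreover have \<gamma>0: "\<gamma> 0 = \<psi>"
    by (auto simp: \<gamma>_def W_def N.chart_inv_map[OF d0])
  moreover have "has_velocity N \<gamma> (\<lambda>d x. \<beta> x *\<^sub>R X d x)"
    unfolding has_velocity_def \<gamma>0
  proof (intro ballI allI impI)
    fix d x assume d: "d \<in> atlas N" "\<psi> x \<in> chart_dom d"
    show "((\<lambda>t. chart_map d (\<gamma> t x)) has_vector_derivative \<beta> x *\<^sub>R X d x) (at 0)"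
    proof (cases "x \<in> W")
      case True
      then have p: "\<psi> x \<in> chart_dom d0" by (simp add: W_def)
      have "((\<lambda>t. transition d0 d (chart_map d0 (\<psi> x) + t *\<^sub>R Z x)) has_vector_derivative
          dird (Z x) (transition d0 d) (chart_map d0 (\<psi> x) + 0 *\<^sub>R Z x)) (at 0)"
        by (rule has_vector_derivative_line[OF N.smooth_transition[OF d0 d(1)]]) (use p d in auto)
      then show ?thesis
        using field_transform[OF field d0 d(1) p d(2)] True by (simp add: transition_def \<gamma>_def Z_def)
    next
      case False
      then have "x \<notin> K" using KW by blast
      then show ?thesis using K(3) outside by simp
    qed
  qed
  ultimately show thesis using that \<epsilon> by blast
qed

end

section \<open>The first variation\<close>

text \<open>The inner product \<open>\<langle>\<nabla>X, d\<psi>\<rangle>\<close>, computed at \<open>x\<close> in charts around \<open>x\<close> and \<open>\<psi> x\<close>.\<close>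

definition nabla_dot ::
  "('a, real^'m) riem \<Rightarrow> ('b, real^'n) riem \<Rightarrow> ('a \<Rightarrow> 'b) \<Rightarrow> (('b, real^'n) chart \<Rightarrow> 'a \<Rightarrow> real^'n) \<Rightarrow> 'a \<Rightarrow> real" where
  "nabla_dot M N \<psi> X x = (let c = chart_at M x; d = chart_at N (\<psi> x); f = coord_rep c d \<psi>; y = chart_map c x;
      b = (SOME b. orthonormal_basis (metric M c x) b)
    in \<Sum>e\<in>b. coord_metric N d (f y)
      (local_metric.cov (coord_metric N d) f e (\<lambda>y. X d (chart_inv c y)) y) (dird e f y))"

context two_manifolds
begin

lemma nabla_dot_sum:
  assumes \<psi>: "smooth_map M N \<psi>" and X: "\<And>i. i \<in> I \<Longrightarrow> vector_field_along M N \<psi> (X i)"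
  shows "nabla_dot M N \<psi> (\<lambda>d x. \<Sum>i\<in>I. X i d x) x = (\<Sum>i\<in>I. nabla_dot M N \<psi> (X i) x)"
proof -
  define c where "c = chart_at M x"
  define d where "d = chart_at N (\<psi> x)"
  note c = M.chart_at[of x, folded c_def] and d = N.chart_at[of "\<psi> x", folded d_def]
  let ?f = "coord_rep c d \<psi>" and ?y = "chart_map c x" and ?k = "coord_metric N d"
  interpret Nd: local_metric "chart_img d" ?k by (rule N.local_metric[OF d(1)])
  let ?X = "\<lambda>i y. X i d (chart_inv c y)"
  have y: "?y \<in> chart_map c ` (chart_dom c \<inter> \<psi> -` chart_dom d)" using c d by auto
  have fy: "?f ?y \<in> chart_img d" using c d by (simp add: coord_rep_def M.chart_inv_map)
  note kb = Nd.bilinear_k[OF fy] and cb = Nd.bilinear_christoffel[OF fy]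
  have cov: "Nd.cov ?f e (\<lambda>y. \<Sum>i\<in>I. ?X i y) ?y = (\<Sum>i\<in>I. Nd.cov ?f e (?X i) ?y)" for e
  proof -
    have "christoffel ?k (?f ?y) u (\<Sum>i\<in>I. ?X i ?y) = (\<Sum>i\<in>I. christoffel ?k (?f ?y) u (?X i ?y))" for u
      using linear_sum[of "christoffel ?k (?f ?y) u"] cb by (simp add: bilinear_def)
    then show ?thesis
      unfolding Nd.cov_def by (simp only: dird_sum[OF field_smooth[OF X c(1) d(1)] y] sum.distrib)
  qed
  have "?k (?f ?y) (\<Sum>i\<in>I. v i) w = (\<Sum>i\<in>I. ?k (?f ?y) (v i) w)" for v w
    using linear_sum[of "\<lambda>u. ?k (?f ?y) u w"] kb by (simp add: bilinear_def)
  then show ?thesis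
    unfolding nabla_dot_def Let_def c_def[symmetric] d_def[symmetric] cov by (simp only: sum.swap[of _ I])
qed

context
  fixes P :: "'p::euclidean_space set" and F :: "'p \<Rightarrow> 'a \<Rightarrow> 'b" and p0 :: 'p and x :: 'a
    and c :: "('a, real^'m) chart" and d :: "('b, real^'n) chart" and b :: "(real^'m) set"
    and f U z q
  assumes P: "open P" and F: "smooth_family P M N F" and p0: "p0 \<in> P"
    and c: "c \<in> atlas M" "x \<in> chart_dom c" and d: "d \<in> atlas N" "F p0 x \<in> chart_dom d"
    and b: "orthonormal_basis (metric M c x) b"
  defines "f \<equiv> fam_rep c d F" and "U \<equiv> fam_dom P c d F" and "z \<equiv> (p0, chart_map c x)"
    and "q \<equiv> \<lambda>w. \<Sum>e\<in>b. coord_metric N d (f w) (dird (0, e) f w) (dird (0, e) f w)"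
begin

interpretation Nd: local_metric "chart_img d" "coord_metric N d" by (rule N.local_metric[OF d(1)])

lemma rep_open: "open U" unfolding U_def by (rule open_fam_dom[OF P F c(1) d(1)])

lemma rep_mem: "z \<in> U"
  unfolding U_def z_def by (rule iffD2[OF mem_fam_dom[OF P F c] conjI[OF p0 d(2)]])

lemma rep_smooth: "smooth_on U f" unfolding U_def f_def by (rule smooth_fam_rep[OF P F c(1) d(1)])

lemma rep_img: "f ` U \<subseteq> chart_img d" unfolding U_def f_def by (rule fam_rep_img[OF P F c(1)])

lemmas along = rep_open rep_img rep_smooth

lemma rep_in_img: "f z \<in> chart_img d" by (rule subsetD[OF rep_img imageI[OF rep_mem]])

lemma q_smooth: "smooth_on U q"
  unfolding q_def by (intro smooth_on_sum Nd.smooth_k_along along smooth_on_dird)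

lemma q_nonneg: "w \<in> U \<Longrightarrow> q w \<ge> 0"
  unfolding q_def by (intro sum_nonneg inner_formD(4) Nd.inner_form_k subsetD[OF rep_img] imageI)

lemma density_smooth: "smooth_on U (\<lambda>w. (1 + q w) powr \<alpha>)"
  by (intro smooth_on_powr smooth_on_add smooth_on_const rep_open q_smooth add_pos_nonneg q_nonneg
      zero_less_one)

lemma hs_eq_q: "p \<in> P \<Longrightarrow> F p x \<in> chart_dom d \<Longrightarrow> (hs_norm_diff M N (F p) x)\<^sup>2 = q (p, chart_map c x)"
  unfolding q_def f_def by (rule hs_norm_diff_family[OF P F c d(1) _ _ b])

definition "param_dom = (\<lambda>p. (p, chart_map c x)) -` U"

lemma param_dom_open: "open param_dom"
  unfolding param_dom_def by (intro continuous_open_vimage rep_open continuous_intros)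

lemma param_dom_mem: "p0 \<in> param_dom" using rep_mem by (simp add: param_dom_def z_def)

lemma hs_eq_q_near: "p \<in> param_dom \<Longrightarrow> (hs_norm_diff M N (F p) x)\<^sup>2 = q (p, chart_map c x)"
proof -
  assume "p \<in> param_dom"
  then have "(p, chart_map c x) \<in> fam_dom P c d F" by (simp only: param_dom_def U_def vimage_eq)
  from iffD1[OF mem_fam_dom[OF P F c] this] show ?thesis using hs_eq_q by blast
qed

lemma dird_q: 
  assumes "w \<in> U"
  shows "dird v q w = 2 * (\<Sum>e\<in>b. coord_metric N d (f w) (Nd.cov f v (dird (0, e) f) w) (dird (0, e) f w))"
proof -
  have fw: "f w \<in> chart_img d" by (rule subsetD[OF rep_img imageI[OF assms]])
  show ?thesis
    unfolding q_def
    by (subst dird_sum[OF Nd.smooth_k_along[OF along smooth_on_dird[OF rep_smooth] smooth_on_dird[OF rep_smooth]] assms])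
      (simp add: Nd.dird_k_along[OF along smooth_on_dird[OF rep_smooth] smooth_on_dird[OF rep_smooth] assms]
        Nd.sym_k[OF fw, of "dird _ f w" "Nd.cov _ _ _ _"] sum_distrib_left)
qed

lemma dird_density:
  assumes "w \<in> U"
  shows "dird v (\<lambda>w. (1 + q w) powr \<alpha>) w = \<alpha> * (1 + q w) powr (\<alpha> - 1) * dird v q w"
  using dird_powr[OF smooth_on_add[OF rep_open smooth_on_const[OF rep_open] q_smooth] assms]
    dird_add[OF smooth_on_const[OF rep_open] q_smooth assms] q_nonneg[OF assms]
  by (simp add: dird_const)

lemma dird_density_slice:
  assumes "p \<in> param_dom"
  shows "dird v (\<lambda>p. (1 + (hs_norm_diff M N (F p) x)\<^sup>2) powr \<alpha>) p
    = dird (v, 0) (\<lambda>w. (1 + q w) powr \<alpha>) (p, chart_map c x)"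
proof -
  have "dird v (\<lambda>p. (1 + (hs_norm_diff M N (F p) x)\<^sup>2) powr \<alpha>) p
      = dird v (\<lambda>p. (1 + q (p, chart_map c x)) powr \<alpha>) p"
    by (rule dird_cong_open[OF param_dom_open assms]) (simp add: hs_eq_q_near)
  also have "\<dots> = dird (v, 0) (\<lambda>w. (1 + q w) powr \<alpha>) (p, chart_map c x)"
    using assms by (intro dird_fst_slice[OF density_smooth]) (simp add: param_dom_def)
  finally show ?thesis .
qed

lemma dird2_density_slice:
  "dird v (\<lambda>p. dird u (\<lambda>p. (1 + (hs_norm_diff M N (F p) x)\<^sup>2) powr \<alpha>) p) p0
    = dird (v, 0) (dird (u, 0) (\<lambda>w. (1 + q w) powr \<alpha>)) z"
proof -
  have "dird v (\<lambda>p. dird u (\<lambda>p. (1 + (hs_norm_diff M N (F p) x)\<^sup>2) powr \<alpha>) p) p0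
      = dird v (\<lambda>p. dird (u, 0) (\<lambda>w. (1 + q w) powr \<alpha>) (p, chart_map c x)) p0"
    by (rule dird_cong_open[OF param_dom_open param_dom_mem dird_density_slice])
  also have "\<dots> = dird (v, 0) (dird (u, 0) (\<lambda>w. (1 + q w) powr \<alpha>)) z"
    unfolding z_def by (rule dird_fst_slice[OF smooth_on_dird[OF density_smooth] rep_mem[unfolded z_def]])
  finally show ?thesis .
qed

lemma cov_slice:
  assumes Y: "smooth_on U Y" and X: "\<And>y. (p0, y) \<in> U \<Longrightarrow> Y (p0, y) = X y"
  shows "Nd.cov f (0, e) Y z = Nd.cov (coord_rep c d (F p0)) e X (chart_map c x)"
proof -
  have o: "open ((\<lambda>y. (p0, y)) -` U)" by (intro continuous_open_vimage rep_open continuous_intros)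
  have "dird e X (chart_map c x) = dird e (\<lambda>y. Y (p0, y)) (chart_map c x)"
    by (rule dird_cong_open[OF o]) (use rep_mem X in \<open>auto simp: z_def\<close>)
  also have "\<dots> = dird (0, e) Y z"
    unfolding z_def by (rule dird_snd_slice[OF Y rep_mem[unfolded z_def]])
  finally have 1: "dird (0, e) Y z = dird e X (chart_map c x)" ..
  have 2: "dird (0, e) f z = dird e (coord_rep c d (F p0)) (chart_map c x)"
    using dird_snd_slice[OF rep_smooth rep_mem[unfolded z_def], of e] by (simp add: f_def fam_rep_def z_def)
  show ?thesis
    unfolding Nd.cov_def 1 2 using X rep_mem by (simp add: z_def f_def fam_rep_def)
qed

lemma nabla_slice:
  assumes Y: "smooth_on U Y" and X: "\<And>y. (p0, y) \<in> U \<Longrightarrow> Y (p0, y) = X y"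
  shows "(\<Sum>e\<in>b. coord_metric N d (f z) (Nd.cov f (0, e) Y z) (dird (0, e) f z))
    = (\<Sum>e\<in>b. coord_metric N d (coord_rep c d (F p0) (chart_map c x))
        (Nd.cov (coord_rep c d (F p0)) e X (chart_map c x)) (dird e (coord_rep c d (F p0)) (chart_map c x)))"
proof -
  have 2: "dird (0, e) f z = dird e (coord_rep c d (F p0)) (chart_map c x)" for e
    using dird_snd_slice[OF rep_smooth rep_mem[unfolded z_def], of e] by (simp add: f_def fam_rep_def z_def)
  have 3: "f z = coord_rep c d (F p0) (chart_map c x)" by (simp add: f_def fam_rep_def z_def)
  have 4: "Nd.cov f (0, e) Y z = Nd.cov (coord_rep c d (F p0)) e X (chart_map c x)" for e
    by (rule cov_slice[OF Y X])
  show ?thesis unfolding 4 2 unfolding 3 ..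
qed

lemma dird_f_slice:
  assumes "(p, y) \<in> U"
  shows "dird (v, 0) f (p, y) = dird v (\<lambda>p. chart_map d (F p (chart_inv c y))) p"
  using dird_fst_slice[OF rep_smooth assms, of v] by (simp add: f_def fam_rep_def coord_rep_def)

lemma dird2_f_slice:
  assumes "(p0, y) \<in> U"
  shows "dird (v, 0) (dird (u, 0) f) (p0, y)
    = dird v (\<lambda>p. dird u (\<lambda>p. chart_map d (F p (chart_inv c y))) p) p0"
proof -
  have o: "open ((\<lambda>p. (p, y)) -` U)" by (intro continuous_open_vimage rep_open continuous_intros)
  have "dird v (\<lambda>p. dird u (\<lambda>p. chart_map d (F p (chart_inv c y))) p) p0 = dird v (\<lambda>p. dird (u, 0) f (p, y)) p0"
    by (rule dird_cong_open[OF o]) (use assms in \<open>auto simp: dird_f_slice\<close>)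
  then show ?thesis
    by (simp add: dird_fst_slice[OF smooth_on_dird[OF rep_smooth] assms])
qed

text \<open>The outer power contributes the square of the first derivative of \<open>q\<close>; in the second
  derivative of \<open>q\<close>, commuting covariant derivatives produces the curvature term and the first
  variation in the direction of the covariant acceleration.\<close>

lemma second_density_ge:
  assumes K: "nonpositive_sectional_curvature N" and \<alpha>: "\<alpha> > 1"
    and eq: "\<And>y. (p0, y) \<in> U \<Longrightarrow> dird (u, 0) f (p0, y) = dird (v, 0) f (p0, y)"
  shows "dird (v, 0) (dird (u, 0) (\<lambda>w. (1 + q w) powr \<alpha>)) z \<ge>
    2 * \<alpha> * (1 + q z) powr (\<alpha> - 1) * 
    (\<Sum>e\<in>b. coord_metric N d (f z) (Nd.cov f (0, e) (Nd.cov f (v, 0) (dird (u, 0) f)) z) (dird (0, e) f z))"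
proof -
  let ?k = "coord_metric N d (f z)" and ?a = "\<lambda>e. dird (0, e) f"
  note sf = smooth_on_dird[OF rep_smooth] and z = rep_mem
  note fz = rep_in_img
  have eqz: "dird (u, 0) f z = dird (v, 0) f z" using eq z by (simp add: z_def)
  have cov_eq: "Nd.cov f (u, 0) (?a e) z = Nd.cov f (v, 0) (?a e) z" for e
  proof -
    have "Nd.cov f (0, e) (dird (u, 0) f) z = Nd.cov f (0, e) (dird (v, 0) f) z"
      using cov_slice[OF sf, where X = "\<lambda>y. dird (v, 0) f (p0, y)" and e = e] eq by simp
    then show ?thesis by (simp add: Nd.cov_commute[OF along z, of "(_, 0)" "(0, e)"])
  qed
  have "dird (v, 0) (dird (u, 0) (\<lambda>w. (1 + q w) powr \<alpha>)) z
      = dird (v, 0) (\<lambda>w. (\<alpha> * (1 + q w) powr (\<alpha> - 1)) * dird (u, 0) q w) z"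
    by (rule dird_cong_open[OF rep_open z dird_density])
  also have "\<dots> = (\<alpha> * (1 + q z) powr (\<alpha> - 1)) * dird (v, 0) (dird (u, 0) q) z
      + dird (v, 0) (\<lambda>w. \<alpha> * (1 + q w) powr (\<alpha> - 1)) z * dird (u, 0) q z"
    by (rule dird_mult[OF smooth_on_mult[OF rep_open smooth_on_const[OF rep_open] density_smooth] 
          smooth_on_dird[OF q_smooth] z])
  also have "dird (v, 0) (\<lambda>w. \<alpha> * (1 + q w) powr (\<alpha> - 1)) z
      = \<alpha> * ((\<alpha> - 1) * (1 + q z) powr (\<alpha> - 2) * dird (v, 0) q z)"
    using dird_linear_comp[OF bounded_linear_mult_right[of \<alpha>] density_smooth z, of "(v, 0)" "\<alpha> - 1"]
    by (simp add: dird_density[OF z])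
  also have "dird (u, 0) q z = dird (v, 0) q z"
    by (simp add: dird_q[OF z] cov_eq)
  finally have main: "dird (v, 0) (dird (u, 0) (\<lambda>w. (1 + q w) powr \<alpha>)) z
      = \<alpha> * (1 + q z) powr (\<alpha> - 1) * dird (v, 0) (dird (u, 0) q) z
        + \<alpha> * (\<alpha> - 1) * (1 + q z) powr (\<alpha> - 2) * (dird (v, 0) q z)\<^sup>2"
    by (simp add: power2_eq_square algebra_simps)
  have "dird (v, 0) (dird (u, 0) q) z
      = dird (v, 0) (\<lambda>w. 2 * (\<Sum>e\<in>b. coord_metric N d (f w) (Nd.cov f (u, 0) (?a e) w) (?a e w))) z"
    by (rule dird_cong_open[OF rep_open z dird_q])
  also have "\<dots> = 2 * dird (v, 0) (\<lambda>w. \<Sum>e\<in>b. coord_metric N d (f w) (Nd.cov f (u, 0) (?a e) w) (?a e w)) z"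
    by (rule dird_linear_comp[OF bounded_linear_mult_right _ z])
      (intro smooth_on_sum Nd.smooth_k_along along Nd.smooth_cov sf)
  also have "\<dots> = 2 * (\<Sum>e\<in>b. dird (v, 0) (\<lambda>w. coord_metric N d (f w) (Nd.cov f (u, 0) (?a e) w) (?a e w)) z)"
    by (subst dird_sum[OF Nd.smooth_k_along[OF along Nd.smooth_cov[OF along sf] sf] z]) (rule refl)
  also have "\<dots> = 2 * (\<Sum>e\<in>b. ?k (Nd.cov f (v, 0) (Nd.cov f (u, 0) (?a e)) z) (?a e z)
      + ?k (Nd.cov f (u, 0) (?a e) z) (Nd.cov f (v, 0) (?a e) z))"
    by (simp only: Nd.dird_k_along[OF along Nd.smooth_cov[OF along sf] sf z])
  also have "\<dots> \<ge> 2 * (\<Sum>e\<in>b. ?k (Nd.cov f (0, e) (Nd.cov f (v, 0) (dird (u, 0) f)) z) (?a e z))"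
  proof (intro mult_left_mono sum_mono)
    fix e
    have "Nd.cov f (v, 0) (Nd.cov f (u, 0) (?a e)) z = Nd.cov f (v, 0) (Nd.cov f (0, e) (dird (u, 0) f)) z"
      unfolding Nd.cov_def[of f "(v, 0)"]
      using dird_cong_open[OF rep_open z Nd.cov_commute[OF along]] Nd.cov_commute[OF along z] by simp
    also have "\<dots> = Nd.cov f (0, e) (Nd.cov f (v, 0) (dird (u, 0) f)) z
        + riemann_curvature (coord_metric N d) (f z) (dird (v, 0) f z) (?a e z) (dird (v, 0) f z)"
      using Nd.cov_curvature[OF along sf z, of "(v, 0)" "(0, e)" "(u, 0)"] eqz by (simp add: algebra_simps)
    finally have 1: "?k (Nd.cov f (v, 0) (Nd.cov f (u, 0) (?a e)) z) (?a e z)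
      = ?k (Nd.cov f (0, e) (Nd.cov f (v, 0) (dird (u, 0) f)) z) (?a e z)
        + ?k (riemann_curvature (coord_metric N d) (f z) (dird (v, 0) f z) (?a e z) (dird (v, 0) f z)) (?a e z)"
      by (simp only: bilinear_ladd[OF Nd.bilinear_k[OF fz]])
    have 2: "?k (riemann_curvature (coord_metric N d) (f z) (dird (v, 0) f z) (?a e z) (dird (v, 0) f z)) (?a e z) \<ge> 0"
    proof (rule Nd.curvature_nonneg[OF fz])
      fix X Y :: "real^'n" assume XY: "X \<noteq> Y" "independent {X, Y}"
      have "sectional_curvature N d (chart_inv d (f z)) X Y \<le> 0"
        using K XY d(1) N.chart_inv_in[OF fz] unfolding nonpositive_sectional_curvature_def by blast
      then show "?k (riemann_curvature (coord_metric N d) (f z) X Y Y) X / (?k X X * ?k Y Y - (?k X Y)\<^sup>2) \<le> 0"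
        unfolding sectional_curvature_def N.chart_map_inv[OF d(1) fz] by (simp only: coord_metric_def)
    qed
    have 3: "?k (Nd.cov f (u, 0) (?a e) z) (Nd.cov f (v, 0) (?a e) z) \<ge> 0"
      unfolding cov_eq by (rule inner_formD(4)[OF Nd.inner_form_k[OF fz]])
    show "?k (Nd.cov f (0, e) (Nd.cov f (v, 0) (dird (u, 0) f)) z) (?a e z)
      \<le> ?k (Nd.cov f (v, 0) (Nd.cov f (u, 0) (?a e)) z) (?a e z)
        + ?k (Nd.cov f (u, 0) (?a e) z) (Nd.cov f (v, 0) (?a e) z)"
      using 1 2 3 by linarith
  qed simp
  finally have "2 * (\<Sum>e\<in>b. ?k (Nd.cov f (0, e) (Nd.cov f (v, 0) (dird (u, 0) f)) z) (?a e z))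
      \<le> dird (v, 0) (dird (u, 0) q) z" .
  then have "\<alpha> * (1 + q z) powr (\<alpha> - 1) * (2 * (\<Sum>e\<in>b. ?k (Nd.cov f (0, e) (Nd.cov f (v, 0) (dird (u, 0) f)) z) (?a e z)))
      \<le> \<alpha> * (1 + q z) powr (\<alpha> - 1) * dird (v, 0) (dird (u, 0) q) z"
    using \<alpha> by (intro mult_left_mono) auto
  moreover have "0 \<le> \<alpha> * (\<alpha> - 1) * (1 + q z) powr (\<alpha> - 2) * (dird (v, 0) q z)\<^sup>2"
    using \<alpha> by auto
  ultimately show ?thesis unfolding main by (simp add: algebra_simps)
qed

end

end

context two_manifolds
begin

lemma first_variation_density:
  fixes P :: "'p::euclidean_space set"
  assumes P: "open P" and F: "smooth_family P M N F" and p0: "p0 \<in> P"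
    and X: "\<And>d x. d \<in> atlas N \<Longrightarrow> F p0 x \<in> chart_dom d \<Longrightarrow>
      dird v (\<lambda>p. chart_map d (F p x)) p0 = X d x"
  shows "dird v (\<lambda>p. (1 + (hs_norm_diff M N (F p) x)\<^sup>2) powr \<alpha>) p0
    = 2 * \<alpha> * ((1 + (hs_norm_diff M N (F p0) x)\<^sup>2) powr (\<alpha> - 1) * nabla_dot M N (F p0) X x)"
proof -
  define c where "c = chart_at M x"
  define d where "d = chart_at N (F p0 x)"
  define b where "b = (SOME b. orthonormal_basis (metric M c x) b)"
  note c = M.chart_at[of x, folded c_def] and d = N.chart_at[of "F p0 x", folded d_def]
  have b: "orthonormal_basis (metric M c x) b"
    unfolding b_def by (rule someI_ex[OF orthonormal_basis_exists[OF M.inner_form_metric[OF c]]])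
  let ?f = "fam_rep c d F" and ?k = "coord_metric N d" and ?z = "(p0, chart_map c x)"
  interpret Nd: local_metric "chart_img d" ?k by (rule N.local_metric[OF d(1)])
  note ctx = P F p0 c d b
  note z = rep_mem[OF ctx] and f = rep_smooth[OF ctx] 
  have "dird v (\<lambda>p. (1 + (hs_norm_diff M N (F p) x)\<^sup>2) powr \<alpha>) p0
      = \<alpha> * (1 + (hs_norm_diff M N (F p0) x)\<^sup>2) powr (\<alpha> - 1) * 
        (2 * (\<Sum>e\<in>b. ?k (?f ?z) (Nd.cov ?f (v, 0) (dird (0, e) ?f) ?z) (dird (0, e) ?f ?z)))"
    unfolding dird_density_slice[OF ctx param_dom_mem[OF ctx]] dird_density[OF ctx z] dird_q[OF ctx z]
      hs_eq_q[OF ctx p0 d(2)] ..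
  also have "(\<Sum>e\<in>b. ?k (?f ?z) (Nd.cov ?f (v, 0) (dird (0, e) ?f) ?z) (dird (0, e) ?f ?z))
      = (\<Sum>e\<in>b. ?k (?f ?z) (Nd.cov ?f (0, e) (dird (v, 0) ?f) ?z) (dird (0, e) ?f ?z))"
    by (simp only: Nd.cov_commute[OF along[OF ctx] z, of "(v, 0)"])
  also have "\<dots> = nabla_dot M N (F p0) X x"
    unfolding nabla_dot_def Let_def c_def[symmetric] d_def[symmetric] b_def[symmetric]
  proof (rule nabla_slice[OF ctx smooth_on_dird[OF f]])
    fix y assume y: "(p0, y) \<in> fam_dom P c d F"
    then have "F p0 (chart_inv c y) \<in> chart_dom d" by (simp add: fam_dom_eq[OF P F c(1)])
    then show "dird (v, 0) ?f (p0, y) = X d (chart_inv c y)"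
      using dird_f_slice[OF ctx y] X[OF d(1)] by simp
  qed
  finally show ?thesis by (simp add: mult_ac)
qed

lemma smooth_on_param:
  fixes P :: "'p::euclidean_space set"
  assumes P: "open P" and F: "smooth_family P M N F" and d: "d \<in> atlas N"
  shows "open {p \<in> P. F p x \<in> chart_dom d}" "smooth_on {p \<in> P. F p x \<in> chart_dom d} (\<lambda>p. chart_map d (F p x))"
proof -
  obtain c where c: "c \<in> atlas M" "x \<in> chart_dom c" by (rule M.chart_exists)
  have eq: "{p \<in> P. F p x \<in> chart_dom d} = (\<lambda>p. (p, chart_map c x)) -` fam_dom P c d F"
    using mem_fam_dom[OF P F c] by blast
  show o: "open {p \<in> P. F p x \<in> chart_dom d}"
    unfolding eq by (intro continuous_open_vimage open_fam_dom[OF P F c(1) d] continuous_intros)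
  have "smooth_on {p \<in> P. F p x \<in> chart_dom d} (\<lambda>p. fam_rep c d F (p, chart_map c x))"
    by (rule smooth_on_compose[OF o open_fam_dom[OF P F c(1) d] _
          smooth_on_Pair[OF o smooth_on_linear[OF bounded_linear_ident o] smooth_on_const[OF o]]
          smooth_fam_rep[OF P F c(1) d]]) (use eq in blast)
  then show "smooth_on {p \<in> P. F p x \<in> chart_dom d} (\<lambda>p. chart_map d (F p x))"
    by (simp add: fam_rep_def coord_rep_def M.chart_inv_map c)
qed

lemma velocity_dird:
  fixes P :: "'p::euclidean_space set"
  assumes P: "open P" and F: "smooth_family P M N F" and p0: "p0 \<in> P"
    and vel: "has_velocity N (\<lambda>t. F (p0 + t *\<^sub>R v)) X"
    and d: "d \<in> atlas N" "F p0 x \<in> chart_dom d"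
  shows "dird v (\<lambda>p. chart_map d (F p x)) p0 = X d x"
proof -
  have "((\<lambda>t. chart_map d (F (p0 + t *\<^sub>R v) x)) has_vector_derivative X d x) (at 0)"
    using vel d by (simp add: has_velocity_def)
  moreover have "((\<lambda>t. chart_map d (F (p0 + t *\<^sub>R v) x)) has_vector_derivative
      dird v (\<lambda>p. chart_map d (F p x)) (p0 + 0 *\<^sub>R v)) (at 0)"
    by (rule has_vector_derivative_line[OF smooth_on_param(2)[OF P F d(1)]]) (use p0 d in simp)
  ultimately show ?thesis using vector_derivative_unique_at by fastforce
qed

definition first_variation_integrand ::
  "real \<Rightarrow> ('a \<Rightarrow> 'b) \<Rightarrow> (('b, real^'n) chart \<Rightarrow> 'a \<Rightarrow> real^'n) \<Rightarrow> 'a \<Rightarrow> real" where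
  "first_variation_integrand \<alpha> \<psi> X x = (1 + (hs_norm_diff M N \<psi> x)\<^sup>2) powr (\<alpha> - 1) * nabla_dot M N \<psi> X x"

context
  fixes \<alpha> :: real and vol :: "'a measure" and \<psi> :: "'a \<Rightarrow> 'b"
  assumes \<alpha>: "\<alpha> > 1" and cpt: "compact (UNIV :: 'a set)" and vol: "riemannian_volume M vol"
    and harmonic: "alpha_harmonic \<alpha> vol M N \<psi>"
begin

lemma finite_vol: "finite_measure vol" by (rule M.finite_volume[OF cpt vol])

lemma sets_vol: "sets vol = sets borel" using vol by (simp add: riemannian_volume_def)

lemma smooth_psi: "smooth_map M N \<psi>" using harmonic by (simp add: alpha_harmonic_def)

lemma first_variation_velocity:
  assumes "\<epsilon> > 0" "smooth_family {-\<epsilon><..<\<epsilon>} M N \<gamma>" "\<gamma> 0 = \<psi>" "has_velocity N \<gamma> X"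
  shows "has_bochner_integral vol (first_variation_integrand \<alpha> \<psi> X) 0"
proof -
  let ?P = "{-\<epsilon><..<\<epsilon>}" and ?e = "\<lambda>t x. (1 + (hs_norm_diff M N (\<gamma> t) x)\<^sup>2) powr \<alpha>"
  have P: "open ?P" "0 \<in> ?P" using assms(1) by auto
  note e = smooth_fun_energy_density[OF P(1) assms(2), of \<alpha>]
  have 1: "dird 1 (\<lambda>t. ?e t x) 0 = 2 * \<alpha> * first_variation_integrand \<alpha> \<psi> X x" for x
  proof -
    have "dird 1 (\<lambda>t. ?e t x) 0
        = 2 * \<alpha> * ((1 + (hs_norm_diff M N (\<gamma> 0) x)\<^sup>2) powr (\<alpha> - 1) * nabla_dot M N (\<gamma> 0) X x)"
    proof (rule first_variation_density[OF P(1) assms(2) P(2)])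
      show "dird 1 (\<lambda>t. chart_map d (\<gamma> t x)) 0 = X d x" if "d \<in> atlas N" "\<gamma> 0 x \<in> chart_dom d" for d x
        by (rule velocity_dird[OF P(1) assms(2) P(2) _ that]) (use assms(4) in simp)
    qed
    then show ?thesis by (simp add: first_variation_integrand_def assms(3))
  qed
  have "integrable vol (\<lambda>x. dird 1 (\<lambda>t. ?e t x) 0)"
    by (rule M.smooth_fun_integrable[OF P(1) M.smooth_fun_dird[OF P(1) e] finite_vol sets_vol cpt P(2)])
  then have int: "integrable vol (first_variation_integrand \<alpha> \<psi> X)" using \<alpha> unfolding 1 by simp
  have "((\<lambda>t. \<integral>x. ?e (0 + t *\<^sub>R 1) x \<partial>vol) has_real_derivative (\<integral>x. dird 1 (\<lambda>t. ?e t x) 0 \<partial>vol)) (at 0)"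
    by (rule M.smooth_fun_integral_deriv[OF P(1) e P(2) finite_vol sets_vol cpt])
  moreover have "((\<lambda>t. alpha_energy \<alpha> vol M N (\<gamma> t)) has_real_derivative 0) (at 0)"
    using harmonic assms(1-3) by (simp add: alpha_harmonic_def)
  ultimately have "(\<integral>x. dird 1 (\<lambda>t. ?e t x) 0 \<partial>vol) = 0"
    using DERIV_unique by (fastforce simp: alpha_energy_def)
  then have "(\<integral>x. first_variation_integrand \<alpha> \<psi> X x \<partial>vol) = 0" using \<alpha> unfolding 1 by simp
  with int show ?thesis by (simp add: has_bochner_integral_iff)
qed

lemma first_variation_field:
  assumes X: "vector_field_along M N \<psi> X"
  shows "has_bochner_integral vol (first_variation_integrand \<alpha> \<psi> X) 0"
proof -
  have "\<exists>\<beta> K d. d \<in> atlas N \<and> smooth_scalar M \<beta> \<and> \<beta> x > 0 \<and> (\<forall>x. \<beta> x \<ge> 0) \<and> compact K \<and>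
      K \<subseteq> \<psi> -` chart_dom d \<and> (\<forall>x. x \<notin> K \<longrightarrow> \<beta> x = 0)" for x
  proof -
    obtain d where d: "d \<in> atlas N" "\<psi> x \<in> chart_dom d" by (rule N.chart_exists)
    have W: "open (\<psi> -` chart_dom d)" "x \<in> \<psi> -` chart_dom d"
      using open_smooth_map_vimage[OF smooth_psi N.open_chart_dom[OF d(1)]] d(2) by auto
    show ?thesis using M.bump_exists[OF W] d(1) by metis
  qed
  then obtain \<beta> K d where \<beta>: "\<And>x. d x \<in> atlas N" "\<And>x. smooth_scalar M (\<beta> x)" "\<And>x. \<beta> x x > (0::real)"
      "\<And>x y. \<beta> x y \<ge> 0" "\<And>x. compact (K x)" "\<And>x. K x \<subseteq> \<psi> -` chart_dom (d x)"
      "\<And>x y. y \<notin> K x \<Longrightarrow> \<beta> x y = 0"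
    by metis
  have cont: "continuous_on UNIV (\<beta> x)" for x
    using \<beta>(2)[of x] by (intro M.continuous_on_chartwise) (auto simp: smooth_scalar_def)
  have "open {y. \<beta> x y > 0}" for x
    by (rule open_Collect_less[OF continuous_on_const cont])
  moreover have "UNIV \<subseteq> (\<Union>x\<in>UNIV. {y. \<beta> x y > 0})" using \<beta>(3) by blast
  ultimately obtain I where I: "finite I" "UNIV \<subseteq> (\<Union>x\<in>I. {y. \<beta> x y > 0})"
    using compactE_image[OF cpt, of UNIV "\<lambda>x. {y. \<beta> x y > 0}"] by metis
  define \<sigma> where "\<sigma> y = (\<Sum>x\<in>I. \<beta> x y)" for y
  have \<sigma>: "\<sigma> y > 0" for y
  proof -
    obtain x where "x \<in> I" "\<beta> x y > 0" using I(2) by blast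
    then show ?thesis unfolding \<sigma>_def using I(1) \<beta>(4) by (intro sum_pos2[of I x]) auto
  qed
  have "smooth_on (chart_img c) (\<lambda>y. 1 / \<sigma> (chart_inv c y))" if c: "c \<in> atlas M" for c
    unfolding \<sigma>_def using \<beta>(2) c \<sigma>[unfolded \<sigma>_def, THEN less_imp_neq]
    by (intro smooth_on_divide smooth_on_sum smooth_on_const M.open_chart_img)
      (auto simp: smooth_scalar_def dest: not_sym)
  then have "smooth_scalar M (\<lambda>y. 1 / \<sigma> y)" by (simp add: smooth_scalar_def)
  note Y = vector_field_along_scale[OF smooth_psi X this]
  let ?Y = "\<lambda>d y. (1 / \<sigma> y) *\<^sub>R X d y"
  have "has_bochner_integral vol (first_variation_integrand \<alpha> \<psi> (\<lambda>d y. \<beta> x y *\<^sub>R ?Y d y)) 0" for x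
  proof (rule local_variation[OF smooth_psi Y \<beta>(1)[of x] \<beta>(2)[of x] \<beta>(5)[of x] \<beta>(6)[of x]])
    show "\<beta> x y = 0" if "y \<notin> K x" for y by (rule \<beta>(7)[OF that])
  qed (rule first_variation_velocity)
  then have "has_bochner_integral vol (\<lambda>y. \<Sum>x\<in>I. first_variation_integrand \<alpha> \<psi> (\<lambda>d y. \<beta> x y *\<^sub>R ?Y d y) y) (\<Sum>x\<in>I. 0)"
    by (intro has_bochner_integral_sum)
  moreover have "(\<Sum>x\<in>I. first_variation_integrand \<alpha> \<psi> (\<lambda>d y. \<beta> x y *\<^sub>R ?Y d y) y) = first_variation_integrand \<alpha> \<psi> X y" for y
  proof -
    have XY: "X = (\<lambda>d y. \<Sum>x\<in>I. \<beta> x y *\<^sub>R ?Y d y)"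
      using \<sigma> by (auto simp: fun_eq_iff scaleR_sum_left[symmetric] \<sigma>_def[symmetric] less_imp_neq[symmetric]
          simp flip: sum_divide_distrib)
    have "nabla_dot M N \<psi> X y = nabla_dot M N \<psi> (\<lambda>d y. \<Sum>x\<in>I. \<beta> x y *\<^sub>R ?Y d y) y"
      by (rule arg_cong[OF XY, of "\<lambda>Z. nabla_dot M N \<psi> Z y"])
    also have "\<dots> = (\<Sum>x\<in>I. nabla_dot M N \<psi> (\<lambda>d y. \<beta> x y *\<^sub>R ?Y d y) y)"
      by (rule nabla_dot_sum[OF smooth_psi vector_field_along_scale[OF smooth_psi Y \<beta>(2)]])
    finally show ?thesis by (simp add: first_variation_integrand_def sum_distrib_left)
  qed
  ultimately show ?thesis by simp
qed

end

end

lemma dird_dird_apply: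
  fixes T :: "'y::euclidean_space \<Rightarrow> 'f::real_normed_vector" and w :: "'z::euclidean_space \<Rightarrow> 'y"
  assumes "open U" "open V" "smooth_on V T" "g ` U \<subseteq> V" "smooth_on U g" "smooth_on U w" "z \<in> U"
  shows "dird v (\<lambda>z. dird (w z) T (g z)) z
    = dird (dird v g z) (dird (w z) T) (g z) + dird (dird v w z) T (g z)"
proof -
  have "\<forall>y\<in>V. bilinear (\<lambda>u (r::real). r *\<^sub>R dird u T y)"
  proof
    fix y assume "y \<in> V"
    note l = linear_dird[OF assms(3) this]
    show "bilinear (\<lambda>u (r::real). r *\<^sub>R dird u T y)"
      by (auto simp: bilinear_def linear_iff linear_add[OF l] linear_scale[OF l] algebra_simps)
  qed
  from dird_bilinear_family[OF assms(1,2) this _ assms(4-6) smooth_on_const[OF assms(1), of "1::real"] assms(7), of v]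
  show ?thesis
    using smooth_on_linear_comp[OF bounded_linear_scaleR_right assms(2) smooth_on_dird[OF assms(3)]]
    by (simp add: dird_const)
qed

context riem_manifold
begin

lemma christoffel_transition:
  assumes c: "c \<in> atlas M" "c' \<in> atlas M" "x \<in> chart_dom c" "x \<in> chart_dom c'"
  defines "T \<equiv> transition c c'" and "y \<equiv> chart_map c x"
  shows "dird (christoffel (coord_metric M c) y u u) T y = dird u (dird u T) y
    + christoffel (coord_metric M c') (chart_map c' x) (dird u T y) (dird u T y)"
proof -
  let ?k = "coord_metric M c" and ?k' = "coord_metric M c'"
  interpret C: local_metric "chart_img c" ?k by (rule local_metric[OF c(1)])
  interpret C': local_metric "chart_img c'" ?k' by (rule local_metric[OF c(2)])
  let ?U = "chart_map c ` (chart_dom c \<inter> chart_dom c')"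
  have U: "open ?U" by (rule open_overlap[OF c(1,2)])
  have T: "T ` ?U \<subseteq> chart_img c'" "smooth_on ?U T"
    using smooth_transition[OF c(1,2)] by (auto simp: T_def transition_def chart_inv_map[OF c(1)])
  have y: "y \<in> ?U" "y \<in> chart_img c" using c by (auto simp: y_def)
  have Ty: "T y = chart_map c' x" by (simp add: T_def transition_def y_def chart_inv_map[OF c(1,3)])
  have Tyi: "T y \<in> chart_img c'" using T(1) y(1) by blast
  have met: "?k p a b = ?k' (T p) (dird a T p) (dird b T p)" if p: "p \<in> ?U" for p a b
  proof -
    obtain q where q: "p = chart_map c q" "q \<in> chart_dom c" "q \<in> chart_dom c'" using p by blast
    have "T p = chart_map c' q" by (simp add: T_def transition_def q(1) chart_inv_map[OF c(1) q(2)])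
    then show ?thesis
      using metric_transform[OF c(1,2) q(2,3)] by (simp add: q(1) coord_metric_eq c q T_def)
  qed
  have D: "dird w (\<lambda>p. ?k p a b) y = ?k' (T y) (C'.cov T w (dird a T) y) (dird b T y)
      + ?k' (T y) (dird a T y) (C'.cov T w (dird b T) y)" for w a b
  proof -
    have "dird w (\<lambda>p. ?k p a b) y = dird w (\<lambda>p. ?k' (T p) (dird a T p) (dird b T p)) y"
      by (rule dird_cong_open[OF U y(1) met])
    also have "\<dots> = ?k' (T y) (C'.cov T w (dird a T) y) (dird b T y)
      + ?k' (T y) (dird a T y) (C'.cov T w (dird b T) y)"
      by (rule C'.dird_k_along[OF U T smooth_on_dird[OF T(2)] smooth_on_dird[OF T(2)] y(1)])
    finally show ?thesis .
  qed
  have "dird (christoffel ?k y u u) T y = C'.cov T u (dird u T) y"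
  proof (rule inner_form_eqI[OF C'.inner_form_k[OF Tyi]])
    fix w'
    obtain b where b: "orthonormal_basis (metric M c x) b"
      using orthonormal_basis_exists[OF inner_form_metric[OF c(1,3)]] by blast
    have "surj (\<lambda>u. dird u T y)"
      using linear_injective_imp_surjective[OF linear_transition[OF c] orthonormal_basis_transition(2)[OF c b]]
      by (simp add: T_def y_def)
    then obtain w where w: "w' = dird w T y" by (metis surjD)
    have "?k' (T y) (dird (christoffel ?k y u u) T y) w' = C.koszul y u u w"
      unfolding w met[OF y(1), symmetric] by (rule C.k_christoffel[OF y(2)])
    also have "\<dots> = ?k' (T y) (C'.cov T u (dird u T) y) w'"
      unfolding C.koszul_def D w
      using C'.cov_commute[OF U T y(1), of u w] C'.sym_k[OF Tyi, of "dird u T y" "C'.cov T w (dird u T) y"]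
      by simp
    finally show "?k' (T y) (dird (christoffel ?k y u u) T y) w' = ?k' (T y) (C'.cov T u (dird u T) y) w'" .
  qed
  then show ?thesis by (simp add: C'.cov_def Ty)
qed

end

context two_manifolds
begin

lemma acceleration_field:
  fixes P :: "'p::euclidean_space set"
  assumes P: "open P" and F: "smooth_family P M N F" and p0: "p0 \<in> P"
    and \<upsilon>: "vector_field_along M N (F p0) \<upsilon>"
    and vel: "\<And>d x. d \<in> atlas N \<Longrightarrow> F p0 x \<in> chart_dom d \<Longrightarrow> dird u (\<lambda>p. chart_map d (F p x)) p0 = \<upsilon> d x"
      "\<And>d x. d \<in> atlas N \<Longrightarrow> F p0 x \<in> chart_dom d \<Longrightarrow> dird v (\<lambda>p. chart_map d (F p x)) p0 = \<upsilon> d x"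
  defines "W \<equiv> \<lambda>d x. dird v (\<lambda>p. dird u (\<lambda>p. chart_map d (F p x)) p) p0
    + christoffel (coord_metric N d) (chart_map d (F p0 x)) (\<upsilon> d x) (\<upsilon> d x)"
  shows "vector_field_along M N (F p0) W"
    and "\<And>c d y. c \<in> atlas M \<Longrightarrow> d \<in> atlas N \<Longrightarrow> (p0, y) \<in> fam_dom P c d F \<Longrightarrow>
      local_metric.cov (coord_metric N d) (fam_rep c d F) (v, 0) (dird (u, 0) (fam_rep c d F)) (p0, y)
      = W d (chart_inv c y)"
proof -
  note \<psi> = smooth_map_slice[OF P F p0]
  show cov: "local_metric.cov (coord_metric N d) (fam_rep c d F) (v, 0) (dird (u, 0) (fam_rep c d F)) (p0, y)
      = W d (chart_inv c y)" if c: "c \<in> atlas M" and d: "d \<in> atlas N" and y: "(p0, y) \<in> fam_dom P c d F" for c d y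
  proof -
    interpret Nd: local_metric "chart_img d" "coord_metric N d" by (rule N.local_metric[OF d])
    have "y \<in> chart_img c" and x2: "F p0 (chart_inv c y) \<in> chart_dom d"
      using y by (auto simp: fam_dom_eq[OF P F c])
    note x = M.chart_inv_in[OF this(1)] x2
    obtain b where b: "orthonormal_basis (metric M c (chart_inv c y)) b"
      using orthonormal_basis_exists[OF M.inner_form_metric[OF c x(1)]] by blast
    note ctx = P F p0 c x(1) d x(2) b
    show ?thesis
      unfolding Nd.cov_def W_def dird2_f_slice[OF ctx y] dird_f_slice[OF ctx y] vel[OF d x(2)]
      by (simp add: fam_rep_def coord_rep_def)
  qed
  show "vector_field_along M N (F p0) W"
  proof (rule vector_field_alongI)
    fix c d assume c: "c \<in> atlas M" and d: "d \<in> atlas N"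
    interpret Nd: local_metric "chart_img d" "coord_metric N d" by (rule N.local_metric[OF d])
    let ?f = "fam_rep c d F" and ?U = "fam_dom P c d F" and ?V = "chart_map c ` (chart_dom c \<inter> F p0 -` chart_dom d)"
    have V: "open ?V" by (rule open_rep_dom[OF \<psi> c d])
    have mem: "(p0, y) \<in> ?U" if "y \<in> ?V" for y
      using that p0 by (auto simp: mem_fam_dom[OF P F c])
    note along = open_fam_dom[OF P F c d] fam_rep_img[OF P F c] smooth_fam_rep[OF P F c d]
    have "smooth_on ?V (\<lambda>y. Nd.cov ?f (v, 0) (dird (u, 0) ?f) (p0, y))"
      by (rule smooth_on_compose[OF V along(1) _ 
          smooth_on_Pair[OF V smooth_on_const[OF V] smooth_on_linear[OF bounded_linear_ident V]]
          Nd.smooth_cov[OF along smooth_on_dird[OF along(3)]]]) (use mem in blast)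
    then show "smooth_on ?V (\<lambda>y. W d (chart_inv c y))"
      by (rule smooth_on_cong[OF V, rotated]) (use cov[OF c d mem] in simp)
  next
    fix d d' x assume d: "d \<in> atlas N" "d' \<in> atlas N" "F p0 x \<in> chart_dom d" "F p0 x \<in> chart_dom d'"
    let ?T = "transition d d'" and ?g = "\<lambda>p. chart_map d (F p x)" and ?V = "chart_map d ` (chart_dom d \<inter> chart_dom d')"
    let ?U = "{p \<in> P. F p x \<in> chart_dom d} \<inter> {p \<in> P. F p x \<in> chart_dom d'}"
    have U: "open ?U" "p0 \<in> ?U"
      using d p0 by (auto intro!: open_Int smooth_on_param(1)[OF P F])
    note V = N.open_overlap[OF d(1,2)] and T = N.smooth_transition[OF d(1,2)]
    have g: "?g ` ?U \<subseteq> ?V" "smooth_on ?U ?g"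
      using smooth_on_subset[OF smooth_on_param(2)[OF P F d(1)], of ?U x] by auto
    have "dird u (\<lambda>p. chart_map d' (F p x)) p = dird (dird u ?g p) ?T (?g p)" if p: "p \<in> ?U" for p
    proof -
      have "dird u (\<lambda>p. chart_map d' (F p x)) p = dird u (\<lambda>p. ?T (?g p)) p"
        by (rule dird_cong_open[OF U(1) p]) (auto simp: transition_def N.chart_inv_map[OF d(1)])
      also have "\<dots> = dird (dird u ?g p) ?T (?g p)"
        by (rule dird_compose[OF g(2) T p]) (use g(1) p in blast)
      finally show ?thesis .
    qed
    then have "dird v (\<lambda>p. dird u (\<lambda>p. chart_map d' (F p x)) p) p0 = dird v (\<lambda>p. dird (dird u ?g p) ?T (?g p)) p0"
      by (rule dird_cong_open[OF U])
    also have "\<dots> = dird (\<upsilon> d x) (dird (\<upsilon> d x) ?T) (?g p0) + dird (dird v (dird u ?g) p0) ?T (?g p0)"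
      unfolding dird_dird_apply[OF U(1) V T g smooth_on_dird[OF g(2)] U(2)] vel[OF d(1,3)] ..
    finally have "W d' x = dird (dird v (dird u ?g) p0) ?T (?g p0) + (dird (\<upsilon> d x) (dird (\<upsilon> d x) ?T) (?g p0)
      + christoffel (coord_metric N d') (chart_map d' (F p0 x)) (\<upsilon> d' x) (\<upsilon> d' x))"
      by (simp add: W_def)
    also have "\<dots> = dird (dird v (dird u ?g) p0) ?T (?g p0)
      + dird (christoffel (coord_metric N d) (?g p0) (\<upsilon> d x) (\<upsilon> d x)) ?T (?g p0)"
      unfolding N.christoffel_transition[OF d] field_transform[OF \<upsilon> d] ..
    also have "\<dots> = dird (W d x) ?T (?g p0)"
      unfolding W_def by (rule linear_add[OF N.linear_transition[OF d], symmetric])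
    finally show "W d' x = dird (W d x) ?T (?g p0)" .
  qed
qed

lemma second_variation_eq:
  fixes \<alpha> \<epsilon> :: real and vol :: "'a measure"
  assumes \<epsilon>: "\<epsilon> > 0" and F: "smooth_family ({-\<epsilon><..<\<epsilon>} \<times> {-\<epsilon><..<\<epsilon>}) M N F"
    and vol: "finite_measure vol" "sets vol = sets borel" "compact (UNIV :: 'a set)"
  defines "e \<equiv> \<lambda>p x. (1 + (hs_norm_diff M N (F p) x)\<^sup>2) powr \<alpha>"
  shows "second_variation \<alpha> vol M N F
      = (\<integral>x. dird (1, 0) (\<lambda>p. dird (0, 1) (\<lambda>p. e p x) p) (0, 0) \<partial>vol)"
    and "integrable vol (\<lambda>x. dird (1, 0) (\<lambda>p. dird (0, 1) (\<lambda>p. e p x) p) (0, 0))"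
proof -
  let ?P = "{-\<epsilon><..<\<epsilon>} \<times> {-\<epsilon><..<\<epsilon>}"
  have P: "open ?P" "(0, 0) \<in> ?P" using \<epsilon> by (auto intro: open_Times)
  have e: "smooth_fun ?P M e" unfolding e_def by (rule smooth_fun_energy_density[OF P(1) F])
  let ?g = "\<lambda>p x. dird (0, 1) (\<lambda>p. e p x) p"
  have g: "smooth_fun ?P M ?g" by (rule M.smooth_fun_dird[OF P(1) e])
  have inner: "deriv (\<lambda>s. alpha_energy \<alpha> vol M N (F (t, s))) 0 = (\<integral>x. ?g (t, 0) x \<partial>vol)" if "t \<in> {-\<epsilon><..<\<epsilon>}" for t
    using M.smooth_fun_integral_deriv[OF P(1) e _ vol, of "(t, 0)" "(0, 1)"] that \<epsilon>
    by (intro DERIV_imp_deriv) (simp add: alpha_energy_def e_def)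
  have "((\<lambda>t. \<integral>x. ?g (t, 0) x \<partial>vol) has_real_derivative (\<integral>x. dird (1, 0) (\<lambda>p. ?g p x) (0, 0) \<partial>vol)) (at 0)"
    using M.smooth_fun_integral_deriv[OF P(1) g P(2) vol, of "(1, 0)"] by simp
  then have "((\<lambda>t. deriv (\<lambda>s. alpha_energy \<alpha> vol M N (F (t, s))) 0) has_real_derivative
      (\<integral>x. dird (1, 0) (\<lambda>p. ?g p x) (0, 0) \<partial>vol)) (at 0)"
    by (rule has_field_derivative_transform_within_open[of _ _ _ "{-\<epsilon><..<\<epsilon>}"]) (use \<epsilon> inner in auto)
  then show "second_variation \<alpha> vol M N F = (\<integral>x. dird (1, 0) (\<lambda>p. ?g p x) (0, 0) \<partial>vol)"
    unfolding second_variation_def by (rule DERIV_imp_deriv)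
  show "integrable vol (\<lambda>x. dird (1, 0) (\<lambda>p. ?g p x) (0, 0))"
    by (rule M.smooth_fun_integrable[OF P(1) M.smooth_fun_dird[OF P(1) g] vol P(2)])
qed

end

section \<open>Stability\<close>

theorem corollary11:
  fixes \<alpha> :: real
    and M :: "('a::{t2_space,second_countable_topology}, real^'m) riem"
    and N :: "('b::{t2_space,second_countable_topology}, real^'n) riem"
    and vol :: "'a measure"
    and \<psi> :: "'a \<Rightarrow> 'b"
  assumes "\<alpha> > 1"
    and "riemannian_manifold M" and "compact (UNIV :: 'a set)"
    and "riemannian_volume M vol"
    and "riemannian_manifold N" and "nonpositive_sectional_curvature N"
    and "alpha_harmonic \<alpha> vol M N \<psi>"
  shows "alpha_stable \<alpha> vol M N \<psi>"
proof -
  interpret two_manifolds M N using assms(2,5) by unfold_locales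
  note harm = assms(1,3,4,7)
  show ?thesis
    unfolding alpha_stable_def
  proof (intro allI impI, elim conjE)
    fix \<upsilon> F assume \<upsilon>: "vector_field_along M N \<psi> \<upsilon>" and "two_parameter_variation M N \<psi> \<upsilon> \<upsilon> F"
    then obtain \<epsilon> where \<epsilon>: "\<epsilon> > 0" and F: "smooth_family ({-\<epsilon><..<\<epsilon>} \<times> {-\<epsilon><..<\<epsilon>}) M N F"
      and F0: "F (0, 0) = \<psi>" and vel: "has_velocity N (\<lambda>t. F (t, 0)) \<upsilon>" "has_velocity N (\<lambda>s. F (0, s)) \<upsilon>"
      by (auto simp: two_parameter_variation_def)
    let ?P = "{-\<epsilon><..<\<epsilon>} \<times> {-\<epsilon><..<\<epsilon>}" and ?t = "(1, 0) :: real \<times> real" and ?s = "(0, 1) :: real \<times> real"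
    have P: "open ?P" "(0, 0) \<in> ?P" using \<epsilon> by (auto intro: open_Times)
    have v: "dird ?s (\<lambda>p. chart_map d (F p x)) (0, 0) = \<upsilon> d x" "dird ?t (\<lambda>p. chart_map d (F p x)) (0, 0) = \<upsilon> d x"
      if "d \<in> atlas N" "F (0, 0) x \<in> chart_dom d" for d x
      using velocity_dird[OF P(1) F P(2) _ that, of ?s \<upsilon>] velocity_dird[OF P(1) F P(2) _ that, of ?t \<upsilon>] vel
      by simp_all
    let ?e = "\<lambda>p x. (1 + (hs_norm_diff M N (F p) x)\<^sup>2) powr \<alpha>"
    define W where "W d x = dird ?t (\<lambda>p. dird ?s (\<lambda>p. chart_map d (F p x)) p) (0, 0)
      + christoffel (coord_metric N d) (chart_map d (F (0, 0) x)) (\<upsilon> d x) (\<upsilon> d x)" for d x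
    have acc: "vector_field_along M N (F (0, 0)) W"
      unfolding W_def by (rule acceleration_field(1)[OF P(1) F P(2) \<upsilon>[folded F0] v])
    have cov: "local_metric.cov (coord_metric N d) (fam_rep c d F) (?t, 0) (dird (?s, 0) (fam_rep c d F)) ((0, 0), y)
        = W d (chart_inv c y)"
      if "c \<in> atlas M" "d \<in> atlas N" "((0, 0), y) \<in> fam_dom ?P c d F" for c d y
      unfolding W_def by (rule acceleration_field(2)[OF P(1) F P(2) \<upsilon>[folded F0] v that])
    have W: "has_bochner_integral vol (first_variation_integrand \<alpha> \<psi> W) 0"
      by (rule first_variation_field[OF harm]) (use acc F0 in simp)
    have ge: "2 * \<alpha> * first_variation_integrand \<alpha> \<psi> W x \<le> dird ?t (\<lambda>p. dird ?s (\<lambda>p. ?e p x) p) (0, 0)" for x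
    proof -
      define c where "c = chart_at M x"
      define d where "d = chart_at N (F (0, 0) x)"
      define b where "b = (SOME b. orthonormal_basis (metric M c x) b)"
      note c = M.chart_at[of x, folded c_def] and d = N.chart_at[of "F (0, 0) x", folded d_def]
      have b: "orthonormal_basis (metric M c x) b"
        unfolding b_def by (rule someI_ex[OF orthonormal_basis_exists[OF M.inner_form_metric[OF c]]])
      note ctx = P(1) F P(2) c d b
      let ?f = "fam_rep c d F" and ?z = "((0, 0) :: real \<times> real, chart_map c x)"
      interpret Nd: local_metric "chart_img d" "coord_metric N d" by (rule N.local_metric[OF d(1)])
      note f = rep_smooth[OF ctx]
      define q where "q w = (\<Sum>e\<in>b. coord_metric N d (?f w) (dird (0, e) ?f w) (dird (0, e) ?f w))" for w
      have eq: "dird (?s, 0) ?f ((0, 0), y) = dird (?t, 0) ?f ((0, 0), y)" if "((0, 0), y) \<in> fam_dom ?P c d F" for y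
      proof -
        have "F (0, 0) (chart_inv c y) \<in> chart_dom d" using that by (simp add: fam_dom_eq[OF P(1) F c(1)])
        then show ?thesis by (simp only: dird_f_slice[OF ctx that] v[OF d(1)])
      qed
      have "nabla_dot M N (F (0, 0)) W x = (\<Sum>e\<in>b. coord_metric N d (?f ?z)
          (Nd.cov ?f (0, e) (Nd.cov ?f (?t, 0) (dird (?s, 0) ?f)) ?z) (dird (0, e) ?f ?z))"
        unfolding nabla_dot_def Let_def c_def[symmetric] d_def[symmetric] b_def[symmetric]
        by (rule nabla_slice[OF ctx Nd.smooth_cov[OF along[OF ctx] smooth_on_dird[OF f]] cov[OF c(1) d(1)], symmetric])
      moreover have "dird (?t, 0) (dird (?s, 0) (\<lambda>w. (1 + q w) powr \<alpha>)) ?z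
          \<ge> 2 * \<alpha> * (1 + q ?z) powr (\<alpha> - 1) * (\<Sum>e\<in>b. coord_metric N d (?f ?z)
            (Nd.cov ?f (0, e) (Nd.cov ?f (?t, 0) (dird (?s, 0) ?f)) ?z) (dird (0, e) ?f ?z))"
        unfolding q_def by (rule second_density_ge[OF ctx assms(6,1) eq])
      ultimately show ?thesis
        unfolding dird2_density_slice[OF ctx] q_def hs_eq_q[OF ctx P(2) d(2), symmetric] F0
        by (simp add: first_variation_integrand_def mult.assoc)
    qed
    note fin = M.finite_volume[OF assms(3,4)] and sv = sets_vol[OF harm]
    note sec = second_variation_eq[OF \<epsilon> F fin sv assms(3), of \<alpha>]
    have "0 = (\<integral>x. 2 * \<alpha> * first_variation_integrand \<alpha> \<psi> W x \<partial>vol)"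
      using W by (simp add: has_bochner_integral_iff)
    also have "\<dots> \<le> second_variation \<alpha> vol M N F"
      unfolding sec(1) using W by (intro integral_mono sec(2) ge) (simp add: has_bochner_integral_iff)
    finally show "0 \<le> second_variation \<alpha> vol M N F" .
  qed
qed

end
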